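(* Let $\Phi,\Psi\in{\bf PFm}$ be modal formulas of ${\rm FP}(Ł,Ł)$ and let $\mathcal{E}$ be the set of events occurring in them. Then $\Phi\vdash_{FP}\Psi$ if and only if $\Phi\models_{\mathcal{E}}\Psi$.
   Context: Łukasiewicz logic Ł: formulas are built from propositional variables using $\oplus,\neg,\bot$, with abbreviations $\top=\neg\bot$, $\varphi\to\psi=\neg\varphi\oplus\psi$, $\varphi\odot\psi=\neg(\neg\varphi\oplus\neg\psi)$, $\varphi\vee\psi=(\varphi\to\psi)\to\psi$, $\varphi\wedge\psi=\neg(\neg\varphi\vee\neg\psi)$, $\varphi\leftrightarrow\psi=(\varphi\to\psi)\wedge(\psi\to\varphi)$; axioms $\varphi\to(\psi\to\varphi)$, $(\varphi\to\psi)\to((\psi\to\gamma)\to(\varphi\to\gamma))$, $((\varphi\to\psi)\to\psi)\to((\psi\to\varphi)\to\varphi)$, $(\neg\varphi\to\neg\psi)\to(\psi\to\varphi)$, with modus ponens. $[0,1]_{MV}=([0,1],\oplus,\neg,0)$ with $x\oplus y=\min(1,x+y)$, $\neg x=1-x$; $f_\varphi$ is the truth function (McNaughton function) of a formula $\varphi$ in $[0,1]_{MV}$. ${\rm FP}(Ł,Ł)$: event formulas are Łukasiewicz formulas; modal formulas are built from atomic modal formulas $P(\varphi)$ and $\top,\bot$ by Łukasiewicz connectives, so each has the form $t[P(\varphi_1),\dots,P(\varphi_k)]$; ${\bf PFm}$ is the set of modal formulas. Axioms and rules: Ł for event formulas; Ł for modal formulas; (P1) $\neg P(\varphi)\leftrightarrow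 P(\neg\varphi)$; (P2) $P(\varphi\to\psi)\to(P(\varphi)\to P(\psi))$; (P3) $P(\varphi\oplus\psi)\leftrightarrow[(P(\varphi)\to P(\varphi\odot\psi))\to P(\psi)]$; (N) from $\varphi$ derive $P(\varphi)$. For events $\mathcal{E}=\{\varphi_1,\dots,\varphi_k\}$ in variables $x_1,\dots,x_n$, the coherent set $\mathscr{C}_{\mathcal{E}}\subseteq[0,1]^k$ is the closed convex hull of $\{(f_{\varphi_1}(x),\dots,f_{\varphi_k}(x)):x\in[0,1]^n\}$. ${\rm Free}(\mathcal{E})$ is the free MV-algebra on generators $p_{\varphi_1},\dots,p_{\varphi_k}$, identified with the algebra of McNaughton functions $[0,1]^k\to[0,1]$; for $S\subseteq[0,1]^k$, ${\rm Free}(\mathcal{E})/S$ is its quotient by the congruence $f\sim g$ iff $f$ and $g$ agree on $S$. ${\rm Term}(\mathcal{E})$ is the term algebra over $p_{\varphi_1},\dots,p_{\varphi_k}$. Translation: $\Phi^\bullet$ is obtained from $\Phi=t[P(\varphi_1),\dots,P(\varphi_k)]$ as the term $t[p_{\varphi_1},\dots,p_{\varphi_k}]$. $v_{\mathcal{E}}:{\rm Term}(\mathcal{E})\to{\rm Free}(\mathcal{E})/\mathscr{C}_{\mathcal{E}}$ is the homomorphism sending each $p_{\varphi_i}$ to its class. A coherent MV-algebra is an MV-algebra isomorphic to ${\rm Free}(k)/\mathscr{C}$ with $\mathscr{C}=\mathscr{C}_{\mathcal{E}'}$ for some set of $k$ events $\mathcal{E}'$. If $\mathbf{A}$ is isomorphic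 to ${\rm Free}(\mathcal{E})/\mathscr{C}_{\mathcal{E}}$ via $f$, then $f\circ v_{\mathcal{E}}:{\rm Term}(\mathcal{E})\to\mathbf{A}$ is a coherent valuation over $\mathcal{E}$. $\Phi\models_{\mathcal{E}}\Psi$ means: for every MV-algebra $\mathbf{A}$ isomorphic to ${\rm Free}(\mathcal{E})/\mathscr{C}_{\mathcal{E}}$, every coherent valuation $e:{\rm Term}(\mathcal{E})\to\mathbf{A}$ over $\mathcal{E}$, and every homomorphism $h:\mathbf{A}\to[0,1]_{MV}$, $h(e(\Phi^\bullet))=1$ implies $h(e(\Psi^\bullet))=1$.
   Formalization: The listed axioms of Ł do not prove ¬⊥ when ⊕ and ⊥ are primitive (⊥ can be read as 1/2), so completeness fails; the axioms ¬⊥, (φ⊕ψ)→(¬φ→ψ) and (¬φ→ψ)→(φ⊕ψ) are added to Ł. *)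

theory Defs
  imports "HOL-Analysis.Analysis" "HOL-Library.Function_Algebras"
begin

text \<open>Formulas over a set of atoms. The same type serves for event formulas (the atoms are
  propositional variables), for modal formulas (the atoms are \<open>P(\<phi>)\<close>), and for terms in the
  signature of MV-algebras (the atoms are generators, \<open>Bot\<close> is the constant 0).\<close>

datatype (atoms: 'a) fm =
    Atom 'a
  | Bot
  | Neg "'a fm"
  | Oplus "'a fm" "'a fm"

definition Top :: "'a fm" where
  "Top = Neg Bot"

definition Imp :: "'a fm \<Rightarrow> 'a fm \<Rightarrow> 'a fm" where
  "Imp \<phi> \<psi> = Oplus (Neg \<phi>) \<psi>"

definition Odot :: "'a fm \<Rightarrow> 'a fm \<Rightarrow> 'a fm" where
  "Odot \<phi> \<psi> = Neg (Oplus (Neg \<phi>) (Neg \<psi>))"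

definition Or :: "'a fm \<Rightarrow> 'a fm \<Rightarrow> 'a fm" where
  "Or \<phi> \<psi> = Imp (Imp \<phi> \<psi>) \<psi>"

definition And :: "'a fm \<Rightarrow> 'a fm \<Rightarrow> 'a fm" where
  "And \<phi> \<psi> = Neg (Or (Neg \<phi>) (Neg \<psi>))"

definition Iff :: "'a fm \<Rightarrow> 'a fm \<Rightarrow> 'a fm" where
  "Iff \<phi> \<psi> = And (Imp \<phi> \<psi>) (Imp \<psi> \<phi>)"

text \<open>The four axiom schemes \<open>L1\<close>--\<open>L4\<close> are those of Lukasiewicz's implication-negation
  calculus. They do not mention \<open>Bot\<close>, and they mention \<open>Oplus\<close> only with a
  negated left argument. Since \<open>Oplus\<close> and \<open>Bot\<close> are primitive here,
  the schemes alone would prove neither \<open>Top\<close> nor the commutativity of \<open>Oplus\<close>.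
  The last three schemes express that \<open>Oplus \<phi> \<psi>\<close> is \<open>\<not>\<phi> \<rightarrow> \<psi>\<close> and that \<open>Bot\<close> is falsum, as in
  every presentation of Lukasiewicz logic; all are valid in the standard MV-algebra.\<close>

inductive luk_axiom :: "'a fm \<Rightarrow> bool" where
  L1: "luk_axiom (Imp \<phi> (Imp \<psi> \<phi>))"
| L2: "luk_axiom (Imp (Imp \<phi> \<psi>) (Imp (Imp \<psi> \<gamma>) (Imp \<phi> \<gamma>)))"
| L3: "luk_axiom (Imp (Imp (Imp \<phi> \<psi>) \<psi>) (Imp (Imp \<psi> \<phi>) \<phi>))"
| L4: "luk_axiom (Imp (Imp (Neg \<phi>) (Neg \<psi>)) (Imp \<psi> \<phi>))"
| Oplus_left: "luk_axiom (Imp (Oplus \<phi> \<psi>) (Imp (Neg \<phi>) \<psi>))"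
| Oplus_right: "luk_axiom (Imp (Imp (Neg \<phi>) \<psi>) (Oplus \<phi> \<psi>))"
| Bot_false: "luk_axiom (Neg Bot)"

inductive luk_provable :: "'a fm \<Rightarrow> bool" where
  axiom: "luk_axiom \<phi> \<Longrightarrow> luk_provable \<phi>"
| mp: "luk_provable \<phi> \<Longrightarrow> luk_provable (Imp \<phi> \<psi>) \<Longrightarrow> luk_provable \<psi>"

type_synonym event = "nat fm"

datatype prob_atom = P (event_of: event)

type_synonym modal = "prob_atom fm"

abbreviation Pr :: "event \<Rightarrow> modal" where
  "Pr \<phi> \<equiv> Atom (P \<phi>)"

text \<open>Premises are modal formulas, so the event formula in the necessitation
  rule is always a theorem of Lukasiewicz logic.\<close>

inductive fp_derives :: "modal set \<Rightarrow> modal \<Rightarrow> bool" (infix "\<turnstile>\<^sub>F\<^sub>P" 50)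
  for \<Gamma> :: "modal set" where
  premise: "\<Phi> \<in> \<Gamma> \<Longrightarrow> \<Gamma> \<turnstile>\<^sub>F\<^sub>P \<Phi>"
| luk: "luk_axiom \<Phi> \<Longrightarrow> \<Gamma> \<turnstile>\<^sub>F\<^sub>P \<Phi>"
| mp: "\<Gamma> \<turnstile>\<^sub>F\<^sub>P \<Phi> \<Longrightarrow> \<Gamma> \<turnstile>\<^sub>F\<^sub>P Imp \<Phi> \<Psi> \<Longrightarrow> \<Gamma> \<turnstile>\<^sub>F\<^sub>P \<Psi>"
| P1: "\<Gamma> \<turnstile>\<^sub>F\<^sub>P Iff (Neg (Pr \<phi>)) (Pr (Neg \<phi>))"
| P2: "\<Gamma> \<turnstile>\<^sub>F\<^sub>P Imp (Pr (Imp \<phi> \<psi>)) (Imp (Pr \<phi>) (Pr \<psi>))"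
| P3: "\<Gamma> \<turnstile>\<^sub>F\<^sub>P Iff (Pr (Oplus \<phi> \<psi>)) (Imp (Imp (Pr \<phi>) (Pr (Odot \<phi> \<psi>))) (Pr \<psi>))"
| N: "luk_provable \<phi> \<Longrightarrow> \<Gamma> \<turnstile>\<^sub>F\<^sub>P Pr \<phi>"

definition events :: "modal \<Rightarrow> event set" where
  "events \<Phi> = event_of ` atoms \<Phi>"

text \<open>Structures in the signature of MV-algebras.\<close>

record 'a mv =
  mv_carrier :: "'a set"
  mv_plus :: "'a \<Rightarrow> 'a \<Rightarrow> 'a"
  mv_neg :: "'a \<Rightarrow> 'a"
  mv_zero :: 'a

locale mv_algebra =
  fixes A :: "'a mv"
  assumes plus_closed: "x \<in> mv_carrier A \<Longrightarrow> y \<in> mv_carrier A \<Longrightarrow> mv_plus A x y \<in> mv_carrier A"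
    and neg_closed: "x \<in> mv_carrier A \<Longrightarrow> mv_neg A x \<in> mv_carrier A"
    and zero_closed: "mv_zero A \<in> mv_carrier A"
    and plus_assoc: "x \<in> mv_carrier A \<Longrightarrow> y \<in> mv_carrier A \<Longrightarrow> z \<in> mv_carrier A \<Longrightarrow>
      mv_plus A (mv_plus A x y) z = mv_plus A x (mv_plus A y z)"
    and plus_commute: "x \<in> mv_carrier A \<Longrightarrow> y \<in> mv_carrier A \<Longrightarrow> mv_plus A x y = mv_plus A y x"
    and plus_zero: "x \<in> mv_carrier A \<Longrightarrow> mv_plus A x (mv_zero A) = x"
    and neg_neg: "x \<in> mv_carrier A \<Longrightarrow> mv_neg A (mv_neg A x) = x"
    and plus_one: "x \<in> mv_carrier A \<Longrightarrow> mv_plus A x (mv_neg A (mv_zero A)) = mv_neg A (mv_zero A)"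
    and lukasiewicz: "x \<in> mv_carrier A \<Longrightarrow> y \<in> mv_carrier A \<Longrightarrow>
      mv_plus A (mv_neg A (mv_plus A (mv_neg A x) y)) y =
      mv_plus A (mv_neg A (mv_plus A (mv_neg A y) x)) x"

definition mv_hom :: "'a mv \<Rightarrow> 'b mv \<Rightarrow> ('a \<Rightarrow> 'b) \<Rightarrow> bool" where
  "mv_hom A B h \<longleftrightarrow>
     h ` mv_carrier A \<subseteq> mv_carrier B \<and>
     h (mv_zero A) = mv_zero B \<and>
     (\<forall>x\<in>mv_carrier A. h (mv_neg A x) = mv_neg B (h x)) \<and>
     (\<forall>x\<in>mv_carrier A. \<forall>y\<in>mv_carrier A. h (mv_plus A x y) = mv_plus B (h x) (h y))"

definition mv_iso :: "'a mv \<Rightarrow> 'b mv \<Rightarrow> ('a \<Rightarrow> 'b) \<Rightarrow> bool" where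
  "mv_iso A B f \<longleftrightarrow> mv_hom A B f \<and> bij_betw f (mv_carrier A) (mv_carrier B)"

definition std_mv :: "real mv" where
  "std_mv = \<lparr>mv_carrier = {0..1}, mv_plus = (\<lambda>x y. min 1 (x + y)), mv_neg = (\<lambda>x. 1 - x), mv_zero = 0\<rparr>"

text \<open>The unique homomorphism from terms to \<open>A\<close> extending the assignment \<open>g\<close>.\<close>

primrec mv_eval :: "'a mv \<Rightarrow> ('g \<Rightarrow> 'a) \<Rightarrow> 'g fm \<Rightarrow> 'a" where
  "mv_eval A g (Atom p) = g p"
| "mv_eval A g Bot = mv_zero A"
| "mv_eval A g (Neg t) = mv_neg A (mv_eval A g t)"
| "mv_eval A g (Oplus s t) = mv_plus A (mv_eval A g s) (mv_eval A g t)"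

definition truth_fun :: "event \<Rightarrow> (nat \<Rightarrow> real) \<Rightarrow> real" where
  "truth_fun \<phi> x = mv_eval std_mv x \<phi>"

definition mv_quotient :: "'a mv \<Rightarrow> 'a rel \<Rightarrow> 'a set mv" where
  "mv_quotient A R =
     \<lparr>mv_carrier = mv_carrier A // R,
      mv_plus = (\<lambda>X Y. \<Union>x\<in>X. \<Union>y\<in>Y. R `` {mv_plus A x y}),
      mv_neg = (\<lambda>X. \<Union>x\<in>X. R `` {mv_neg A x}),
      mv_zero = R `` {mv_zero A}\<rparr>"

text \<open>For a finite set \<open>E\<close> of \<open>k\<close> events, \<open>[0,1]\<^sup>k\<close> is rendered with coordinates indexed by the
  events themselves. Thus \<open>k = 0\<close> is covered, and no enumeration of \<open>E\<close> has to be chosen.\<close>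

definition cube :: "'i set \<Rightarrow> ('i \<Rightarrow> real) set" where
  "cube I = I \<rightarrow>\<^sub>E {0..1}"

text \<open>The pointwise vector space structure and the product topology on \<^typ>\<open>'a \<Rightarrow> real\<close> give
  the usual convexity and topology of \<open>\<real>\<^sup>k\<close> on the functions that are extensional on a
  \<open>k\<close>-element set: these form a closed affine subspace.\<close>

instantiation "fun" :: (type, real_vector) real_vector
begin

definition scaleR_fun :: "real \<Rightarrow> ('a \<Rightarrow> 'b) \<Rightarrow> 'a \<Rightarrow> 'b" where
  "scaleR_fun r f = (\<lambda>x. r *\<^sub>R f x)"

instance
  by standard (auto simp: scaleR_fun_def fun_eq_iff scaleR_add_right scaleR_add_left)

end

definition coherent_set :: "event set \<Rightarrow> (event \<Rightarrow> real) set" where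
  "coherent_set E =
     closure (convex hull ((\<lambda>x. \<lambda>\<phi>\<in>E. truth_fun \<phi> x) ` cube (\<Union>\<phi>\<in>E. atoms \<phi>)))"

text \<open>McNaughton functions: the continuous functions from the cube to \<open>[0,1]\<close> that are piecewise
  affine with integer coefficients. A pair \<open>(b, a)\<close> encodes the affine function
  \<open>b + \<Sum>i\<in>I. a i * x i\<close>.\<close>

definition mcnaughton :: "'i set \<Rightarrow> (('i \<Rightarrow> real) \<Rightarrow> real) set" where
  "mcnaughton I =
     {f \<in> cube I \<rightarrow>\<^sub>E {0..1}. continuous_on (cube I) f \<and>
        (\<exists>L :: (int \<times> ('i \<Rightarrow> int)) set. finite L \<and>
           (\<forall>x\<in>cube I. \<exists>(b, a)\<in>L. f x = of_int b + (\<Sum>i\<in>I. of_int (a i) * x i)))}"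

definition free_mv :: "'i set \<Rightarrow> (('i \<Rightarrow> real) \<Rightarrow> real) mv" where
  "free_mv I =
     \<lparr>mv_carrier = mcnaughton I,
      mv_plus = (\<lambda>f g. \<lambda>x\<in>cube I. mv_plus std_mv (f x) (g x)),
      mv_neg = (\<lambda>f. \<lambda>x\<in>cube I. mv_neg std_mv (f x)),
      mv_zero = (\<lambda>x\<in>cube I. mv_zero std_mv)\<rparr>"

definition free_gen :: "'i set \<Rightarrow> 'i \<Rightarrow> ('i \<Rightarrow> real) \<Rightarrow> real" where
  "free_gen I i = (\<lambda>x\<in>cube I. x i)"

definition agree_cong :: "'i set \<Rightarrow> ('i \<Rightarrow> real) set \<Rightarrow> (('i \<Rightarrow> real) \<Rightarrow> real) rel" where
  "agree_cong I S = {(f, g). f \<in> mcnaughton I \<and> g \<in> mcnaughton I \<and> (\<forall>x\<in>S. f x = g x)}"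

definition free_quot :: "'i set \<Rightarrow> ('i \<Rightarrow> real) set \<Rightarrow> (('i \<Rightarrow> real) \<Rightarrow> real) set mv" where
  "free_quot I S = mv_quotient (free_mv I) (agree_cong I S)"

definition term_alg :: "'i set \<Rightarrow> 'i fm mv" where
  "term_alg I = \<lparr>mv_carrier = {t. atoms t \<subseteq> I}, mv_plus = Oplus, mv_neg = Neg, mv_zero = Bot\<rparr>"

text \<open>The generator \<open>p\<^sub>\<phi>\<close> of the term algebra over \<open>E\<close> is \<open>Atom \<phi>\<close>.\<close>

definition bullet :: "modal \<Rightarrow> event fm" where
  "bullet \<Phi> = map_fm event_of \<Phi>"

definition coh_class :: "event set \<Rightarrow> event fm \<Rightarrow> ((event \<Rightarrow> real) \<Rightarrow> real) set" where
  "coh_class E =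
     mv_eval (free_quot E (coherent_set E))
       (\<lambda>\<phi>. agree_cong E (coherent_set E) `` {free_gen E \<phi>})"

definition coherent_valuation :: "event set \<Rightarrow> 'a mv \<Rightarrow> (event fm \<Rightarrow> 'a) \<Rightarrow> bool" where
  "coherent_valuation E A e \<longleftrightarrow>
     (\<exists>f. mv_iso (free_quot E (coherent_set E)) A f \<and>
          (\<forall>t\<in>mv_carrier (term_alg E). e t = f (coh_class E t)))"

text \<open>The first argument fixes the type of the elements of the algebras \<open>A\<close>, because a formula of
  HOL cannot quantify over types.\<close>

definition fp_entails :: "'a itself \<Rightarrow> event set \<Rightarrow> modal \<Rightarrow> modal \<Rightarrow> bool" where
  "fp_entails (_ :: 'a itself) E \<Phi> \<Psi> \<longleftrightarrow>
     (\<forall>A :: 'a mv. mv_algebra A \<and> (\<exists>f. mv_iso (free_quot E (coherent_set E)) A f) \<longrightarrow>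
        (\<forall>e. coherent_valuation E A e \<longrightarrow>
           (\<forall>h. mv_hom A std_mv h \<longrightarrow> h (e (bullet \<Phi>)) = 1 \<longrightarrow> h (e (bullet \<Psi>)) = 1)))"

text \<open>The element type of the algebras used in the main statement: \<^typ>\<open>'a\<close> is
  arbitrary, and the second summand provides room for the quotient of the free algebra
  itself, so that entailment is not vacuous when \<^typ>\<open>'a\<close> is too small for any copy of it.\<close>

type_synonym 'a elem = "'a + ((event \<Rightarrow> real) \<Rightarrow> real) set"

end

theory Submission
  imports Defs "HOL-Algebra.FiniteProduct"
begin

text \<open>Both sides are equivalent to: every point of the coherent set that satisfies \<open>\<Phi>\<close> satisfies
  \<open>\<Psi>\<close>. On the semantic side, the homomorphisms from the coherent algebra to \<open>[0,1]\<close> are the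
  evaluations at points of the coherent set. Soundness holds because these points are convex
  combinations of truth assignments, hence restrictions of states.

  For completeness, a theory that does not prove \<open>\<Psi>\<close> extends to a prime theory, whose Lindenbaum
  algebra is a chain and so the unit interval of a totally ordered abelian group. This gives a
  valuation of modal formulas in the group. Truth of a formula under a valuation is a finite system
  of homogeneous linear constraints with integer coefficients, and by Fourier--Motzkin elimination
  such a system is solvable over the reals if it is solvable in an ordered group. The coherent set
  is also given by finitely many integer inequalities. They hold for the group-valued probabilities: an integer
  inequality between event formulas can be sorted into a good sequence by repeatedly replacing
  \<open>\<phi>, \<psi>\<close> with \<open>\<phi> \<oplus> \<psi>, \<phi> \<odot> \<psi>\<close>, which preserves the sum of the probabilities, and the superfluous
  entries of the sequence are refutable in Lukasiewicz logic.\<close>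

subsection \<open>Fourier--Motzkin elimination with integer coefficients\<close>

text \<open>Completeness does not reduce to unit-interval models by taking the instances of
  \<open>P1\<close>, \<open>P2\<close>, \<open>P3\<close> and \<open>N\<close> as premises: there
  are infinitely many of them, and from infinitely many premises Lukasiewicz logic is not complete
  over the unit interval. What the syntax provides is values in an ordered group that may contain
  infinitesimals. Finiteness is recovered on the semantic side: only the subformulas of \<Phi> and
  \<Psi> and the inequalities of the coherent set matter, and these make up one finite system. To
  transfer it, the group is reduced to the cone of its nonnegative integer forms
  (\<open>mv_cone\<close>), and elimination only ever adds constraints, an operation that makes
  sense in such a cone. This is also why the inequalities of the coherent set must be integral: real
  coefficients do not act on the group. They come out of the same elimination, run on a system over
  the cells where all truth functions are affine. The calculus has no deduction theorem of the
  classical form; derivations are replayed under a side disjunct instead.\<close>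

definition fin_form :: "('v \<Rightarrow> int) \<Rightarrow> bool" where
  "fin_form a \<longleftrightarrow> finite {v. a v \<noteq> 0}"

definition delta :: "'v \<Rightarrow> 'v \<Rightarrow> int" where
  "delta v = (\<lambda>w. if w = v then 1 else 0)"

definition ev :: "('v \<Rightarrow> int) \<Rightarrow> ('v \<Rightarrow> real) \<Rightarrow> real" where
  "ev a r = (\<Sum>v | a v \<noteq> 0. of_int (a v) * r v)"

lemma fin_form_zero [simp, intro]: "fin_form 0"
  by (simp add: fin_form_def)

lemma fin_form_delta [simp, intro]: "fin_form (delta v)"
  by (simp add: fin_form_def delta_def)

lemma fin_form_add [simp, intro]: "fin_form a \<Longrightarrow> fin_form b \<Longrightarrow> fin_form (a + b)"
  unfolding fin_form_def by (rule finite_subset[of _ "{v. a v \<noteq> 0} \<union> {v. b v \<noteq> 0}"]) auto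

lemma fin_form_uminus [simp, intro]: "fin_form a \<Longrightarrow> fin_form (- a)"
  by (simp add: fin_form_def)

lemma fin_form_diff [simp, intro]: "fin_form a \<Longrightarrow> fin_form b \<Longrightarrow> fin_form (a - b)"
  using fin_form_add[of a "- b"] by simp

lemma fin_form_sub: "finite X \<Longrightarrow> {v. a v \<noteq> 0} \<subseteq> X \<Longrightarrow> fin_form a"
  unfolding fin_form_def by (rule finite_subset)

lemma ev_superset:
  assumes "finite X" "{v. a v \<noteq> 0} \<subseteq> X"
  shows "ev a r = (\<Sum>v\<in>X. of_int (a v) * r v)"
  unfolding ev_def using assms by (intro sum.mono_neutral_left) auto

lemma ev_zero [simp]: "ev 0 r = 0"
  by (simp add: ev_def)

lemma ev_delta [simp]: "ev (delta v) r = r v"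
  by (subst ev_superset[of "{v}"]) (auto simp: delta_def)

lemma ev_add [simp]:
  assumes "fin_form a" "fin_form b"
  shows "ev (a + b) r = ev a r + ev b r"
proof -
  let ?X = "{v. a v \<noteq> 0} \<union> {v. b v \<noteq> 0}"
  have f: "finite ?X" using assms by (simp add: fin_form_def)
  have "ev (a + b) r = (\<Sum>v\<in>?X. of_int ((a + b) v) * r v)" by (rule ev_superset[OF f]) auto
  also have "\<dots> = (\<Sum>v\<in>?X. of_int (a v) * r v) + (\<Sum>v\<in>?X. of_int (b v) * r v)"
    by (simp add: sum.distrib algebra_simps)
  also have "\<dots> = ev a r + ev b r"
    by (simp add: ev_superset[OF f, of a] ev_superset[OF f, of b])
  finally show ?thesis .
qed

lemma ev_uminus [simp]: "ev (- a) r = - ev a r"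
  by (simp add: ev_def sum_negf)

lemma ev_diff [simp]: "fin_form a \<Longrightarrow> fin_form b \<Longrightarrow> ev (a - b) r = ev a r - ev b r"
  using ev_add[of a "- b" r] by simp

lemma ev_cong: "(\<And>v. a v \<noteq> 0 \<Longrightarrow> r v = r' v) \<Longrightarrow> ev a r = ev a r'"
  by (simp add: ev_def)

lemma ev_scale: "ev a (\<lambda>v. c * r v) = c * ev a r"
  by (simp add: ev_def sum_distrib_left algebra_simps)

text \<open>A constraint \<open>(True, a)\<close> reads \<open>a > 0\<close>, and \<open>(False, a)\<close> reads \<open>a \<ge> 0\<close>.\<close>

definition sat :: "('v \<Rightarrow> real) \<Rightarrow> bool \<times> ('v \<Rightarrow> int) \<Rightarrow> bool" where
  "sat r c \<longleftrightarrow> (if fst c then ev (snd c) r > 0 else ev (snd c) r \<ge> 0)"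

text \<open>Sums only, no multipliers: a derived constraint then holds in every additive cone in
  which the given ones hold. Positive integer multiples are repeated sums.\<close>

inductive_set der :: "(bool \<times> ('v \<Rightarrow> int)) set \<Rightarrow> (bool \<times> ('v \<Rightarrow> int)) set"
  for S :: "(bool \<times> ('v \<Rightarrow> int)) set" where
  base: "c \<in> S \<Longrightarrow> c \<in> der S"
| add: "(p, a) \<in> der S \<Longrightarrow> (q, b) \<in> der S \<Longrightarrow> (p \<or> q, a + b) \<in> der S"

lemma der_subset:
  assumes "S' \<subseteq> der S" shows "der S' \<subseteq> der S"
proof
  fix c assume "c \<in> der S'"
  then show "c \<in> der S" by induction (use assms in \<open>auto intro: der.add\<close>)
qed

lemma der_scale:
  assumes "(p, a) \<in> der S"
  shows "(p, (\<lambda>v. int (Suc n) * a v)) \<in> der S"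
proof (induction n)
  case (Suc n)
  have "(p \<or> p, a + (\<lambda>v. int (Suc n) * a v)) \<in> der S" by (rule der.add[OF assms Suc])
  moreover have "a + (\<lambda>v. int (Suc n) * a v) = (\<lambda>v. int (Suc (Suc n)) * a v)"
    by (auto simp: fun_eq_iff algebra_simps)
  ultimately show ?case by (metis (full_types))
qed (use assms in simp)

lemma der_scale':
  assumes "(p, a) \<in> der S" "k > 0"
  shows "(p, (\<lambda>v. k * a v)) \<in> der S"
  using der_scale[OF assms(1), of "nat k - 1"] assms(2) by simp

text \<open>Compare the largest lower bound with the smallest upper bound. The midpoint works if
  there is a gap between them, and otherwise their common value does.\<close>

lemma exists_between:
  fixes L U :: "(bool \<times> real) set"
  assumes "finite L" "finite U"
    and *: "\<And>p q l u. (p, l) \<in> L \<Longrightarrow> (q, u) \<in> U \<Longrightarrow> (if p \<or> q then l < u else l \<le> u)"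
  shows "\<exists>t. (\<forall>(p, l)\<in>L. if p then l < t else l \<le> t) \<and> (\<forall>(q, u)\<in>U. if q then t < u else t \<le> u)"
proof -
  consider "L = {}" | "U = {}" | "L \<noteq> {}" "U \<noteq> {}" by blast
  then show ?thesis
  proof cases
    case 1
    let ?t = "Min (snd ` U) - 1"
    have "?t < u" if "(q, u) \<in> U" for q u
    proof -
      have "Min (snd ` U) \<le> u" using that assms(2) by (intro Min_le) (auto intro: rev_image_eqI)
      then show ?thesis by simp
    qed
    then show ?thesis using 1 by (intro exI[of _ ?t]) (force simp: less_imp_le)
  next
    case 2
    let ?t = "Max (snd ` L) + 1"
    have "u < ?t" if "(q, u) \<in> L" for q u
    proof -
      have "u \<le> Max (snd ` L)" using that assms(1) by (intro Max_ge) (auto intro: rev_image_eqI)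
      then show ?thesis by simp
    qed
    then show ?thesis using 2 by (intro exI[of _ ?t]) (force simp: less_imp_le)
  next
    case 3
    let ?l = "Max (snd ` L)" and ?u = "Min (snd ` U)"
    have l: "l \<le> ?l" if "(q, l) \<in> L" for q l
      using that assms(1) by (intro Max_ge) (auto intro: rev_image_eqI)
    have u: "?u \<le> u" if "(q, u) \<in> U" for q u
      using that assms(2) by (intro Min_le) (auto intro: rev_image_eqI)
    have "?l \<in> snd ` L" "?u \<in> snd ` U" using 3 assms by (auto intro!: Max_in Min_in)
    then obtain p q where pq: "(p, ?l) \<in> L" "(q, ?u) \<in> U" by auto
    show ?thesis
    proof (cases "?l < ?u")
      case True
      show ?thesis
      proof (intro exI[of _ "(?l + ?u) / 2"] conjI ballI; clarify)
        fix p l assume "(p, l) \<in> L"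
        then show "if p then l < (?l + ?u) / 2 else l \<le> (?l + ?u) / 2" using l[of p l] True by auto
      next
        fix p l assume "(p, l) \<in> U"
        then show "if p then (?l + ?u) / 2 < l else (?l + ?u) / 2 \<le> l" using u[of p l] True by auto
      qed
    next
      \<comment> \<open>Without a gap the two extremal bounds coincide. A strict bound cannot have
        the common value, since it would clash with the extremal bound of the other side.\<close>
      case False
      with *[OF pq] have e: "?l = ?u" by (auto split: if_splits)
      show ?thesis
      proof (intro exI[of _ "?l"] conjI ballI; clarify)
        fix p l assume a: "(p, l) \<in> L"
        show "if p then l < ?l else l \<le> ?l" using l[OF a] *[OF a pq(2)] e by (auto split: if_splits)
      next
        fix p l assume a: "(p, l) \<in> U"
        show "if p then ?l < l else ?l \<le> l" using u[OF a] *[OF pq(1) a] e by (auto split: if_splits)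
      qed
    qed
  qed
qed

lemma ev_upd:
  assumes "fin_form a"
  shows "ev a (r(x := t)) = ev a (r(x := 0)) + of_int (a x) * t"
proof -
  let ?X = "insert x {v. a v \<noteq> 0}"
  have f: "finite ?X" using assms by (simp add: fin_form_def)
  have e: "ev a s = (\<Sum>v\<in>?X. of_int (a v) * s v)" for s by (rule ev_superset[OF f]) auto
  have "(\<Sum>v\<in>?X. of_int (a v) * (r(x := s)) v) =
      of_int (a x) * s + (\<Sum>v\<in>?X - {x}. of_int (a v) * r v)" for s
    by (subst sum.remove[OF f, of x]) auto
  then show ?thesis unfolding e by simp
qed

text \<open>A lower bound \<open>a\<close> and an upper bound \<open>b\<close> on \<open>x\<close>
  are added with the positive integer multipliers \<open>- b x\<close> and \<open>a x\<close>, which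
  cancels \<open>x\<close>. These sums say exactly that every lower bound lies below every upper
  bound.\<close>

lemma fourier_motzkin_step:
  fixes S :: "(bool \<times> ('v \<Rightarrow> int)) set"
  assumes "finite S" "\<And>c. c \<in> S \<Longrightarrow> {v. snd c v \<noteq> 0} \<subseteq> insert x X" "finite X" "x \<notin> X"
  shows "\<exists>S'. finite S' \<and> S' \<subseteq> der S \<and> (\<forall>c\<in>S'. {v. snd c v \<noteq> 0} \<subseteq> X) \<and>
    (\<forall>r. (\<forall>c\<in>S'. sat r c) \<longrightarrow> (\<exists>t. \<forall>c\<in>S. sat (r(x := t)) c))"
proof -
  define comb :: "(bool \<times> ('v \<Rightarrow> int)) \<times> (bool \<times> ('v \<Rightarrow> int)) \<Rightarrow> bool \<times> ('v \<Rightarrow> int)"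
    where "comb = (\<lambda>((p, a), (q, b)). (p \<or> q, (\<lambda>v. (- b x) * a v) + (\<lambda>v. a x * b v)))"
  define Lo where "Lo = {c\<in>S. snd c x > 0}"
  define Up where "Up = {c\<in>S. snd c x < 0}"
  define S' where "S' = {c\<in>S. snd c x = 0} \<union> comb ` (Lo \<times> Up)"
  have fin: "finite Lo" "finite Up" "finite S'" using assms(1) by (auto simp: Lo_def Up_def S'_def)
  have ff: "fin_form (snd c)" if "c \<in> S" for c
    using assms(2)[OF that] assms(3) by (auto intro: fin_form_sub[of "insert x X"])
  have "comb (c, d) \<in> der S" if "c \<in> Lo" "d \<in> Up" for c d
  proof -
    obtain p a q b where [simp]: "c = (p, a)" "d = (q, b)" by fastforce
    have "(p, a) \<in> der S" "(q, b) \<in> der S" "a x > 0" "b x < 0"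
      using that by (auto simp: Lo_def Up_def intro: der.base)
    then show ?thesis using der.add[OF der_scale'[of p a S "- b x"] der_scale'[of q b S "a x"]]
      by (simp add: comb_def)
  qed
  then have 1: "S' \<subseteq> der S" by (auto simp: S'_def intro: der.base)
  have 2: "{v. snd c v \<noteq> 0} \<subseteq> X" if c: "c \<in> S'" for c
  proof -
    consider "c \<in> S" "snd c x = 0" | l u where "l \<in> Lo" "u \<in> Up" "c = comb (l, u)"
      using c by (auto simp: S'_def)
    then show ?thesis
    proof cases
      case 1
      then show ?thesis using assms(2)[of c] by auto
    next
      case 2
      then have "l \<in> S" "u \<in> S" by (auto simp: Lo_def Up_def)
      moreover have "snd c x = 0" using 2(3) by (auto simp: comb_def case_prod_unfold)
      moreover have "{v. snd c v \<noteq> 0} \<subseteq> {v. snd l v \<noteq> 0} \<union> {v. snd u v \<noteq> 0}"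
        using 2(3) by (auto simp: comb_def case_prod_unfold)
      ultimately show ?thesis using assms(2)[of l] assms(2)[of u] by blast
    qed
  qed
  have 3: "\<exists>t. \<forall>c\<in>S. sat (r(x := t)) c" if r: "\<forall>c\<in>S'. sat r c" for r
  proof -
    \<comment> \<open>\<open>e a\<close> is the form with \<open>x\<close> set to 0, so
      \<open>bd\<close> solves a constraint for \<open>x\<close>: a lower bound if the coefficient
      is positive, an upper bound if it is negative.\<close>
    define e where "e = (\<lambda>a. ev a (r(x := 0)))"
    define bd where "bd = (\<lambda>(p::bool, a). (p, - e a / of_int (a x)))"
    have "\<exists>t. (\<forall>(p, l)\<in>bd ` Lo. if p then l < t else l \<le> t) \<and>
        (\<forall>(q, u)\<in>bd ` Up. if q then t < u else t \<le> u)"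
    proof (rule exists_between)
      fix p q l u assume "(p, l) \<in> bd ` Lo" "(q, u) \<in> bd ` Up"
      then obtain a b where a: "(p, a) \<in> Lo" "l = - e a / of_int (a x)"
        and b: "(q, b) \<in> Up" "u = - e b / of_int (b x)" by (auto simp: bd_def)
      have ax: "a x > 0" and bx: "b x < 0" and S: "(p, a) \<in> S" "(q, b) \<in> S"
        using a b by (auto simp: Lo_def Up_def)
      have fa: "fin_form a" and fb: "fin_form b" using ff S by fastforce+
      let ?c = "(\<lambda>v. (- b x) * a v) + (\<lambda>v. a x * b v)"
      have fs: "fin_form (\<lambda>v. k * a v)" "fin_form (\<lambda>v. k * b v)" for k
        using fa fb by (auto simp: fin_form_def)
      have evs: "ev (\<lambda>v. k * a v) r = k * ev a r" "ev (\<lambda>v. k * b v) r = k * ev b r" for k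
      proof -
        have "ev (\<lambda>v. k * a v) r = (\<Sum>v | a v \<noteq> 0. of_int (k * a v) * r v)"
          using fa by (intro ev_superset) (auto simp: fin_form_def)
        then show "ev (\<lambda>v. k * a v) r = k * ev a r" by (simp add: ev_def sum_distrib_left mult.assoc)
        have "ev (\<lambda>v. k * b v) r = (\<Sum>v | b v \<noteq> 0. of_int (k * b v) * r v)"
          using fb by (intro ev_superset) (auto simp: fin_form_def)
        then show "ev (\<lambda>v. k * b v) r = k * ev b r" by (simp add: ev_def sum_distrib_left mult.assoc)
      qed
      have "ev ?c r = ev (\<lambda>v. (- b x) * a v) r + ev (\<lambda>v. a x * b v) r" by (rule ev_add) (rule fs)+
      also have "\<dots> = (- b x) * ev a r + a x * ev b r" unfolding evs by simp
      also have "ev a r = e a + of_int (a x) * r x"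
        using ev_upd[OF fa, of r x "r x"] by (simp add: e_def)
      also have "ev b r = e b + of_int (b x) * r x"
        using ev_upd[OF fb, of r x "r x"] by (simp add: e_def)
      also have "(- b x) * (e a + of_int (a x) * r x) + a x * (e b + of_int (b x) * r x) =
          (- of_int (b x)) * e a + of_int (a x) * e b" by (simp add: algebra_simps)
      finally have ec: "ev ?c r = (- of_int (b x)) * e a + of_int (a x) * e b" .
      have "(p \<or> q, ?c) \<in> S'" unfolding S'_def comb_def using a(1) b(1) by force
      with r have "sat r (p \<or> q, ?c)" by blast
      then have "if p \<or> q then 0 < (- of_int (b x)) * e a + of_int (a x) * e b
          else 0 \<le> (- of_int (b x)) * e a + of_int (a x) * e b"
        unfolding sat_def fst_conv snd_conv ec .
      then show "if p \<or> q then l < u else l \<le> u"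
        using ax bx unfolding a(2) b(2) by (auto simp: field_simps split: if_splits)
    qed (use fin in auto)
    then obtain t where t: "\<And>p l. (p, l) \<in> bd ` Lo \<Longrightarrow> if p then l < t else l \<le> t"
      "\<And>p l. (p, l) \<in> bd ` Up \<Longrightarrow> if p then t < l else t \<le> l" by fast
    have "sat (r(x := t)) c" if c: "c \<in> S" for c
    proof -
      obtain p a where [simp]: "c = (p, a)" by fastforce
      have fa: "fin_form a" using ff[OF c] by simp
      have u: "ev a (r(x := t)) = e a + of_int (a x) * t"
        using ev_upd[OF fa, of r x t] by (simp add: e_def)
      consider "a x = 0" | "a x > 0" | "a x < 0" by linarith
      then show ?thesis
      proof cases
        case 1
        then have "c \<in> S'" using c by (simp add: S'_def)
        then have "sat r c" using r by blast
        moreover have "ev a (r(x := t)) = ev a r" using 1 by (intro ev_cong) auto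
        ultimately show ?thesis by (cases p) (simp_all add: sat_def)
      next
        case 2
        then have "bd (p, a) \<in> bd ` Lo" using c by (intro imageI) (simp add: Lo_def)
        then have "(p, - e a / of_int (a x)) \<in> bd ` Lo" by (simp add: bd_def)
        from t(1)[OF this] show ?thesis using 2
          by (auto simp: sat_def u field_simps split: if_splits)
      next
        case 3
        then have "bd (p, a) \<in> bd ` Up" using c by (intro imageI) (simp add: Up_def)
        then have "(p, - e a / of_int (a x)) \<in> bd ` Up" by (simp add: bd_def)
        from t(2)[OF this] show ?thesis using 3
          by (auto simp: sat_def u field_simps split: if_splits)
      qed
    qed
    then show ?thesis by blast
  qed
  show ?thesis using fin(3) 1 2 3 by blast
qed

text \<open>The kept variables \<open>X\<close> serve the description of the coherent set, which is
  a projection. Consistency is the case where \<open>X\<close> is empty.\<close>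

theorem fourier_motzkin:
  fixes S :: "(bool \<times> ('v \<Rightarrow> int)) set"
  assumes "finite Y" "finite X" "X \<inter> Y = {}" "finite S"
    and "\<And>c. c \<in> S \<Longrightarrow> {v. snd c v \<noteq> 0} \<subseteq> X \<union> Y"
  shows "\<exists>S'. finite S' \<and> S' \<subseteq> der S \<and> (\<forall>c\<in>S'. {v. snd c v \<noteq> 0} \<subseteq> X) \<and>
    (\<forall>r. (\<forall>c\<in>S'. sat r c) \<longrightarrow> (\<exists>r'. (\<forall>v\<in>X. r' v = r v) \<and> (\<forall>c\<in>S. sat r' c)))"
  using assms
proof (induction Y arbitrary: S rule: finite_induct)
  case empty
  then show ?case by (intro exI[of _ S]) (auto intro: der.base)
next
  case (insert y Y)
  have "\<exists>S1. finite S1 \<and> S1 \<subseteq> der S \<and> (\<forall>c\<in>S1. {v. snd c v \<noteq> 0} \<subseteq> X \<union> Y) \<and>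
    (\<forall>r. (\<forall>c\<in>S1. sat r c) \<longrightarrow> (\<exists>t. \<forall>c\<in>S. sat (r(y := t)) c))"
    using insert.prems insert.hyps by (intro fourier_motzkin_step) auto
  then obtain S1 where S1: "finite S1" "S1 \<subseteq> der S" "\<And>c. c \<in> S1 \<Longrightarrow> {v. snd c v \<noteq> 0} \<subseteq> X \<union> Y"
    "\<And>r. \<forall>c\<in>S1. sat r c \<Longrightarrow> \<exists>t. \<forall>c\<in>S. sat (r(y := t)) c" by blast
  have "\<exists>S'. finite S' \<and> S' \<subseteq> der S1 \<and> (\<forall>c\<in>S'. {v. snd c v \<noteq> 0} \<subseteq> X) \<and>
    (\<forall>r. (\<forall>c\<in>S'. sat r c) \<longrightarrow> (\<exists>r'. (\<forall>v\<in>X. r' v = r v) \<and> (\<forall>c\<in>S1. sat r' c)))"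
    using insert.prems S1 by (intro insert.IH) auto
  then obtain S' where S': "finite S'" "S' \<subseteq> der S1" "\<forall>c\<in>S'. {v. snd c v \<noteq> 0} \<subseteq> X"
    "\<forall>r. (\<forall>c\<in>S'. sat r c) \<longrightarrow> (\<exists>r'. (\<forall>v\<in>X. r' v = r v) \<and> (\<forall>c\<in>S1. sat r' c))"
    by (elim exE conjE) (rule that)
  have "\<forall>r. (\<forall>c\<in>S'. sat r c) \<longrightarrow> (\<exists>r'. (\<forall>v\<in>X. r' v = r v) \<and> (\<forall>c\<in>S. sat r' c))"
  proof (intro allI impI)
    fix r assume r: "\<forall>c\<in>S'. sat r c"
    obtain r1 where r1: "\<forall>v\<in>X. r1 v = r v" "\<forall>c\<in>S1. sat r1 c" using S'(4) r by blast
    obtain t where "\<forall>c\<in>S. sat (r1(y := t)) c" using S1(4)[OF r1(2)] by blast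
    then show "\<exists>r'. (\<forall>v\<in>X. r' v = r v) \<and> (\<forall>c\<in>S. sat r' c)"
      using r1(1) insert.prems(2) by (intro exI[of _ "r1(y := t)"]) auto
  qed
  moreover have "S' \<subseteq> der S" using S'(2) der_subset[OF S1(2)] by (rule subset_trans)
  ultimately show ?case using S'(1,3) by (intro exI[of _ S'] conjI)
qed

text \<open>Once all variables are eliminated only the zero form is left, and the single constraint
  on it that can fail is \<open>0 > 0\<close>.\<close>

corollary motzkin_transposition:
  fixes S :: "(bool \<times> ('v \<Rightarrow> int)) set"
  assumes "finite S" "\<And>c. c \<in> S \<Longrightarrow> fin_form (snd c)" "(True, 0) \<notin> der S"
  shows "\<exists>r. \<forall>c\<in>S. sat r c"
proof -
  let ?Y = "\<Union>c\<in>S. {v. snd c v \<noteq> 0}"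
  have "finite ?Y" using assms by (auto simp: fin_form_def)
  then have "\<exists>S'. finite S' \<and> S' \<subseteq> der S \<and> (\<forall>c\<in>S'. {v. snd c v \<noteq> 0} \<subseteq> {}) \<and>
    (\<forall>r. (\<forall>c\<in>S'. sat r c) \<longrightarrow> (\<exists>r'. (\<forall>v\<in>{}. r' v = r v) \<and> (\<forall>c\<in>S. sat r' c)))"
    using assms(1) by (intro fourier_motzkin[where X = "{}" and Y = ?Y]) auto
  then obtain S' where S': "S' \<subseteq> der S" "\<forall>c\<in>S'. {v. snd c v \<noteq> 0} \<subseteq> {}"
    "\<forall>r. (\<forall>c\<in>S'. sat r c) \<longrightarrow> (\<exists>r'. (\<forall>v\<in>{}. r' v = r v) \<and> (\<forall>c\<in>S. sat r' c))"
    by (elim exE conjE) (rule that)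
  have "sat (\<lambda>_. 0) c" if c: "c \<in> S'" for c
  proof -
    have "snd c = 0" using S'(2) c by (auto simp: fun_eq_iff)
    then have "c = (fst c, 0)" by (metis prod.collapse)
    with assms(3) S'(1) c have "\<not> fst c" by (metis (full_types) subsetD)
    then show ?thesis using \<open>snd c = 0\<close> by (simp add: sat_def)
  qed
  with S'(3) show ?thesis by blast
qed

subsection \<open>The implicational calculus\<close>

text \<open>Two instances matter: no premises, for event formulas, and all consequences of \<Phi> in
  the modal calculus as premises, for modal formulas.\<close>

inductive luk_derives :: "'a fm set \<Rightarrow> 'a fm \<Rightarrow> bool" (infix "\<turnstile>\<^sub>L" 50)
  for T :: "'a fm set" where
  premise: "\<phi> \<in> T \<Longrightarrow> T \<turnstile>\<^sub>L \<phi>"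
| axiom: "luk_axiom \<phi> \<Longrightarrow> T \<turnstile>\<^sub>L \<phi>"
| mp: "T \<turnstile>\<^sub>L \<phi> \<Longrightarrow> T \<turnstile>\<^sub>L Imp \<phi> \<psi> \<Longrightarrow> T \<turnstile>\<^sub>L \<psi>"

lemma luk_provable_iff_derives: "luk_provable \<phi> \<longleftrightarrow> {} \<turnstile>\<^sub>L \<phi>"
proof
  show "luk_provable \<phi> \<Longrightarrow> {} \<turnstile>\<^sub>L \<phi>"
    by (induction rule: luk_provable.induct) (auto intro: luk_derives.intros)
  show "{} \<turnstile>\<^sub>L \<phi> \<Longrightarrow> luk_provable \<phi>"
    by (induction rule: luk_derives.induct) (auto intro: luk_provable.intros)
qed

lemma luk_derives_cut: "T \<turnstile>\<^sub>L \<phi> \<Longrightarrow> (\<And>\<psi>. \<psi> \<in> T \<Longrightarrow> S \<turnstile>\<^sub>L \<psi>) \<Longrightarrow> S \<turnstile>\<^sub>L \<phi>"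
  by (induction rule: luk_derives.induct) (auto intro: luk_derives.axiom luk_derives.mp)

lemma luk_derives_mono: "T \<turnstile>\<^sub>L \<phi> \<Longrightarrow> T \<subseteq> S \<Longrightarrow> S \<turnstile>\<^sub>L \<phi>"
  by (erule luk_derives_cut) (auto intro: luk_derives.premise)

context
  fixes T :: "'a fm set"
begin

lemma L1: "T \<turnstile>\<^sub>L Imp a (Imp b a)" and
  L2: "T \<turnstile>\<^sub>L Imp (Imp a b) (Imp (Imp b c) (Imp a c))" and
  L3: "T \<turnstile>\<^sub>L Imp (Imp (Imp a b) b) (Imp (Imp b a) a)" and
  L4: "T \<turnstile>\<^sub>L Imp (Imp (Neg a) (Neg b)) (Imp b a)" and
  Oplus_left: "T \<turnstile>\<^sub>L Imp (Oplus a b) (Imp (Neg a) b)" and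
  Oplus_right: "T \<turnstile>\<^sub>L Imp (Imp (Neg a) b) (Oplus a b)" and
  Bot_false: "T \<turnstile>\<^sub>L Neg Bot"
  by (auto intro!: luk_derives.axiom luk_axiom.intros)

lemma imp_mp: "T \<turnstile>\<^sub>L Imp a b \<Longrightarrow> T \<turnstile>\<^sub>L a \<Longrightarrow> T \<turnstile>\<^sub>L b"
  by (rule luk_derives.mp)

lemma imp_trans [trans]: "T \<turnstile>\<^sub>L Imp a b \<Longrightarrow> T \<turnstile>\<^sub>L Imp b c \<Longrightarrow> T \<turnstile>\<^sub>L Imp a c"
  by (rule imp_mp[OF imp_mp[OF L2]])

lemma imp_weaken: "T \<turnstile>\<^sub>L b \<Longrightarrow> T \<turnstile>\<^sub>L Imp a b"
  by (rule imp_mp[OF L1])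

lemma imp_assertion: "T \<turnstile>\<^sub>L Imp a (Imp (Imp a b) b)"
  by (rule imp_trans[OF L1 L3])

lemma imp_exchange: "T \<turnstile>\<^sub>L Imp (Imp a (Imp b c)) (Imp b (Imp a c))"
proof -
  have "T \<turnstile>\<^sub>L Imp (Imp (Imp (Imp b c) c) (Imp a c)) (Imp b (Imp a c))"
    by (rule imp_mp[OF L2 imp_assertion])
  with L2 show ?thesis by (rule imp_trans)
qed

lemma imp_swap: "T \<turnstile>\<^sub>L Imp a (Imp b c) \<Longrightarrow> T \<turnstile>\<^sub>L Imp b (Imp a c)"
  by (rule imp_mp[OF imp_exchange])

text \<open>Exchange turns \<open>L1\<close> into \<open>Imp b (Imp a a)\<close> for any
  \<open>b\<close>; the axiom \<open>Neg Bot\<close> is a theorem with which to discharge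
  \<open>b\<close>.\<close>

lemma imp_refl: "T \<turnstile>\<^sub>L Imp a a"
  by (rule imp_mp[OF imp_swap[OF L1] Bot_false])

lemma imp_suffix: "T \<turnstile>\<^sub>L Imp a b \<Longrightarrow> T \<turnstile>\<^sub>L Imp (Imp b c) (Imp a c)"
  by (rule imp_mp[OF L2])

lemma imp_prefix: "T \<turnstile>\<^sub>L Imp b c \<Longrightarrow> T \<turnstile>\<^sub>L Imp (Imp a b) (Imp a c)"
  by (rule imp_mp[OF imp_swap[OF L2]])

lemma imp_mono: "T \<turnstile>\<^sub>L Imp a' a \<Longrightarrow> T \<turnstile>\<^sub>L Imp b b' \<Longrightarrow> T \<turnstile>\<^sub>L Imp (Imp a b) (Imp a' b')"
  by (rule imp_trans[OF imp_suffix imp_prefix])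

lemma neg_elim: "T \<turnstile>\<^sub>L Imp (Neg a) (Imp a b)"
  by (rule imp_trans[OF L1 L4])

lemma neg_neg_elim: "T \<turnstile>\<^sub>L Imp (Neg (Neg a)) a"
proof -
  \<comment> \<open>The free consequent of \<open>neg_elim\<close> is chosen as
    \<open>Neg (Neg Bot)\<close>, which gives the implication the shape that \<open>L4\<close>
    expects.\<close>
  have "T \<turnstile>\<^sub>L Imp (Neg (Neg a)) (Imp (Neg Bot) a)"
    by (rule imp_trans[OF neg_elim L4])
  then show ?thesis by (rule imp_mp[OF imp_swap Bot_false])
qed

lemma neg_neg_intro: "T \<turnstile>\<^sub>L Imp a (Neg (Neg a))"
  by (rule imp_mp[OF L4 neg_neg_elim])

lemma contrapos_imp: "T \<turnstile>\<^sub>L Imp (Imp a b) (Imp (Neg b) (Neg a))"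
  by (rule imp_trans[OF imp_mono[OF neg_neg_elim neg_neg_intro] L4])

lemma contrapos: "T \<turnstile>\<^sub>L Imp a b \<Longrightarrow> T \<turnstile>\<^sub>L Imp (Neg b) (Neg a)"
  by (rule imp_mp[OF contrapos_imp])

lemma Oplus_mono: "T \<turnstile>\<^sub>L Imp a a' \<Longrightarrow> T \<turnstile>\<^sub>L Imp b b' \<Longrightarrow> T \<turnstile>\<^sub>L Imp (Oplus a b) (Oplus a' b')"
  by (rule imp_trans[OF imp_trans[OF Oplus_left imp_mono[OF contrapos]] Oplus_right])

lemma Oplus_comm: "T \<turnstile>\<^sub>L Imp (Oplus a b) (Oplus b a)"
proof -
  note Oplus_left
  also note contrapos_imp
  also have "T \<turnstile>\<^sub>L Imp (Imp (Neg b) (Neg (Neg a))) (Imp (Neg b) a)"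
    by (rule imp_prefix[OF neg_neg_elim])
  also note Oplus_right
  finally show ?thesis .
qed

lemma Oplus_left_comm: "T \<turnstile>\<^sub>L Imp (Oplus a (Oplus b c)) (Oplus b (Oplus a c))"
proof -
  note Oplus_left
  also have "T \<turnstile>\<^sub>L Imp (Imp (Neg a) (Oplus b c)) (Imp (Neg a) (Imp (Neg b) c))"
    by (rule imp_prefix[OF Oplus_left])
  also note imp_exchange
  also have "T \<turnstile>\<^sub>L Imp (Imp (Neg b) (Imp (Neg a) c)) (Imp (Neg b) (Oplus a c))"
    by (rule imp_prefix[OF Oplus_right])
  also note Oplus_right
  finally show ?thesis .
qed

lemma Oplus_assoc1: "T \<turnstile>\<^sub>L Imp (Oplus (Oplus a b) c) (Oplus a (Oplus b c))"
  by (rule imp_trans[OF imp_trans[OF Oplus_comm Oplus_left_comm] Oplus_mono[OF imp_refl Oplus_comm]])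

lemma Oplus_assoc2: "T \<turnstile>\<^sub>L Imp (Oplus a (Oplus b c)) (Oplus (Oplus a b) c)"
  by (rule imp_trans[OF imp_trans[OF Oplus_mono[OF imp_refl Oplus_comm] Oplus_left_comm] Oplus_comm])

lemma Oplus_Bot1: "T \<turnstile>\<^sub>L Imp (Oplus a Bot) a"
  by (rule imp_trans[OF Oplus_comm imp_trans[OF Oplus_left imp_mp[OF imp_assertion Bot_false]]])

lemma Oplus_Bot2: "T \<turnstile>\<^sub>L Imp a (Oplus a Bot)"
  by (rule imp_trans[OF L1 imp_trans[OF Oplus_right Oplus_comm]])

lemma Or_upper1: "T \<turnstile>\<^sub>L Imp a (Or a b)"
  unfolding Or_def by (rule imp_assertion)

lemma Or_upper2: "T \<turnstile>\<^sub>L Imp b (Or a b)"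
  unfolding Or_def by (rule L1)

text \<open>Replacing \<open>a\<close> by \<open>c\<close> inside \<open>Or a b\<close> gives
  \<open>Imp (Imp c b) b\<close>. The asymmetric definition of \<open>Or\<close> is then turned
  around by \<open>L3\<close>, and \<open>Imp b c\<close> detaches \<open>c\<close>.\<close>

lemma Or_least:
  assumes "T \<turnstile>\<^sub>L Imp a c" "T \<turnstile>\<^sub>L Imp b c"
  shows "T \<turnstile>\<^sub>L Imp (Or a b) c"
proof -
  have "T \<turnstile>\<^sub>L Imp (Or a b) (Imp (Imp c b) b)"
    unfolding Or_def by (intro imp_suffix assms)
  also note L3
  also have "T \<turnstile>\<^sub>L Imp (Imp (Imp b c) c) c"
    by (rule imp_mp[OF imp_assertion assms(2)])
  finally show ?thesis .
qed

lemma Or_comm: "T \<turnstile>\<^sub>L Or a b \<Longrightarrow> T \<turnstile>\<^sub>L Or b a"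
  by (rule imp_mp[OF Or_least[OF Or_upper2 Or_upper1]])

lemma Or_mp:
  assumes "T \<turnstile>\<^sub>L Or a g" "T \<turnstile>\<^sub>L Or (Imp a b) g"
  shows "T \<turnstile>\<^sub>L Or b g"
proof -
  have g: "T \<turnstile>\<^sub>L Imp g (Imp c (Or b g))" for c
    by (rule imp_trans[OF Or_upper2 L1])
  have "T \<turnstile>\<^sub>L Imp (Or (Imp a b) g) (Imp a (Or b g))"
    by (rule Or_least[OF imp_prefix[OF Or_upper1] g])
  then have "T \<turnstile>\<^sub>L Imp (Or a g) (Imp (Or (Imp a b) g) (Or b g))"
    by (intro Or_least g) (rule imp_swap)
  then show ?thesis using assms imp_mp by blast
qed

lemma And_elim:
  assumes "T \<turnstile>\<^sub>L And a b" shows "T \<turnstile>\<^sub>L a" "T \<turnstile>\<^sub>L b"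
proof -
  have "T \<turnstile>\<^sub>L Imp (And a b) a" "T \<turnstile>\<^sub>L Imp (And a b) b" unfolding And_def
    by (rule imp_trans[OF contrapos[OF Or_upper1] neg_neg_elim],
        rule imp_trans[OF contrapos[OF Or_upper2] neg_neg_elim])
  with assms show "T \<turnstile>\<^sub>L a" "T \<turnstile>\<^sub>L b" by (auto intro: imp_mp)
qed

lemma Iff_elim:
  assumes "T \<turnstile>\<^sub>L Iff a b" shows "T \<turnstile>\<^sub>L Imp a b" "T \<turnstile>\<^sub>L Imp b a"
  using And_elim[OF assms[unfolded Iff_def]] .

lemma Odot_lower: "T \<turnstile>\<^sub>L Imp (Odot a b) a"
proof -
  have "T \<turnstile>\<^sub>L Imp (Neg a) (Oplus (Neg a) (Neg b))"
    by (rule imp_trans[OF Oplus_Bot2 Oplus_mono[OF imp_refl]])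
      (rule imp_trans[OF neg_neg_intro imp_mp[OF imp_swap[OF neg_elim] Bot_false]])
  then show ?thesis unfolding Odot_def by (rule imp_trans[OF contrapos neg_neg_elim])
qed

text \<open>One half of residuation. It later bounds the probability of \<open>a\<close> by that of
  \<open>Imp b (Odot a b)\<close>.\<close>

lemma Odot_intro: "T \<turnstile>\<^sub>L Imp a (Imp b (Odot a b))"
proof -
  have "T \<turnstile>\<^sub>L Imp (Oplus (Neg a) (Neg b)) (Imp a (Neg b))"
    by (rule imp_trans[OF Oplus_left imp_suffix[OF neg_neg_intro]])
  then have "T \<turnstile>\<^sub>L Imp a (Imp (Oplus (Neg a) (Neg b)) (Neg b))" by (rule imp_swap)
  also have "T \<turnstile>\<^sub>L Imp (Imp (Oplus (Neg a) (Neg b)) (Neg b)) (Imp b (Odot a b))"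
    unfolding Odot_def
    by (rule imp_trans[OF contrapos_imp imp_suffix[OF neg_neg_intro]])
  finally show ?thesis .
qed

end

text \<open>Stands in for the deduction theorem: every line of the derivation is repeated with the
  disjunct \<open>g\<close> attached, and \<open>Or_mp\<close> is modus ponens in this form. Two
  applications give proof by cases.\<close>

lemma luk_derives_Or:
  assumes "insert a T \<turnstile>\<^sub>L b" "T \<turnstile>\<^sub>L Or a g"
  shows "T \<turnstile>\<^sub>L Or b g"
  using assms(1)
proof (induction rule: luk_derives.induct)
  case (premise \<phi>)
  show ?case
  proof (cases "\<phi> = a")
    case False
    with premise have "T \<turnstile>\<^sub>L \<phi>" by (intro luk_derives.premise) simp
    then show ?thesis by (rule imp_mp[OF Or_upper1])
  qed (use assms(2) in simp)
next
  case (axiom \<phi>)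
  then show ?case by (rule imp_mp[OF Or_upper1 luk_derives.axiom])
next
  case (mp \<phi> \<psi>)
  show ?case by (rule Or_mp[OF mp.IH])
qed

lemma luk_derives_cases:
  assumes "insert a T \<turnstile>\<^sub>L c" "insert b T \<turnstile>\<^sub>L c" "T \<turnstile>\<^sub>L Or a b"
  shows "T \<turnstile>\<^sub>L c"
proof -
  have "T \<turnstile>\<^sub>L Or c b" by (rule luk_derives_Or[OF assms(1,3)])
  then have "T \<turnstile>\<^sub>L Or b c" by (rule Or_comm)
  then have "T \<turnstile>\<^sub>L Or c c" by (rule luk_derives_Or[OF assms(2)])
  then show ?thesis by (rule imp_mp[OF Or_least[OF imp_refl imp_refl]])
qed

subsection \<open>The Lindenbaum algebra\<close>

definition luk_equiv :: "'a fm set \<Rightarrow> 'a fm \<Rightarrow> 'a fm \<Rightarrow> bool" where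
  "luk_equiv T a b \<longleftrightarrow> T \<turnstile>\<^sub>L Imp a b \<and> T \<turnstile>\<^sub>L Imp b a"

text \<open>The elements of the Lindenbaum algebra are chosen representatives of the classes of
  provably equivalent formulas, not the classes themselves.\<close>

definition nf :: "'a fm set \<Rightarrow> 'a fm \<Rightarrow> 'a fm" where
  "nf T a = (SOME b. luk_equiv T a b)"

definition lindenbaum :: "'a fm set \<Rightarrow> 'a fm mv" where
  "lindenbaum T = \<lparr>mv_carrier = range (nf T), mv_plus = (\<lambda>a b. nf T (Oplus a b)),
     mv_neg = (\<lambda>a. nf T (Neg a)), mv_zero = nf T Bot\<rparr>"

lemma luk_equiv_refl: "luk_equiv T a a"
  by (simp add: luk_equiv_def imp_refl)

lemma luk_equiv_sym: "luk_equiv T a b \<Longrightarrow> luk_equiv T b a"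
  by (simp add: luk_equiv_def)

lemma luk_equiv_trans: "luk_equiv T a b \<Longrightarrow> luk_equiv T b c \<Longrightarrow> luk_equiv T a c"
  by (auto simp: luk_equiv_def intro: imp_trans)

lemma nf_equiv: "luk_equiv T a (nf T a)"
  unfolding nf_def by (rule someI) (rule luk_equiv_refl)

lemma nf_eq_iff: "nf T a = nf T b \<longleftrightarrow> luk_equiv T a b"
proof
  show "nf T a = nf T b \<Longrightarrow> luk_equiv T a b"
    by (metis nf_equiv luk_equiv_sym luk_equiv_trans)
  assume "luk_equiv T a b"
  then have "luk_equiv T a = luk_equiv T b"
    by (intro ext) (blast intro: luk_equiv_sym luk_equiv_trans)
  then show "nf T a = nf T b" by (simp add: nf_def)
qed

lemma nf_Oplus [simp]: "nf T (Oplus (nf T a) (nf T b)) = nf T (Oplus a b)"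
  using nf_equiv[of T a] nf_equiv[of T b]
  by (auto simp: nf_eq_iff luk_equiv_def intro!: Oplus_mono)

lemma nf_Neg [simp]: "nf T (Neg (nf T a)) = nf T (Neg a)"
  using nf_equiv[of T a] by (auto simp: nf_eq_iff luk_equiv_def intro!: contrapos)

lemma nf_nf [simp]: "nf T (nf T a) = nf T a"
  using nf_equiv[of T a] by (simp add: nf_eq_iff luk_equiv_sym)

lemma nf_Oplus1 [simp]: "nf T (Oplus (nf T a) b) = nf T (Oplus a b)"
  and nf_Oplus2 [simp]: "nf T (Oplus a (nf T b)) = nf T (Oplus a b)"
  using nf_Oplus[of T "nf T a" b] nf_Oplus[of T a "nf T b"]
  by (metis nf_Oplus nf_nf)+

lemma nf_eq_Top_iff: "nf T a = nf T (Neg Bot) \<longleftrightarrow> T \<turnstile>\<^sub>L a"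
  by (auto simp: nf_eq_iff luk_equiv_def intro: imp_weaken Bot_false imp_mp)

lemma nf_sel [simp]:
  "nf T a \<in> mv_carrier (lindenbaum T)"
  "mv_plus (lindenbaum T) a b = nf T (Oplus a b)"
  "mv_neg (lindenbaum T) a = nf T (Neg a)"
  "mv_zero (lindenbaum T) = nf T Bot"
  by (simp_all add: lindenbaum_def)

lemma mv_algebra_lindenbaum: "mv_algebra (lindenbaum T)"
proof
  have c: "mv_carrier (lindenbaum T) = range (nf T)" by (simp add: lindenbaum_def)
  let ?C = "mv_carrier (lindenbaum T)"
  show "mv_plus (lindenbaum T) (mv_plus (lindenbaum T) x y) z =
      mv_plus (lindenbaum T) x (mv_plus (lindenbaum T) y z)" for x y z
    by (auto simp: nf_eq_iff luk_equiv_def intro: Oplus_assoc1 Oplus_assoc2)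
  show "mv_plus (lindenbaum T) x y = mv_plus (lindenbaum T) y x" for x y
    by (auto simp: nf_eq_iff luk_equiv_def intro: Oplus_comm)
  show "mv_plus (lindenbaum T) x (mv_zero (lindenbaum T)) = x" if "x \<in> ?C" for x
    using that by (auto simp: c nf_eq_iff luk_equiv_def intro: Oplus_Bot1 Oplus_Bot2)
  show "mv_neg (lindenbaum T) (mv_neg (lindenbaum T) x) = x" if "x \<in> ?C" for x
  proof -
    have "nf T (Neg (Neg x)) = nf T x"
      by (simp add: nf_eq_iff luk_equiv_def neg_neg_elim neg_neg_intro)
    then show ?thesis using that by (auto simp: c)
  qed
  have "T \<turnstile>\<^sub>L Oplus x (Neg Bot)" for x
    by (rule imp_mp[OF Oplus_right imp_weaken[OF Bot_false]])
  then show "mv_plus (lindenbaum T) x (mv_neg (lindenbaum T) (mv_zero (lindenbaum T))) =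
      mv_neg (lindenbaum T) (mv_zero (lindenbaum T))" for x
    by (simp add: nf_eq_Top_iff)
  show "mv_plus (lindenbaum T) (mv_neg (lindenbaum T) (mv_plus (lindenbaum T)
        (mv_neg (lindenbaum T) x) y)) y =
      mv_plus (lindenbaum T) (mv_neg (lindenbaum T) (mv_plus (lindenbaum T)
        (mv_neg (lindenbaum T) y) x)) x" for x y
    using L3[of T x y] L3[of T y x] by (simp add: nf_eq_iff luk_equiv_def Imp_def)
qed simp_all

subsection \<open>Chang's ordered group of an MV-chain\<close>

context mv_algebra
begin

abbreviation mplus (infixl "\<boxplus>" 65) where "x \<boxplus> y \<equiv> mv_plus A x y"
abbreviation mneg where "mneg x \<equiv> mv_neg A x"
abbreviation mzero where "mzero \<equiv> mv_zero A"
abbreviation mone where "mone \<equiv> mv_neg A (mv_zero A)"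
abbreviation mtimes (infixl "\<boxdot>" 70) where "x \<boxdot> y \<equiv> mneg (mneg x \<boxplus> mneg y)"

declare plus_closed [simp] neg_closed [simp] zero_closed [simp] plus_zero [simp]
  neg_neg [simp] plus_one [simp]

lemma plus_left_commute:
  "x \<in> mv_carrier A \<Longrightarrow> y \<in> mv_carrier A \<Longrightarrow> z \<in> mv_carrier A \<Longrightarrow>
    x \<boxplus> (y \<boxplus> z) = y \<boxplus> (x \<boxplus> z)"
  by (metis plus_assoc plus_commute)

lemmas plus_ac = plus_assoc plus_commute plus_left_commute

lemma zero_plus [simp]: "x \<in> mv_carrier A \<Longrightarrow> mzero \<boxplus> x = x"
  by (simp add: plus_commute[of mzero])

lemma one_plus [simp]: "x \<in> mv_carrier A \<Longrightarrow> mone \<boxplus> x = mone"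
  by (simp add: plus_commute[of mone])

lemma neg_plus_self [simp]: "x \<in> mv_carrier A \<Longrightarrow> mneg x \<boxplus> x = mone"
  using lukasiewicz[of x mone] by simp

lemma self_plus_neg [simp]: "x \<in> mv_carrier A \<Longrightarrow> x \<boxplus> mneg x = mone"
  by (simp add: plus_commute[of x])

lemma neg_inject: "x \<in> mv_carrier A \<Longrightarrow> y \<in> mv_carrier A \<Longrightarrow> mneg x = mneg y \<longleftrightarrow> x = y"
  by (metis neg_neg)

text \<open>The hypothesis says \<open>x \<boxdot> y = mzero\<close>, so the sum is not truncated
  and \<open>y\<close> can be taken off again. One side of the Lukasiewicz identity collapses to
  \<open>mneg x\<close>.\<close>

lemma plus_cancel_neg:
  assumes "x \<in> mv_carrier A" "y \<in> mv_carrier A" "mneg x \<boxplus> mneg y = mone"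
  shows "mneg (x \<boxplus> y) \<boxplus> y = mneg x"
  using lukasiewicz[of "mneg x" y] assms by (simp add: plus_commute[of "mneg y"])

lemma plus_eq_zero:
  assumes "x \<in> mv_carrier A" "y \<in> mv_carrier A" "x \<boxplus> y = mzero"
  shows "x = mzero"
proof -
  have "mneg x = mneg x \<boxplus> (x \<boxplus> y)" using assms by simp
  also have "\<dots> = mone" using assms(1,2) by (simp flip: plus_assoc)
  finally show ?thesis using assms(1) by (metis neg_neg zero_closed)
qed

text \<open>Divisibility of the natural order; the complement is the truncated difference
  \<open>y \<boxdot> mneg x\<close>.\<close>

lemma le_imp_plus:
  assumes "x \<in> mv_carrier A" "y \<in> mv_carrier A" "mneg x \<boxplus> y = mone"
  shows "y = x \<boxplus> mneg (mneg y \<boxplus> x)"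
proof -
  have "y = mneg (mneg x \<boxplus> y) \<boxplus> y" using assms by simp
  also have "\<dots> = mneg (mneg y \<boxplus> x) \<boxplus> x" using assms(1,2) by (rule lukasiewicz)
  finally show ?thesis using assms by (simp add: plus_commute)
qed

text \<open>Neither sum with \<open>c\<close> is truncated, so \<open>mneg a\<close> and
  \<open>mneg b\<close> can be written with \<open>mneg (a \<boxplus> c)\<close> and
  \<open>mneg (b \<boxplus> c)\<close>. After that the two sides differ only in the order of their
  summands.\<close>

lemma times_plus_swap:
  assumes [simp]: "a \<in> mv_carrier A" "b \<in> mv_carrier A" "c \<in> mv_carrier A"
    and "mneg a \<boxplus> mneg c = mone" "mneg b \<boxplus> mneg c = mone"
  shows "a \<boxdot> (b \<boxplus> c) = b \<boxdot> (a \<boxplus> c)"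
proof -
  have "mneg a = mneg (a \<boxplus> c) \<boxplus> c" "mneg b = mneg (b \<boxplus> c) \<boxplus> c"
    by (simp_all add: plus_cancel_neg assms)
  then have "mneg a \<boxplus> mneg (b \<boxplus> c) = (mneg (a \<boxplus> c) \<boxplus> c) \<boxplus> mneg (b \<boxplus> c)"
    and "mneg b \<boxplus> mneg (a \<boxplus> c) = (mneg (b \<boxplus> c) \<boxplus> c) \<boxplus> mneg (a \<boxplus> c)" by simp_all
  moreover have "(mneg (a \<boxplus> c) \<boxplus> c) \<boxplus> mneg (b \<boxplus> c) = (mneg (b \<boxplus> c) \<boxplus> c) \<boxplus> mneg (a \<boxplus> c)"
    by (simp add: plus_ac)
  ultimately show ?thesis by simp
qed

text \<open>In the group to be built both sides are \<open>a + b + c - 1\<close>. With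
  \<open>d = b \<boxdot> c\<close> and \<open>f = mneg (a \<boxplus> c)\<close>, the element
  \<open>b\<close> splits into \<open>a \<boxplus> d\<close> and \<open>f\<close> without
  truncation; removing \<open>f\<close> leaves the left side.\<close>

lemma plus_times_swap:
  assumes [simp]: "a \<in> mv_carrier A" "b \<in> mv_carrier A" "c \<in> mv_carrier A"
    and "b \<boxplus> c = mone" "mneg a \<boxplus> mneg c = mone"
  shows "a \<boxplus> b \<boxdot> c = b \<boxdot> (a \<boxplus> c)"
proof -
  define d f where "d = b \<boxdot> c" and "f = mneg (a \<boxplus> c)"
  have [simp]: "d \<in> mv_carrier A" "f \<in> mv_carrier A" by (simp_all add: d_def f_def)
  have "mneg (c \<boxplus> a) \<boxplus> a = mneg c"
    using assms(5) by (intro plus_cancel_neg) (simp_all add: plus_commute)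
  then have e: "f \<boxplus> a = mneg c" by (simp add: f_def plus_commute)
  have "d \<boxplus> mneg c = mneg (mneg (mneg c) \<boxplus> b) \<boxplus> b"
    unfolding d_def by (rule lukasiewicz) simp_all
  also have "\<dots> = b" using assms(4) by (simp add: plus_commute)
  finally have b: "b = (a \<boxplus> d) \<boxplus> f" using e by (metis \<open>d \<in> _\<close> \<open>f \<in> _\<close> assms(1) plus_assoc plus_commute)
  have "mneg d \<boxplus> c = mone" by (simp add: d_def plus_assoc)
  then obtain w where [simp]: "w \<in> mv_carrier A" and c: "c = d \<boxplus> w"
    using le_imp_plus[of d c] by (intro that[of "mneg (mneg c \<boxplus> d)"]) simp_all
  have "mneg f = (a \<boxplus> d) \<boxplus> w" by (simp add: f_def c plus_assoc)
  then have "mneg (a \<boxplus> d) \<boxplus> mneg f = mone"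
    using plus_assoc[of "mneg (a \<boxplus> d)" "a \<boxplus> d" w] by simp
  then have "mneg ((a \<boxplus> d) \<boxplus> f) \<boxplus> f = mneg (a \<boxplus> d)"
    by (intro plus_cancel_neg) simp_all
  then have "mneg b \<boxplus> mneg (a \<boxplus> c) = mneg (a \<boxplus> d)"
    unfolding f_def[symmetric] by (subst b)
  then show ?thesis by (simp add: d_def)
qed

text \<open>Used to establish that an algebra is a chain, so it has to be proved equationally. Four
  applications of the Lukasiewicz identity regroup the summands until \<open>x\<close> and
  \<open>mneg x\<close> stand side by side.\<close>

lemma prelinearity:
  assumes [simp]: "x \<in> mv_carrier A" "y \<in> mv_carrier A"
  shows "mneg (mneg (mneg x \<boxplus> y) \<boxplus> (mneg y \<boxplus> x)) \<boxplus> (mneg y \<boxplus> x) = mone"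
proof -
  define q s where "q = mneg (mneg y \<boxplus> x)" and "s = mneg x \<boxplus> q"
  have [simp]: "q \<in> mv_carrier A" "s \<in> mv_carrier A" by (simp_all add: q_def s_def)
  have q: "mneg q = mneg y \<boxplus> x" by (simp add: q_def)
  have "mneg (mneg (mneg x \<boxplus> y) \<boxplus> (mneg y \<boxplus> x)) \<boxplus> (mneg y \<boxplus> x) =
      mneg (mneg (mneg y \<boxplus> x) \<boxplus> (mneg x \<boxplus> y)) \<boxplus> (mneg x \<boxplus> y)"
    by (rule lukasiewicz) simp_all
  also have "\<dots> = mneg x \<boxplus> (mneg (mneg (mneg s) \<boxplus> y) \<boxplus> y)"
    unfolding q_def[symmetric] s_def by (simp add: plus_ac)
  also have "mneg (mneg (mneg s) \<boxplus> y) \<boxplus> y = mneg (mneg y \<boxplus> mneg s) \<boxplus> mneg s"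
    by (rule lukasiewicz) simp_all
  also have "mneg x \<boxplus> \<dots> = mneg (mneg y \<boxplus> mneg s) \<boxplus> (mneg (mneg (mneg q) \<boxplus> mneg x) \<boxplus> mneg x)"
    unfolding s_def by (simp add: plus_ac)
  also have "mneg (mneg (mneg q) \<boxplus> mneg x) \<boxplus> mneg x = mneg (mneg (mneg x) \<boxplus> mneg q) \<boxplus> mneg q"
    by (rule lukasiewicz) simp_all
  also have "mneg (mneg y \<boxplus> mneg s) \<boxplus> \<dots> =
      mneg (x \<boxplus> mneg q) \<boxplus> x \<boxplus> (mneg (mneg (mneg (mneg s)) \<boxplus> mneg y) \<boxplus> mneg y)"
    unfolding q by (simp add: plus_ac)
  also have "mneg (mneg (mneg (mneg s)) \<boxplus> mneg y) \<boxplus> mneg y =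
      mneg (mneg (mneg y) \<boxplus> mneg (mneg s)) \<boxplus> mneg (mneg s)"
    by (rule lukasiewicz) simp_all
  also have "mneg (x \<boxplus> mneg q) \<boxplus> x \<boxplus> \<dots> =
      (x \<boxplus> mneg x) \<boxplus> (mneg (x \<boxplus> mneg q) \<boxplus> mneg (y \<boxplus> s) \<boxplus> q)"
    unfolding s_def by (simp add: plus_ac del: self_plus_neg neg_plus_self)
  also have "\<dots> = mone" by simp
  finally show ?thesis .
qed

end

locale mv_chain = mv_algebra +
  assumes total: "x \<in> mv_carrier A \<Longrightarrow> y \<in> mv_carrier A \<Longrightarrow>
      mv_plus A (mv_neg A x) y = mv_neg A (mv_zero A) \<or>
      mv_plus A (mv_neg A y) x = mv_neg A (mv_zero A)"
    and zero_neq_one: "mv_zero A \<noteq> mv_neg A (mv_zero A)"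
begin

text \<open>Chang's totally ordered group: \<open>(m, a)\<close> with \<open>a < 1\<close> stands for \<open>m + a\<close>, and the order is
  the lexicographic one.\<close>

definition chang_group :: "(int \<times> 'a) monoid" where
  "chang_group = \<lparr>carrier = {(m, a). a \<in> mv_carrier A \<and> a \<noteq> mone},
     monoid.mult = (\<lambda>(m, a) (n, b). if a \<boxplus> b = mone then (m + n + 1, a \<boxdot> b) else (m + n, a \<boxplus> b)),
     one = (0, mzero)\<rparr>"

text \<open>Here linearity enters: \<open>mneg a\<close> and \<open>b\<close> are comparable, so a
  sum that stays below one has no overflow.\<close>

lemma times_zero_if: "a \<in> mv_carrier A \<Longrightarrow> b \<in> mv_carrier A \<Longrightarrow> a \<boxplus> b \<noteq> mone \<Longrightarrow>
    mneg a \<boxplus> mneg b = mone"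
  using total[of "mneg a" b] by (auto simp: plus_commute)

lemma times_neq_one: "a \<in> mv_carrier A \<Longrightarrow> b \<in> mv_carrier A \<Longrightarrow> a \<noteq> mone \<Longrightarrow> a \<boxdot> b \<noteq> mone"
  by (metis neg_inject neg_closed plus_closed zero_closed plus_eq_zero neg_neg)

lemma chang_mult: "monoid.mult chang_group (m, a) (n, b) =
    (if a \<boxplus> b = mone then (m + n + 1, a \<boxdot> b) else (m + n, a \<boxplus> b))"
  by (simp add: chang_group_def)

text \<open>With commutativity this amounts to associativity, but \<open>a\<close> and
  \<open>b\<close> now play symmetric roles. The cases are which of the two inner sums produce a
  carry.\<close>

lemma chang_left_comm:
  assumes [simp]: "a \<in> mv_carrier A" "b \<in> mv_carrier A" "c \<in> mv_carrier A"
    and neq: "a \<noteq> mone" "b \<noteq> mone" "c \<noteq> mone"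
  shows "monoid.mult chang_group (k, a) (monoid.mult chang_group (m, b) (n, c)) =
    monoid.mult chang_group (m, b) (monoid.mult chang_group (k, a) (n, c))"
proof -
  \<comment> \<open>Each side has exactly one carry: the left side in its inner sum, the right side
    in its outer sum.\<close>
  have mixed: "monoid.mult chang_group (k, a) (monoid.mult chang_group (m, b) (n, c)) =
    monoid.mult chang_group (m, b) (monoid.mult chang_group (k, a) (n, c))"
    if [simp]: "a \<in> mv_carrier A" "b \<in> mv_carrier A" and "b \<noteq> mone"
      and *: "b \<boxplus> c = mone" "a \<boxplus> c \<noteq> mone" for k m a b
  proof -
    have e: "a \<boxplus> b \<boxdot> c = b \<boxdot> (a \<boxplus> c)"
      using * by (intro plus_times_swap times_zero_if) simp_all
    have "b \<boxplus> (a \<boxplus> c) = a \<boxplus> (b \<boxplus> c)" by (rule plus_left_commute) simp_all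
    then have f: "b \<boxplus> (a \<boxplus> c) = mone" using * by simp
    have "b \<boxdot> (a \<boxplus> c) \<noteq> mone" using \<open>b \<noteq> mone\<close> by (intro times_neq_one) simp_all
    then have g: "a \<boxplus> b \<boxdot> c \<noteq> mone" unfolding e .
    have "monoid.mult chang_group (k, a) (m + n + 1, b \<boxdot> c) = (k + (m + n + 1), b \<boxdot> (a \<boxplus> c))"
      using g unfolding chang_mult e by simp
    then show ?thesis using * f by (simp add: chang_mult)
  qed
  consider "b \<boxplus> c = mone" "a \<boxplus> c \<noteq> mone" | "b \<boxplus> c \<noteq> mone" "a \<boxplus> c = mone"
    | "b \<boxplus> c \<noteq> mone" "a \<boxplus> c \<noteq> mone" | "b \<boxplus> c = mone" "a \<boxplus> c = mone" by blast
  then show ?thesis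
  proof cases
    case 1
    then show ?thesis using neq by (intro mixed) simp_all
  next
    case 2
    then show ?thesis using neq by (intro mixed[symmetric]) simp_all
  next
    case 3
    have "a \<boxplus> (b \<boxplus> c) = b \<boxplus> (a \<boxplus> c)" by (rule plus_left_commute) simp_all
    moreover have "a \<boxdot> (b \<boxplus> c) = b \<boxdot> (a \<boxplus> c)"
      using 3 by (intro times_plus_swap times_zero_if) simp_all
    ultimately show ?thesis using 3 by (simp add: chang_mult)
  next
    case 4
    \<comment> \<open>When both inner sums carry, negation leads back to the identity for sums
      without truncation.\<close>
    have "mneg a \<boxdot> (mneg b \<boxplus> mneg c) = mneg b \<boxdot> (mneg a \<boxplus> mneg c)"
      using 4 by (intro times_plus_swap) simp_all
    then have "a \<boxplus> b \<boxdot> c = b \<boxplus> a \<boxdot> c" by (simp add: neg_inject)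
    moreover have "a \<boxdot> (b \<boxdot> c) = b \<boxdot> (a \<boxdot> c)"
      using plus_left_commute[of "mneg a" "mneg b" "mneg c"] by simp
    ultimately show ?thesis using 4 by (simp add: chang_mult)
  qed
qed

lemma chang_comm: "a \<in> mv_carrier A \<Longrightarrow> b \<in> mv_carrier A \<Longrightarrow>
    monoid.mult chang_group (m, a) (n, b) = monoid.mult chang_group (n, b) (m, a)"
  by (simp add: chang_mult plus_commute add_ac)

lemma chang_carrier: "(m, a) \<in> carrier chang_group \<longleftrightarrow> a \<in> mv_carrier A \<and> a \<noteq> mone"
  by (simp add: chang_group_def)

lemma chang_closed:
  "x \<in> carrier chang_group \<Longrightarrow> y \<in> carrier chang_group \<Longrightarrow> monoid.mult chang_group x y \<in> carrier chang_group"
  by (cases x; cases y) (auto simp: chang_carrier chang_mult times_neq_one)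

lemma comm_group_chang: "comm_group chang_group"
proof (rule comm_groupI)
  let ?G = chang_group
  show "x \<otimes>\<^bsub>?G\<^esub> y \<in> carrier ?G" if "x \<in> carrier ?G" "y \<in> carrier ?G" for x y
    using that by (rule chang_closed)
  show "\<one>\<^bsub>?G\<^esub> \<in> carrier ?G" by (simp add: chang_group_def zero_neq_one)
  show comm: "x \<otimes>\<^bsub>?G\<^esub> y = y \<otimes>\<^bsub>?G\<^esub> x" if "x \<in> carrier ?G" "y \<in> carrier ?G" for x y
    using that by (cases x; cases y) (simp add: chang_carrier chang_comm)
  show "x \<otimes>\<^bsub>?G\<^esub> y \<otimes>\<^bsub>?G\<^esub> z = x \<otimes>\<^bsub>?G\<^esub> (y \<otimes>\<^bsub>?G\<^esub> z)"
    if xyz: "x \<in> carrier ?G" "y \<in> carrier ?G" "z \<in> carrier ?G" for x y z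
  proof -
    have "x \<otimes>\<^bsub>?G\<^esub> y \<otimes>\<^bsub>?G\<^esub> z = z \<otimes>\<^bsub>?G\<^esub> (x \<otimes>\<^bsub>?G\<^esub> y)" using xyz by (intro comm chang_closed)
    also have "\<dots> = x \<otimes>\<^bsub>?G\<^esub> (z \<otimes>\<^bsub>?G\<^esub> y)"
      using xyz by (cases x; cases y; cases z) (simp add: chang_carrier chang_left_comm)
    also have "z \<otimes>\<^bsub>?G\<^esub> y = y \<otimes>\<^bsub>?G\<^esub> z" using xyz by (intro comm)
    finally show ?thesis .
  qed
  show "\<one>\<^bsub>?G\<^esub> \<otimes>\<^bsub>?G\<^esub> x = x" if "x \<in> carrier ?G" for x
    using that by (cases x) (auto simp: chang_group_def)
  show "\<exists>y\<in>carrier ?G. y \<otimes>\<^bsub>?G\<^esub> x = \<one>\<^bsub>?G\<^esub>" if x: "x \<in> carrier ?G" for x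
  proof -
    obtain m a where [simp]: "x = (m, a)" by fastforce
    have [simp]: "a \<in> mv_carrier A" and a: "a \<noteq> mone" using x by (auto simp: chang_carrier)
    show ?thesis
    proof (cases "a = mzero")
      case True
      then show ?thesis using zero_neq_one
        by (intro bexI[of _ "(- m, mzero)"]) (simp_all add: chang_group_def)
    next
      case False
      then have "mneg a \<noteq> mone" by (simp add: neg_inject)
      \<comment> \<open>\<open>a\<close> and \<open>mneg a\<close> add up to one, and this carry has
        to be compensated in the integer part.\<close>
      then show ?thesis
        by (intro bexI[of _ "(- m - 1, mneg a)"]) (simp_all add: chang_group_def)
    qed
  qed
qed

text \<open>The second component has to stay below one, so the top element becomes the unit
  \<open>(1, mzero)\<close>.\<close>

definition chang_emb :: "'a \<Rightarrow> int \<times> 'a" where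
  "chang_emb a = (if a = mone then (1, mzero) else (0, a))"

lemma chang_emb_carrier: "a \<in> mv_carrier A \<Longrightarrow> chang_emb a \<in> carrier chang_group"
  by (simp add: chang_emb_def chang_carrier zero_neq_one)

text \<open>The one bridge between the MV operations and the group. Below one the overflow is zero
  by linearity; otherwise the truncated sum is the unit and the overflow is the fractional
  part.\<close>

lemma chang_emb_plus:
  assumes [simp]: "a \<in> mv_carrier A" "b \<in> mv_carrier A"
  shows "chang_emb a \<otimes>\<^bsub>chang_group\<^esub> chang_emb b = chang_emb (a \<boxplus> b) \<otimes>\<^bsub>chang_group\<^esub> chang_emb (a \<boxdot> b)"
proof -
  consider "a = mone" | "b = mone" | "a \<noteq> mone" "b \<noteq> mone" by blast
  then show ?thesis
  proof cases
    case 3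
    then have "a \<boxdot> b \<noteq> mone" by (intro times_neq_one) simp_all
    with 3 show ?thesis using zero_neq_one times_zero_if[of a b]
      by (cases "a \<boxplus> b = mone") (simp_all add: chang_emb_def chang_mult)
  qed (use zero_neq_one in \<open>auto simp: chang_emb_def chang_mult plus_commute[of b]\<close>)
qed

end

subsection \<open>Integer forms evaluated in an abelian group\<close>

context comm_group
begin

text \<open>The analogue of \<open>ev\<close> in multiplicative notation: coefficients become
  exponents.\<close>

definition form_val :: "('v \<Rightarrow> 'a) \<Rightarrow> ('v \<Rightarrow> int) \<Rightarrow> 'a" where
  "form_val g f = (\<Otimes>v\<in>{v. f v \<noteq> 0}. g v [^] f v)"

context
  fixes g :: "'v \<Rightarrow> 'a"
  assumes g: "\<And>v. g v \<in> carrier G"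
begin

lemma form_val_closed: "form_val g f \<in> carrier G"
  unfolding form_val_def using g by (intro finprod_closed) auto

lemma form_val_superset:
  assumes "finite X" "{v. f v \<noteq> 0} \<subseteq> X"
  shows "form_val g f = (\<Otimes>v\<in>X. g v [^] f v)"
  unfolding form_val_def using assms g
  by (intro finprod_mono_neutral_cong_left) auto

lemma form_val_add:
  assumes "fin_form a" "fin_form b"
  shows "form_val g (a + b) = form_val g a \<otimes> form_val g b"
proof -
  let ?X = "{v. a v \<noteq> 0} \<union> {v. b v \<noteq> 0}"
  have f: "finite ?X" using assms by (simp add: fin_form_def)
  have "form_val g (a + b) = (\<Otimes>v\<in>?X. g v [^] (a + b) v)" by (rule form_val_superset[OF f]) auto
  also have "\<dots> = (\<Otimes>v\<in>?X. g v [^] a v \<otimes> g v [^] b v)"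
    using g by (intro finprod_cong) (auto simp: int_pow_mult simp_implies_def)
  also have "\<dots> = (\<Otimes>v\<in>?X. g v [^] a v) \<otimes> (\<Otimes>v\<in>?X. g v [^] b v)"
    using g by (intro finprod_multf) auto
  also have "\<dots> = form_val g a \<otimes> form_val g b"
    by (simp add: form_val_superset[OF f, of a] form_val_superset[OF f, of b])
  finally show ?thesis .
qed

lemma form_val_zero: "form_val g 0 = \<one>"
  by (simp add: form_val_def)

lemma form_val_delta: "form_val g (delta v) = g v"
  using g by (subst form_val_superset[of "{v}"]) (auto simp: delta_def)

lemma form_val_diff:
  assumes "fin_form a" "fin_form b"
  shows "form_val g (a - b) = form_val g a \<otimes> inv form_val g b"
proof -
  have "form_val g a = form_val g ((a - b) + b)" by simp
  also have "\<dots> = form_val g (a - b) \<otimes> form_val g b" using assms by (intro form_val_add) auto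
  finally show ?thesis by (simp add: form_val_closed m_assoc)
qed

end

end

subsection \<open>Prime theories and positive cones\<close>

text \<open>A derivation uses finitely many premises, and these lie in one member of the chain. The
  empty set is added to cover the empty chain.\<close>

lemma luk_derives_chain:
  assumes "subset.chain \<A> C" "T \<union> \<Union>C \<turnstile>\<^sub>L \<phi>"
  shows "\<exists>S\<in>insert {} C. T \<union> S \<turnstile>\<^sub>L \<phi>"
  using assms(2)
proof (induction rule: luk_derives.induct)
  case (premise \<phi>)
  then show ?case by (auto intro: luk_derives.premise)
next
  case (axiom \<phi>)
  then show ?case by (auto intro: luk_derives.axiom)
next
  case (mp \<phi> \<psi>)
  then obtain S S' where S: "S \<in> insert {} C" "T \<union> S \<turnstile>\<^sub>L \<phi>" "S' \<in> insert {} C" "T \<union> S' \<turnstile>\<^sub>L Imp \<phi> \<psi>"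
    by blast
  then have "S \<subseteq> S' \<or> S' \<subseteq> S" using assms(1) by (auto simp: subset_chain_def)
  then have "S \<union> S' \<in> insert {} C" using S by (auto simp: sup.absorb1 sup.absorb2)
  moreover have "T \<union> (S \<union> S') \<turnstile>\<^sub>L \<psi>"
    by (rule luk_derives.mp[OF luk_derives_mono[OF S(2)] luk_derives_mono[OF S(4)]]) auto
  ultimately show ?case by blast
qed

text \<open>Zorn's lemma for the extensions of \<open>T\<close> that do not prove \<psi>. Maximality
  relative to \<psi> is what makes prelinearity decide between two implications.\<close>

lemma luk_maximal_theory:
  assumes "\<not> T \<turnstile>\<^sub>L \<psi>"
  obtains N where "T \<subseteq> N" "\<not> N \<turnstile>\<^sub>L \<psi>" "\<And>a. \<not> N \<turnstile>\<^sub>L a \<Longrightarrow> insert a N \<turnstile>\<^sub>L \<psi>"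
proof -
  let ?A = "{S. \<not> T \<union> S \<turnstile>\<^sub>L \<psi>}"
  have "\<exists>M\<in>?A. \<forall>X\<in>?A. M \<subseteq> X \<longrightarrow> X = M"
  proof (rule subset_Zorn')
    fix C assume C: "subset.chain ?A C"
    show "\<Union>C \<in> ?A"
    proof (rule ccontr)
      assume "\<Union>C \<notin> ?A"
      then obtain S where "S \<in> insert {} C" "T \<union> S \<turnstile>\<^sub>L \<psi>" using luk_derives_chain[OF C] by blast
      with C assms show False by (auto simp: subset_chain_def)
    qed
  qed
  then obtain M where M: "\<not> T \<union> M \<turnstile>\<^sub>L \<psi>" "\<And>X. \<not> T \<union> X \<turnstile>\<^sub>L \<psi> \<Longrightarrow> M \<subseteq> X \<Longrightarrow> X = M" by auto
  show ?thesis
  proof (rule that)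
    show "insert a (T \<union> M) \<turnstile>\<^sub>L \<psi>" if "\<not> T \<union> M \<turnstile>\<^sub>L a" for a
    proof (rule ccontr)
      assume *: "\<not> insert a (T \<union> M) \<turnstile>\<^sub>L \<psi>"
      have "a \<notin> M" using that by (auto intro: luk_derives.premise)
      with M(2)[of "insert a M"] * show False by auto
    qed
  qed (use M in auto)
qed

text \<open>If neither implication were derivable, adding either one would yield \<psi>, and proof
  by cases on prelinearity would derive \<psi> itself.\<close>

lemma mv_chain_lindenbaum:
  assumes "\<not> N \<turnstile>\<^sub>L \<psi>" "\<And>a. \<not> N \<turnstile>\<^sub>L a \<Longrightarrow> insert a N \<turnstile>\<^sub>L \<psi>"
  shows "mv_chain (lindenbaum N)"
proof -
  interpret mv_algebra "lindenbaum N" by (rule mv_algebra_lindenbaum)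
  have lin: "N \<turnstile>\<^sub>L Imp a b \<or> N \<turnstile>\<^sub>L Imp b a" for a b
  proof (rule ccontr)
    assume "\<not> (N \<turnstile>\<^sub>L Imp a b \<or> N \<turnstile>\<^sub>L Imp b a)"
    then have "insert (Imp a b) N \<turnstile>\<^sub>L \<psi>" "insert (Imp b a) N \<turnstile>\<^sub>L \<psi>" using assms(2) by auto
    moreover have "nf N (Or (Imp a b) (Imp b a)) = nf N (Neg Bot)"
      using prelinearity[of "nf N a" "nf N b"] by (simp add: Or_def Imp_def)
    then have "N \<turnstile>\<^sub>L Or (Imp a b) (Imp b a)" by (simp add: nf_eq_Top_iff)
    ultimately have "N \<turnstile>\<^sub>L \<psi>" by (rule luk_derives_cases)
    with assms(1) show False by contradiction
  qed
  show ?thesis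
  proof
    fix x y assume "x \<in> mv_carrier (lindenbaum N)" "y \<in> mv_carrier (lindenbaum N)"
    then obtain a b where [simp]: "x = nf N a" "y = nf N b" by (auto simp: lindenbaum_def)
    have "nf N (Imp a b) = nf N (Neg Bot) \<or> nf N (Imp b a) = nf N (Neg Bot)"
      using lin by (simp add: nf_eq_Top_iff)
    then show "mv_plus (lindenbaum N) (mv_neg (lindenbaum N) x) y =
          mv_neg (lindenbaum N) (mv_zero (lindenbaum N)) \<or>
        mv_plus (lindenbaum N) (mv_neg (lindenbaum N) y) x =
          mv_neg (lindenbaum N) (mv_zero (lindenbaum N))"
      by (simp add: Imp_def)
  next
    have "\<not> N \<turnstile>\<^sub>L Bot"
    proof
      assume "N \<turnstile>\<^sub>L Bot"
      moreover have "N \<turnstile>\<^sub>L Imp Bot \<psi>" by (rule imp_mp[OF neg_elim Bot_false])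
      ultimately show False using assms(1) imp_mp by blast
    qed
    then show "mv_zero (lindenbaum N) \<noteq> mv_neg (lindenbaum N) (mv_zero (lindenbaum N))"
      by (simp add: nf_eq_Top_iff)
  qed
qed

text \<open>The nonnegative integer forms in the values of formulas under a valuation in a totally
  ordered abelian group whose unit is the value of \<open>Top\<close>.\<close>

locale mv_cone =
  fixes NN :: "('a fm \<Rightarrow> int) \<Rightarrow> bool"
  assumes NN_add: "NN a \<Longrightarrow> NN b \<Longrightarrow> NN (a + b)"
    and NN_zero: "NN 0"
    and NN_delta: "NN (delta \<phi>)"
    and NN_Bot: "NN (- delta Bot)"
    and NN_Neg1: "NN (delta \<phi> + delta (Neg \<phi>) - delta Top)"
    and NN_Neg2: "NN (delta Top - delta \<phi> - delta (Neg \<phi>))"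
    and NN_plus1: "NN (delta \<phi> + delta \<psi> - delta (Oplus \<phi> \<psi>) - delta (Odot \<phi> \<psi>))"
    and NN_plus2: "NN (delta (Oplus \<phi> \<psi>) + delta (Odot \<phi> \<psi>) - delta \<phi> - delta \<psi>)"
    and NN_cases: "NN (delta (Oplus \<phi> \<psi>) - delta Top) \<or> NN (- delta (Odot \<phi> \<psi>))"

text \<open>After this theorem the group is gone: everything else is read off from which integer
  forms are nonnegative.\<close>

theorem prime_cone:
  assumes "\<not> T \<turnstile>\<^sub>L \<psi>"
  obtains NN where "mv_cone NN" "\<And>\<phi>. T \<turnstile>\<^sub>L \<phi> \<Longrightarrow> NN (delta \<phi> - delta Top)"
    "\<not> NN (delta \<psi> - delta Top)"
proof -
  obtain N where TN: "T \<subseteq> N" and N: "\<not> N \<turnstile>\<^sub>L \<psi>" "\<And>a. \<not> N \<turnstile>\<^sub>L a \<Longrightarrow> insert a N \<turnstile>\<^sub>L \<psi>"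
    using luk_maximal_theory[OF assms] by metis
  interpret mv_chain "lindenbaum N" using N by (rule mv_chain_lindenbaum)
  let ?G = chang_group
  interpret G: comm_group ?G by (rule comm_group_chang)
  define g where "g = (\<lambda>\<phi>. chang_emb (nf N \<phi>))"
  have g: "g \<phi> \<in> carrier ?G" for \<phi> by (simp add: g_def chang_emb_carrier)
  define val where "val = G.form_val g"
  \<comment> \<open>Fractional parts are nonnegative, so in the lexicographic order the integer part
    alone decides the sign.\<close>
  define NN where "NN = (\<lambda>f. fin_form f \<and> fst (val f) \<ge> 0)"
  have closed: "val f \<in> carrier ?G" for f unfolding val_def by (rule G.form_val_closed[OF g])
  have add: "val (a + b) = val a \<otimes>\<^bsub>?G\<^esub> val b" if "fin_form a" "fin_form b" for a b
    unfolding val_def using that by (intro G.form_val_add g)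
  have diff: "val (a - b) = val a \<otimes>\<^bsub>?G\<^esub> inv\<^bsub>?G\<^esub> val b" if "fin_form a" "fin_form b" for a b
    unfolding val_def using that by (intro G.form_val_diff g)
  have delta: "val (delta \<phi>) = g \<phi>" for \<phi> unfolding val_def by (rule G.form_val_delta[OF g])
  have one: "\<one>\<^bsub>?G\<^esub> = (0, mv_zero (lindenbaum N))" by (simp add: chang_group_def)
  \<comment> \<open>A carry can only raise the integer part, which makes the cone closed under
    sums.\<close>
  have mono: "fst (x \<otimes>\<^bsub>?G\<^esub> y) \<ge> fst x + fst y" for x y
    by (cases x; cases y) (simp add: chang_mult)
  have eq: "NN (a - b)" if "fin_form a" "fin_form b" "val a = val b" for a b
    using that closed[of b] by (simp add: NN_def diff one)
  have zero: "val 0 = \<one>\<^bsub>?G\<^esub>" by (simp add: val_def G.form_val_zero[OF g])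
  have gTop: "g Top = chang_emb (mv_neg (lindenbaum N) (mv_zero (lindenbaum N)))"
    by (simp add: g_def Top_def)
  have eqTop: "NN (delta \<phi> - delta Top)" if "N \<turnstile>\<^sub>L \<phi>" for \<phi>
    using that by (intro eq) (simp_all add: delta g_def Top_def flip: nf_eq_Top_iff)
  have plus: "g \<phi> \<otimes>\<^bsub>?G\<^esub> g \<theta> = g (Oplus \<phi> \<theta>) \<otimes>\<^bsub>?G\<^esub> g (Odot \<phi> \<theta>)" for \<phi> \<theta>
    using chang_emb_plus[of "nf N \<phi>" "nf N \<theta>"] by (simp add: g_def Odot_def)
  have gBot: "g Bot = \<one>\<^bsub>?G\<^esub>"
    using zero_neq_one unfolding one by (simp add: g_def chang_emb_def)
  have neg: "g \<phi> \<otimes>\<^bsub>?G\<^esub> g (Neg \<phi>) = g Top" for \<phi>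
  proof -
    have one: "nf N (Oplus \<alpha> (Neg \<alpha>)) = nf N (Neg Bot)" for \<alpha>
      using self_plus_neg[of "nf N \<alpha>"] by simp
    have "nf N (Odot \<phi> (Neg \<phi>)) = nf N (Neg (nf N (Oplus (Neg \<phi>) (Neg (Neg \<phi>)))))"
      by (simp add: Odot_def)
    also have "\<dots> = nf N Bot" using neg_neg[of "nf N Bot"] by (simp add: one)
    finally have "g (Oplus \<phi> (Neg \<phi>)) = g Top" "g (Odot \<phi> (Neg \<phi>)) = g Bot"
      using one by (simp_all add: g_def Top_def)
    then show ?thesis using plus[of \<phi> "Neg \<phi>"] g by (simp add: gBot)
  qed
  have "mv_cone NN"
  proof
    show "NN (a + b)" if "NN a" "NN b" for a b
      using that mono[of "val a" "val b"] by (auto simp: NN_def add)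
    show "NN 0" by (simp add: NN_def zero one)
    show "NN (delta \<phi>)" for \<phi> by (simp add: NN_def delta g_def chang_emb_def)
    show "NN (- delta Bot)" using eq[of 0 "delta Bot"] by (simp add: zero delta gBot)
    show "NN (delta \<phi> + delta (Neg \<phi>) - delta Top)" for \<phi>
      by (rule eq) (simp_all add: add delta neg)
    show "NN (delta Top - delta \<phi> - delta (Neg \<phi>))" for \<phi>
      unfolding diff_diff_eq by (rule eq) (simp_all add: add delta neg)
    show "NN (delta \<phi> + delta \<theta> - delta (Oplus \<phi> \<theta>) - delta (Odot \<phi> \<theta>))" for \<phi> \<theta>
      unfolding diff_diff_eq by (rule eq) (simp_all add: add delta plus[of \<phi> \<theta>])
    show "NN (delta (Oplus \<phi> \<theta>) + delta (Odot \<phi> \<theta>) - delta \<phi> - delta \<theta>)" for \<phi> \<theta>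
      unfolding diff_diff_eq by (rule eq) (simp_all add: add delta plus[of \<phi> \<theta>])
    show "NN (delta (Oplus \<phi> \<theta>) - delta Top) \<or> NN (- delta (Odot \<phi> \<theta>))" for \<phi> \<theta>
    proof (cases "N \<turnstile>\<^sub>L Oplus \<phi> \<theta>")
      case False
      then have "nf N (Oplus \<phi> \<theta>) \<noteq> nf N (Neg Bot)" by (simp add: nf_eq_Top_iff)
      then have "nf N (Oplus (Neg \<phi>) (Neg \<theta>)) = nf N (Neg Bot)"
        using times_zero_if[of "nf N \<phi>" "nf N \<theta>"] by simp
      then have "nf N (Odot \<phi> \<theta>) = nf N (Neg (Neg Bot))"
        unfolding Odot_def by (metis nf_Neg)
      also have "\<dots> = nf N Bot" using neg_neg[of "nf N Bot"] by simp
      finally have "g (Odot \<phi> \<theta>) = \<one>\<^bsub>?G\<^esub>" by (simp add: g_def flip: gBot)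
      then show ?thesis using eq[of 0 "delta (Odot \<phi> \<theta>)"] by (simp add: zero delta)
    qed (use eqTop in blast)
  qed
  moreover have "NN (delta \<phi> - delta Top)" if "T \<turnstile>\<^sub>L \<phi>" for \<phi>
    by (rule eqTop) (rule luk_derives_mono[OF that TN])
  moreover have "\<not> NN (delta \<psi> - delta Top)"
  proof -
    let ?z = "mv_zero (lindenbaum N)"
    have c: "(- 1, ?z) \<in> carrier ?G" "(1, ?z) \<in> carrier ?G" using zero_neq_one by (auto simp: chang_carrier)
    have "(- 1, ?z) \<otimes>\<^bsub>?G\<^esub> (1, ?z) = \<one>\<^bsub>?G\<^esub>"
      using zero_neq_one zero_plus[of ?z] by (simp add: chang_mult one)
    then have "inv\<^bsub>?G\<^esub> (1, ?z) = (- 1, ?z)" using c by (intro G.inv_equality)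
    moreover have "g Top = (1, ?z)" by (simp add: gTop chang_emb_def)
    moreover have neq: "nf N \<psi> \<noteq> mv_neg (lindenbaum N) ?z" using N(1) by (simp add: nf_eq_Top_iff)
    then have "g \<psi> = (0, nf N \<psi>)" by (simp add: g_def chang_emb_def)
    \<comment> \<open>\<psi> is not derivable, so its value has integer part 0; subtracting the unit
      leaves -1.\<close>
    ultimately have "fst (val (delta \<psi> - delta Top)) = - 1"
      using neq plus_zero[of "nf N \<psi>"] by (simp add: diff delta chang_mult)
    then show ?thesis by (simp add: NN_def)
  qed
  ultimately show ?thesis by (rule that)
qed

section \<open>Implication in a cone, and transfer to the reals\<close>

context mv_cone
begin

lemma NN_le_Top: "NN (delta Top - delta \<phi>)"
  using NN_add[OF NN_Neg2[of \<phi>] NN_delta[of "Neg \<phi>"]] by simp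

lemma NN_trans: "NN (b - a) \<Longrightarrow> NN (c - b) \<Longrightarrow> NN (c - a)"
  using NN_add[of "b - a" "c - b"] by simp

text \<open>This lemma and the next two are the pieces of the formula
  \<open>min Top (Top - p + q)\<close> for the value of an implication. In each, instances of the
  cone axioms are chosen so that their sum telescopes.\<close>

lemma NN_ImpD:
  assumes "NN (delta (Imp p q) - delta Top)"
  shows "NN (delta q - delta p)"
proof -
  let ?n = "delta (Neg p)" and ?d = "delta (Odot (Neg p) q)"
  have "NN ((?n + delta q - delta (Oplus (Neg p) q) - ?d) + (delta (Oplus (Neg p) q) - delta Top)
      + ?d + (delta Top - delta p - ?n))"
    by (intro NN_add NN_plus1 NN_Neg2 NN_delta assms[unfolded Imp_def])
  then show ?thesis by (simp add: algebra_simps)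
qed

lemma NN_Imp_upper: "NN (delta Top - delta p + delta q - delta (Imp p q))"
proof -
  let ?n = "delta (Neg p)" and ?d = "delta (Odot (Neg p) q)"
  have "NN ((?n + delta q - delta (Oplus (Neg p) q) - ?d) + ?d + (delta Top - delta p - ?n))"
    by (intro NN_add NN_plus1 NN_Neg2 NN_delta)
  then show ?thesis by (simp add: Imp_def algebra_simps)
qed

lemma NN_Imp_lower:
  assumes "NN (delta p - delta q)"
  shows "NN (delta (Imp p q) - (delta Top - delta p + delta q))"
  unfolding Imp_def using NN_cases
proof
  let ?n = "delta (Neg p)" and ?d = "delta (Odot (Neg p) q)"
  assume "NN (- ?d)"
  then have "NN ((delta (Oplus (Neg p) q) + ?d - ?n - delta q) + (- ?d) + (delta p + ?n - delta Top))"
    by (intro NN_add NN_plus2 NN_Neg1)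
  then show "NN (delta (Oplus (Neg p) q) - (delta Top - delta p + delta q))"
    by (simp add: algebra_simps)
next
  assume "NN (delta (Oplus (Neg p) q) - delta Top)"
  then have "NN ((delta (Oplus (Neg p) q) - delta Top) + (delta p - delta q))"
    by (intro NN_add assms)
  then show "NN (delta (Oplus (Neg p) q) - (delta Top - delta p + delta q))"
    by (simp add: algebra_simps)
qed

text \<open>Lying in the cone, and for strict constraints having no negative there, is preserved by
  sums: from \<open>- (a + b)\<close> one gets \<open>- b\<close> by adding \<open>a\<close>, and
  \<open>- a\<close> by adding \<open>b\<close>. The zero form cannot be strict in this
  sense.\<close>

lemma cone_satisfiable:
  assumes "finite S" "\<And>c. c \<in> S \<Longrightarrow> fin_form (snd c)"
    and "\<And>c. c \<in> S \<Longrightarrow> NN (snd c) \<and> (fst c \<longrightarrow> \<not> NN (- snd c))"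
  shows "\<exists>r. \<forall>c\<in>S. sat r c"
proof (rule motzkin_transposition[OF assms(1,2)])
  have "NN (snd c) \<and> (fst c \<longrightarrow> \<not> NN (- snd c))" if "c \<in> der S" for c
    using that
  proof (induction rule: der.induct)
    case (base c)
    then show ?case by (rule assms(3))
  next
    case (add p a q b)
    have "\<not> NN (- (a + b))" if "p \<or> q"
    proof
      assume *: "NN (- (a + b))"
      have ab: "NN a" "NN b" using add.IH by simp_all
      have "NN (- (a + b) + a)" "NN (- (a + b) + b)" by (rule NN_add[OF * ab(1)], rule NN_add[OF * ab(2)])
      moreover have "- (a + b) + a = - b" "- (a + b) + b = - a" by simp_all
      ultimately have "NN (- b)" "NN (- a)" by simp_all
      then show False using add.IH that unfolding fst_conv snd_conv by blast
    qed
    then show ?case using add.IH NN_add[of a b] unfolding fst_conv snd_conv by blast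
  qed
  then show "(True, 0) \<notin> der S" using NN_zero by force
qed

end

subsection \<open>Tableaux of linear constraints\<close>

primrec subf :: "'a fm \<Rightarrow> 'a fm set" where
  "subf (Atom p) = {Atom p}"
| "subf Bot = {Bot}"
| "subf (Neg \<phi>) = insert (Neg \<phi>) (subf \<phi>)"
| "subf (Oplus \<phi> \<psi>) = insert (Oplus \<phi> \<psi>) (subf \<phi> \<union> subf \<psi>)"

lemma finite_subf [simp]: "finite (subf \<phi>)"
  by (induction \<phi>) auto

lemma subf_refl [simp]: "\<phi> \<in> subf \<phi>"
  by (cases \<phi>) auto

lemma subf_trans: "\<psi> \<in> subf \<phi> \<Longrightarrow> subf \<psi> \<subseteq> subf \<phi>"
  by (induction \<phi>) auto

lemma Atom_subf: "Atom p \<in> subf \<phi> \<longleftrightarrow> p \<in> atoms \<phi>"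
  by (induction \<phi>) auto

text \<open>A branch \<open>\<sigma>\<close> of the tableau fixes which truncated sums take the value 1. The variable
  of a formula is the formula itself, and \<open>Top\<close> is the unit, so all constraints are homogeneous.\<close>

fun tabc :: "'a fm set \<Rightarrow> 'a fm \<Rightarrow> ('a fm \<Rightarrow> int) set" where
  "tabc \<sigma> (Atom p) = {}"
| "tabc \<sigma> Bot = {- delta Bot}"
| "tabc \<sigma> (Neg \<phi>) = {delta \<phi> + delta (Neg \<phi>) - delta Top, delta Top - delta \<phi> - delta (Neg \<phi>)}"
| "tabc \<sigma> (Oplus \<phi> \<psi>) =
     (if Oplus \<phi> \<psi> \<in> \<sigma> then {delta \<phi> + delta \<psi> - delta Top, delta (Oplus \<phi> \<psi>) - delta Top}
      else {delta Top - delta \<phi> - delta \<psi>, delta \<phi> + delta \<psi> - delta (Oplus \<phi> \<psi>),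
        delta (Oplus \<phi> \<psi>) - delta \<phi> - delta \<psi>})"

definition tab :: "'a fm set \<Rightarrow> 'a fm set \<Rightarrow> ('a fm \<Rightarrow> int) set" where
  "tab \<sigma> W = (\<Union>\<theta>\<in>W. {delta \<theta>, delta Top - delta \<theta>} \<union> tabc \<sigma> \<theta>)"

lemma finite_tabc [simp]: "finite (tabc \<sigma> \<theta>)"
  by (cases \<theta>) auto

lemma finite_tab [simp]: "finite W \<Longrightarrow> finite (tab \<sigma> W)"
  by (auto simp: tab_def)

lemma tabc_support: "a \<in> tabc \<sigma> \<theta> \<Longrightarrow> {v. a v \<noteq> 0} \<subseteq> insert Top (subf \<theta>)"
  by (cases \<theta>) (auto simp: delta_def split: if_splits)

lemma tab_support:
  assumes "\<And>\<theta>. \<theta> \<in> W \<Longrightarrow> subf \<theta> \<subseteq> W" "a \<in> tab \<sigma> W"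
  shows "{v. a v \<noteq> 0} \<subseteq> insert Top W"
proof -
  obtain \<theta> where "\<theta> \<in> W" "a \<in> {delta \<theta>, delta Top - delta \<theta>} \<union> tabc \<sigma> \<theta>"
    using assms(2) by (auto simp: tab_def)
  then show ?thesis using assms(1)[of \<theta>] tabc_support[of a \<sigma> \<theta>]
    by (auto simp: delta_def split: if_splits)
qed

lemma fin_form_tab: "a \<in> tab \<sigma> W \<Longrightarrow> fin_form a"
proof -
  have "fin_form a" if "a \<in> tabc \<sigma> \<theta>" for \<theta>
    using that by (cases \<theta>) (auto split: if_splits)
  then show "a \<in> tab \<sigma> W \<Longrightarrow> fin_form a" by (auto simp: tab_def)
qed

abbreviation std_eval :: "('a \<Rightarrow> real) \<Rightarrow> 'a fm \<Rightarrow> real" where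
  "std_eval \<equiv> mv_eval std_mv"

lemma std_mv_simps [simp]:
  "mv_carrier std_mv = {0..1}" "mv_plus std_mv x y = min 1 (x + y)" "mv_neg std_mv x = 1 - x"
  "mv_zero std_mv = 0"
  by (simp_all add: std_mv_def)

lemma std_eval_Top [simp]: "std_eval y Top = 1"
  by (simp add: Top_def)

lemma std_eval_bounds: "(\<And>p. p \<in> atoms \<phi> \<Longrightarrow> y p \<in> {0..1}) \<Longrightarrow> std_eval y \<phi> \<in> {0..1}"
  by (induction \<phi>) auto

lemma mv_eval_cong: "(\<And>p. p \<in> atoms \<phi> \<Longrightarrow> g p = g' p) \<Longrightarrow> mv_eval A g \<phi> = mv_eval A g' \<phi>"
  by (induction \<phi>) auto

lemma tabc_subset_tab: "\<theta> \<in> W \<Longrightarrow> tabc \<sigma> \<theta> \<subseteq> tab \<sigma> W"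
  unfolding tab_def by blast

lemma tab_bounds:
  assumes "\<forall>a\<in>tab \<sigma> W. ev a r \<ge> 0" "\<theta> \<in> W"
  shows "0 \<le> r \<theta>" "r \<theta> \<le> r Top"
proof -
  have "delta \<theta> \<in> tab \<sigma> W" "delta Top - delta \<theta> \<in> tab \<sigma> W" using assms(2) by (auto simp: tab_def)
  then have "ev (delta \<theta>) r \<ge> 0" "ev (delta Top - delta \<theta>) r \<ge> 0" using assms(1) by blast+
  then show "0 \<le> r \<theta>" "r \<theta> \<le> r Top" by auto
qed

text \<open>Dividing by the value of the unit turns a solution into a truth assignment. The clamp
  changes nothing on atoms in \<open>W\<close> and forces all other atoms into the unit
  interval.\<close>

lemma tab_solution:
  assumes "\<forall>a\<in>tab \<sigma> W. ev a r \<ge> 0" "r Top > 0" "subf \<theta> \<subseteq> W"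
  shows "r \<theta> = r Top * std_eval (\<lambda>p. max 0 (min 1 (r (Atom p) / r Top))) \<theta>"
  using assms(3)
proof (induction \<theta>)
  case (Atom p)
  then show ?case using tab_bounds[OF assms(1), of "Atom p"] assms(2) by (simp add: min_def max_def)
next
  case Bot
  then have "- delta Bot \<in> tab \<sigma> W" by (force simp: tab_def)
  with assms(1) have "ev (- delta Bot) r \<ge> 0" by blast
  then show ?case using tab_bounds[OF assms(1), of Bot] Bot by simp
next
  case (Neg \<theta>)
  then have "tabc \<sigma> (Neg \<theta>) \<subseteq> tab \<sigma> W" by (intro tabc_subset_tab) simp
  with assms(1) have "\<forall>a\<in>tabc \<sigma> (Neg \<theta>). ev a r \<ge> 0" by blast
  then have "r (Neg \<theta>) = r Top - r \<theta>" by simp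
  then show ?case using Neg by (simp add: algebra_simps)
next
  case (Oplus \<phi> \<psi>)
  then have "tabc \<sigma> (Oplus \<phi> \<psi>) \<subseteq> tab \<sigma> W" by (intro tabc_subset_tab) simp
  with assms(1) have *: "\<forall>a\<in>tabc \<sigma> (Oplus \<phi> \<psi>). ev a r \<ge> 0" by blast
  have "r (Oplus \<phi> \<psi>) \<le> r Top" using tab_bounds[OF assms(1)] Oplus.prems by auto
  with * have "r (Oplus \<phi> \<psi>) = min (r Top) (r \<phi> + r \<psi>)" by (auto split: if_splits)
  also have "\<dots> = r Top * min 1 ((r \<phi> + r \<psi>) / r Top)" using assms(2) by (simp add: min_mult_distrib_left)
  also have "(r \<phi> + r \<psi>) / r Top = r \<phi> / r Top + r \<psi> / r Top" by (rule add_divide_distrib)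
  finally show ?case using Oplus assms(2) by simp
qed

lemma tab_eval:
  assumes "\<And>p. y p \<in> {0..1}"
    and a: "a \<in> tab {\<theta>. \<exists>\<phi> \<psi>. \<theta> = Oplus \<phi> \<psi> \<and> std_eval y \<phi> + std_eval y \<psi> \<ge> 1} W" (is "_ \<in> tab ?\<sigma> W")
  shows "ev a (std_eval y) \<ge> 0"
proof -
  obtain \<theta> where "a \<in> {delta \<theta>, delta Top - delta \<theta>} \<union> tabc ?\<sigma> \<theta>"
    using a by (auto simp: tab_def)
  then show ?thesis using std_eval_bounds[where \<phi> = \<theta> and y = y, OF assms(1)]
    by (cases \<theta>) (auto split: if_splits)
qed

text \<open>The cone selects its own branch. On a sum that does not reach the unit,
  \<open>NN_cases\<close> makes the overflow vanish, and the sum becomes exact.\<close>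

lemma (in mv_cone) NN_tab:
  assumes "a \<in> tab {\<theta>. NN (delta \<theta> - delta Top)} W"
  shows "NN a"
proof -
  let ?\<sigma> = "{\<theta>. NN (delta \<theta> - delta Top)}"
  obtain \<theta> where "a \<in> {delta \<theta>, delta Top - delta \<theta>} \<union> tabc ?\<sigma> \<theta>"
    using assms by (auto simp: tab_def)
  moreover have "NN a" if "a \<in> tabc ?\<sigma> (Oplus \<phi> \<psi>)" for \<phi> \<psi>
  proof -
    let ?o = "delta (Oplus \<phi> \<psi>)" and ?d = "delta (Odot \<phi> \<psi>)"
    show ?thesis
    proof (cases "NN (?o - delta Top)")
      case True
      then have "NN ((delta \<phi> + delta \<psi> - ?o - ?d) + (?o - delta Top) + ?d)"
        by (intro NN_add NN_plus1 NN_delta)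
      then have "NN (delta \<phi> + delta \<psi> - delta Top)" by (simp add: algebra_simps)
      then show ?thesis using that True by auto
    next
      case False
      then have d: "NN (- ?d)" using NN_cases by blast
      have "NN ((?o + ?d - delta \<phi> - delta \<psi>) + (- ?d) + (delta Top - ?o))"
        "NN ((delta \<phi> + delta \<psi> - ?o - ?d) + ?d)" "NN ((?o + ?d - delta \<phi> - delta \<psi>) + (- ?d))"
        by (intro NN_add NN_plus1 NN_plus2 NN_delta NN_le_Top d)+
      then have "NN (delta Top - delta \<phi> - delta \<psi>)" "NN (delta \<phi> + delta \<psi> - ?o)"
        "NN (?o - delta \<phi> - delta \<psi>)" by (simp_all add: algebra_simps)
      then show ?thesis using that False by auto
    qed
  qed
  ultimately show ?thesis using NN_delta NN_le_Top NN_Bot NN_Neg1 NN_Neg2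
    by (cases \<theta>) auto
qed

text \<open>A cone in which \<phi> stays below the unit satisfies one branch of the tableau for
  \<phi>. A real solution of that branch, normalized, is an assignment that refutes \<phi>.\<close>

theorem luk_completeness:
  assumes "\<And>y. (\<And>p. y p \<in> {0..1}) \<Longrightarrow> std_eval y \<phi> = 1"
  shows "luk_provable \<phi>"
proof (rule ccontr)
  assume "\<not> luk_provable \<phi>"
  then have "\<not> {} \<turnstile>\<^sub>L \<phi>" by (simp add: luk_provable_iff_derives)
  then obtain NN where "mv_cone NN" and \<phi>: "\<not> NN (delta \<phi> - delta Top)" by (rule prime_cone)
  interpret mv_cone NN by fact
  let ?T = "tab {\<theta>. NN (delta \<theta> - delta Top)} (subf \<phi>)"
  have "\<exists>r. \<forall>c\<in>insert (True, delta Top - delta \<phi>) (Pair False ` ?T). sat r c"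
    using \<phi> NN_le_Top NN_tab by (intro cone_satisfiable) (auto intro: fin_form_tab)
  then obtain r where r: "\<forall>a\<in>?T. ev a r \<ge> 0" "r \<phi> < r Top" by (auto simp: sat_def)
  have pos: "r Top > 0" using tab_bounds[OF r(1) subf_refl] r(2) by simp
  have "r \<phi> = r Top * std_eval (\<lambda>p. max 0 (min 1 (r (Atom p) / r Top))) \<phi>"
    by (rule tab_solution[OF r(1) pos]) simp
  also have "std_eval (\<lambda>p. max 0 (min 1 (r (Atom p) / r Top))) \<phi> = 1"
    by (rule assms) simp
  finally show False using r(2) by simp
qed

subsection \<open>Good sequences\<close>

text \<open>Since \<open>\<phi> + \<psi> = (\<phi> \<oplus> \<psi>) + (\<phi> \<odot> \<psi>)\<close> pointwise, insertion preserves the sum of the truth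
  functions. The result is sorted: the entry with index \<open>i\<close> is the sum minus \<open>i\<close>, truncated to
  the unit interval.\<close>

fun good_insert :: "'a fm \<Rightarrow> 'a fm list \<Rightarrow> 'a fm list" where
  "good_insert \<psi> [] = [\<psi>]"
| "good_insert \<psi> (\<phi> # cs) = Oplus \<phi> \<psi> # good_insert (Odot \<phi> \<psi>) cs"

definition good_seq :: "'a fm list \<Rightarrow> 'a fm list" where
  "good_seq ps = foldr good_insert ps []"

definition clamp01 :: "real \<Rightarrow> real" where
  "clamp01 t = max 0 (min 1 t)"

lemma length_good_insert [simp]: "length (good_insert \<psi> cs) = Suc (length cs)"
  by (induction \<psi> cs rule: good_insert.induct) auto

lemma length_good_seq [simp]: "length (good_seq ps) = length ps"
  by (induction ps) (auto simp: good_seq_def)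

lemma std_eval_Odot: "std_eval y (Odot \<phi> \<psi>) = max 0 (std_eval y \<phi> + std_eval y \<psi> - 1)"
  by (auto simp: Odot_def)

text \<open>The bounds on \<open>s\<close> say that \<open>cs\<close> accounts for the whole sum, so
  the new last place only receives what \<psi> contributes. In the base case they force
  \<open>s = 0\<close>.\<close>

lemma eval_good_insert:
  assumes "\<forall>i<length cs. std_eval y (cs ! i) = clamp01 (s - real i)"
    and "0 \<le> s" "s \<le> real (length cs)" "std_eval y \<psi> \<in> {0..1}" "i \<le> length cs"
  shows "std_eval y (good_insert \<psi> cs ! i) = clamp01 (s + std_eval y \<psi> - real i)"
  using assms
proof (induction \<psi> cs arbitrary: s i rule: good_insert.induct)
  case (1 \<psi>)
  then show ?case by (auto simp: clamp01_def)
next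
  case (2 \<psi> \<phi> cs)
  let ?v = "std_eval y \<psi>"
  have c: "std_eval y \<phi> = clamp01 s" using 2(2) by fastforce
  show ?case
  proof (cases i)
    case 0
    then show ?thesis using 2(3-5) c by (auto simp: clamp01_def)
  next
    case (Suc j)
    \<comment> \<open>Without its head, the sequence is good for the sum \<open>s - 1\<close> cut
      off at 0, and the head passes on its overflow.\<close>
    let ?s = "max 0 (s - 1)" and ?w = "std_eval y (Odot \<phi> \<psi>)"
    have w: "?w = max 0 (clamp01 s + ?v - 1)" by (simp add: std_eval_Odot c)
    have "std_eval y (good_insert (Odot \<phi> \<psi>) cs ! j) = clamp01 (?s + ?w - real j)"
    proof (rule "2.IH")
      show "\<forall>i<length cs. std_eval y (cs ! i) = clamp01 (?s - real i)"
      proof (intro allI impI)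
        fix i assume "i < length cs"
        then have "std_eval y (cs ! i) = clamp01 (s - real (Suc i))" using 2(2) by fastforce
        also have "\<dots> = clamp01 (?s - real i)" by (auto simp: clamp01_def)
        finally show "std_eval y (cs ! i) = clamp01 (?s - real i)" .
      qed
    qed (use 2(4-6) Suc in \<open>auto simp: w clamp01_def\<close>)
    \<comment> \<open>If the head is 1, the overflow is all of \<psi>. If \<open>s < 1\<close>, the
      tail is zero and the overflow is whatever exceeds 1.\<close>
    also have "?s + ?w - real j = (if s \<ge> 1 then s + ?v - real i else max 0 (s + ?v - 1) - real j)"
      using 2(3,5) Suc by (auto simp: w clamp01_def)
    also have "clamp01 \<dots> = clamp01 (s + ?v - real i)" using Suc by (auto simp: clamp01_def)
    finally show ?thesis using Suc by simp
  qed
qed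

lemma eval_good_seq:
  assumes "\<And>\<psi>. \<psi> \<in> set ps \<Longrightarrow> std_eval y \<psi> \<in> {0..1}" "i < length ps"
  shows "std_eval y (good_seq ps ! i) = clamp01 ((\<Sum>\<psi>\<leftarrow>ps. std_eval y \<psi>) - real i)"
  using assms
proof (induction ps arbitrary: i)
  case (Cons \<psi> ps)
  let ?s = "\<Sum>\<psi>\<leftarrow>ps. std_eval y \<psi>"
  have "0 \<le> ?s" using Cons.prems(1) by (intro sum_list_nonneg) auto
  moreover have "?s \<le> (\<Sum>\<psi>\<leftarrow>ps. 1)" using Cons.prems(1) by (intro sum_list_mono) auto
  moreover have "good_seq (\<psi> # ps) = good_insert \<psi> (good_seq ps)" by (simp add: good_seq_def)
  ultimately show ?case
    using Cons eval_good_insert[of "good_seq ps" y ?s \<psi> i] by (simp add: sum_list_triv add.commute)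
qed simp

lemma atoms_good_insert: "\<theta> \<in> set (good_insert \<psi> cs) \<Longrightarrow> atoms \<theta> \<subseteq> atoms \<psi> \<union> (\<Union>\<phi>\<in>set cs. atoms \<phi>)"
  by (induction \<psi> cs rule: good_insert.induct) (fastforce simp: Odot_def)+

lemma atoms_good_seq: "\<theta> \<in> set (good_seq ps) \<Longrightarrow> atoms \<theta> \<subseteq> (\<Union>\<psi>\<in>set ps. atoms \<psi>)"
proof (induction ps arbitrary: \<theta>)
  case (Cons \<psi> ps)
  then have "atoms \<theta> \<subseteq> atoms \<psi> \<union> (\<Union>\<phi>\<in>set (good_seq ps). atoms \<phi>)"
    by (intro atoms_good_insert) (simp add: good_seq_def)
  then show ?case using Cons.IH by fastforce
qed (simp add: good_seq_def)

subsection \<open>Forms as sums of literals\<close>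

text \<open>Induction on the sum of the absolute values of the coefficients, moving one nonzero
  coefficient a step towards 0.\<close>

lemma form_induct:
  assumes "finite X" "{v. f v \<noteq> 0} \<subseteq> X" "Q 0"
    and step: "\<And>f v. v \<in> X \<Longrightarrow> Q f \<Longrightarrow> Q (f + delta v) \<and> Q (f - delta v)"
  shows "Q f"
  using assms(2)
proof (induction "\<Sum>v\<in>X. nat \<bar>f v\<bar>" arbitrary: f rule: less_induct)
  case less
  have meas: "(\<Sum>v\<in>X. nat \<bar>g v\<bar>) < (\<Sum>v\<in>X. nat \<bar>f v\<bar>)"
    if "u \<in> X" "\<bar>g u\<bar> < \<bar>f u\<bar>" "\<And>v. v \<noteq> u \<Longrightarrow> g v = f v" for g u
    by (rule sum_strict_mono_ex1[OF assms(1)])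
      (metis that(2,3) less_imp_le nat_mono order_refl, use that(1,2) in force)
  show ?case
  proof (cases "f = 0")
    case False
    then obtain u where u: "f u \<noteq> 0" by (auto simp: fun_eq_iff)
    then have uX: "u \<in> X" using less.prems by auto
    show ?thesis
    proof (cases "f u > 0")
      case True
      have "Q (f - delta u)"
        by (rule less.hyps, rule meas[of u]) (use True uX less.prems u in \<open>auto simp: delta_def split: if_splits\<close>)
      then have "Q (f - delta u + delta u)" using step[OF uX] by blast
      then show ?thesis by simp
    next
      case False
      have "Q (f + delta u)"
        by (rule less.hyps, rule meas[of u]) (use False uX less.prems u in \<open>auto simp: delta_def split: if_splits\<close>)
      then have "Q (f + delta u - delta u)" using step[OF uX] by blast
      then show ?thesis by simp
    qed
  qed (use assms(3) in simp)
qed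

definition unit_form :: "int \<Rightarrow> 'a fm \<Rightarrow> int" where
  "unit_form k = (\<lambda>v. k * delta Top v)"

lemma unit_form_simps:
  "unit_form 0 = 0" "unit_form (k + 1) = unit_form k + delta Top"
  "unit_form (k - 1) = unit_form k - delta Top"
  by (auto simp: unit_form_def fun_eq_iff algebra_simps)

lemma unit_form_Suc: "unit_form (int (Suc m)) = unit_form (int m) + delta Top"
  by (auto simp: unit_form_def fun_eq_iff algebra_simps)

text \<open>Good sequences handle sums, not signed combinations. A summand \<open>+ v\<close> is
  therefore traded for \<open>Top - Neg v\<close>, while \<open>- v\<close> stays, which leaves an
  integer minus a list of literals. The real and the cone version are stated for the same list, so
  that bounds computed on assignments can be used in the cone.\<close>

lemma literal_form:
  fixes f :: "'a fm \<Rightarrow> int"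
  assumes "finite E" "{v. f v \<noteq> 0} \<subseteq> insert Top (Atom ` E)"
  shows "\<exists>ps k. set ps \<subseteq> Atom ` E \<union> (Neg \<circ> Atom) ` E \<and>
    (\<forall>y. ev f (std_eval y) = of_int k - (\<Sum>\<psi>\<leftarrow>ps. std_eval y \<psi>)) \<and>
    (\<forall>NN. mv_cone NN \<longrightarrow> NN (f - (unit_form k - (\<Sum>\<psi>\<leftarrow>ps. delta \<psi>))))"
    (is "?P f")
proof -
  let ?ok = "\<lambda>ps (k::int) f. set ps \<subseteq> Atom ` E \<union> (Neg \<circ> Atom) ` E \<and>
    (\<forall>y. ev f (std_eval y) = of_int k - (\<Sum>\<psi>\<leftarrow>ps. std_eval y \<psi>)) \<and>
    (\<forall>NN. mv_cone NN \<longrightarrow> NN (f - (unit_form k - (\<Sum>\<psi>\<leftarrow>ps. delta \<psi>))))"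
  have "fin_form f \<and> ?P f"
  proof (rule form_induct[OF _ assms(2)])
    show "finite (insert Top (Atom ` E))" using assms(1) by simp
    have "?ok [] 0 0" by (auto simp: unit_form_simps intro: mv_cone.NN_zero)
    then show "fin_form 0 \<and> ?P 0" by blast
  next
    fix f :: "'a fm \<Rightarrow> int" and v assume v: "v \<in> insert Top (Atom ` E)" and IH: "fin_form f \<and> ?P f"
    then have ff: "fin_form f" by simp
    from IH obtain ps k where ok: "?ok ps k f" by blast
    from v consider "v = Top" | p where "p \<in> E" "v = Atom p" by blast
    then have "?P (f + delta v) \<and> ?P (f - delta v)"
    proof cases
      case 1
      have "?ok ps (k + 1) (f + delta v)" "?ok ps (k - 1) (f - delta v)"
        using ok ff unfolding 1 unit_form_simps by (auto simp: algebra_simps)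
      then show ?thesis by blast
    next
      case 2
      have "?ok (Neg v # ps) (k + 1) (f + delta v)"
      proof (intro conjI allI impI)
        fix NN :: "('a fm \<Rightarrow> int) \<Rightarrow> bool" assume "mv_cone NN"
        then interpret mv_cone NN .
        have "NN ((f - (unit_form k - (\<Sum>\<psi>\<leftarrow>ps. delta \<psi>))) + (delta v + delta (Neg v) - delta Top))"
          using ok \<open>mv_cone NN\<close> by (intro NN_add NN_Neg1) blast
        then show "NN (f + delta v - (unit_form (k + 1) - (\<Sum>\<psi>\<leftarrow>Neg v # ps. delta \<psi>)))"
          unfolding unit_form_simps by (simp add: algebra_simps)
      qed (use ok ff 2 in auto)
      moreover have "?ok (v # ps) k (f - delta v)"
        using ok ff 2 by (auto simp: algebra_simps)
      ultimately show ?thesis by blast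
    qed
    then show "(fin_form (f + delta v) \<and> ?P (f + delta v)) \<and> (fin_form (f - delta v) \<and> ?P (f - delta v))"
      using ff by blast
  qed
  then show ?thesis by blast
qed

subsection \<open>States with values in ordered groups\<close>

text \<open>The value under the state concentrated at the single assignment
  \<open>y\<close>.\<close>

definition modal_eval :: "(nat \<Rightarrow> real) \<Rightarrow> modal \<Rightarrow> real" where
  "modal_eval y = std_eval (\<lambda>p. std_eval y (event_of p))"

lemma modal_eval_Pr [simp]: "modal_eval y (Pr \<phi>) = std_eval y \<phi>"
  and modal_eval_Top [simp]: "modal_eval y Top = 1"
  by (simp_all add: modal_eval_def)

lemma fp_derives_luk_closed: "{\<Theta>. \<Gamma> \<turnstile>\<^sub>F\<^sub>P \<Theta>} \<turnstile>\<^sub>L \<Phi> \<Longrightarrow> \<Gamma> \<turnstile>\<^sub>F\<^sub>P \<Phi>"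
  by (induction rule: luk_derives.induct) (auto intro: fp_derives.luk fp_derives.mp)

lemma fp_Iff_elim:
  assumes "\<Gamma> \<turnstile>\<^sub>F\<^sub>P Iff \<Phi> \<Psi>"
  shows "\<Gamma> \<turnstile>\<^sub>F\<^sub>P Imp \<Phi> \<Psi>" "\<Gamma> \<turnstile>\<^sub>F\<^sub>P Imp \<Psi> \<Phi>"
proof -
  have "{\<Theta>. \<Gamma> \<turnstile>\<^sub>F\<^sub>P \<Theta>} \<turnstile>\<^sub>L Iff \<Phi> \<Psi>" using assms by (intro luk_derives.premise) simp
  then show "\<Gamma> \<turnstile>\<^sub>F\<^sub>P Imp \<Phi> \<Psi>" "\<Gamma> \<turnstile>\<^sub>F\<^sub>P Imp \<Psi> \<Phi>"
    by (blast intro: fp_derives_luk_closed dest: Iff_elim)+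
qed

locale fp_cone = mv_cone NN for NN :: "(modal \<Rightarrow> int) \<Rightarrow> bool" +
  fixes \<Gamma> :: "modal set"
  assumes NN_fp: "\<Gamma> \<turnstile>\<^sub>F\<^sub>P \<Phi> \<Longrightarrow> NN (delta \<Phi> - delta Top)"
begin

lemma NN_fp_Imp: "\<Gamma> \<turnstile>\<^sub>F\<^sub>P Imp \<Phi> \<Psi> \<Longrightarrow> NN (delta \<Psi> - delta \<Phi>)"
  by (rule NN_ImpD[OF NN_fp])

lemma NN_Pr_mono:
  assumes "luk_provable (Imp \<phi> \<psi>)" shows "NN (delta (Pr \<psi>) - delta (Pr \<phi>))"
proof -
  have 1: "NN (delta (Imp (Pr \<phi>) (Pr \<psi>)) - delta (Pr (Imp \<phi> \<psi>)))"
    by (rule NN_fp_Imp[OF fp_derives.P2])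
  have 2: "NN (delta (Pr (Imp \<phi> \<psi>)) - delta Top)"
    by (rule NN_fp[OF fp_derives.N[OF assms]])
  show ?thesis by (rule NN_ImpD[OF NN_trans[OF 2 1]])
qed

lemma NN_Pr_Neg: "NN (delta (Pr (Neg \<phi>)) - delta (Neg (Pr \<phi>)))"
    "NN (delta (Neg (Pr \<phi>)) - delta (Pr (Neg \<phi>)))"
  by (rule NN_fp_Imp[OF fp_Iff_elim(1)[OF fp_derives.P1]])
    (rule NN_fp_Imp[OF fp_Iff_elim(2)[OF fp_derives.P1]])

text \<open>The point is that the outer implication in \<open>P3\<close> is not truncated:
  residuation and \<open>P2\<close> show that its antecedent dominates \<open>Pr \<psi>\<close>. Its
  value is then affine, and \<open>P3\<close> becomes the inequality by which inserting into a good
  sequence does not lower the sum of probabilities.\<close>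

lemma NN_Pr_plus: "NN (delta (Pr (Oplus \<phi> \<psi>)) + delta (Pr (Odot \<phi> \<psi>)) - delta (Pr \<phi>) - delta (Pr \<psi>))"
proof -
  let ?p = "delta (Pr \<phi>)" and ?q = "delta (Pr (Odot \<phi> \<psi>))" and ?r = "delta (Pr \<psi>)"
  let ?i = "delta (Imp (Pr \<phi>) (Pr (Odot \<phi> \<psi>)))"
  have qp: "NN (?p - ?q)"
    by (rule NN_Pr_mono) (simp add: luk_provable_iff_derives Odot_lower)
  have "NN (delta (Imp (Pr \<psi>) (Pr (Odot \<phi> \<psi>))) - ?p)"
    by (rule NN_trans[OF NN_Pr_mono NN_fp_Imp[OF fp_derives.P2]])
      (simp add: luk_provable_iff_derives Odot_intro)
  then have "NN ((delta Top - ?r + ?q - delta (Imp (Pr \<psi>) (Pr (Odot \<phi> \<psi>)))) +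
      (delta (Imp (Pr \<psi>) (Pr (Odot \<phi> \<psi>))) - ?p) + (?i - (delta Top - ?p + ?q)))"
    by (intro NN_add NN_Imp_upper NN_Imp_lower qp)
  then have "NN (?i - ?r)" by (simp add: algebra_simps)
  then have 1: "NN (delta (Imp (Imp (Pr \<phi>) (Pr (Odot \<phi> \<psi>))) (Pr \<psi>)) - (delta Top - ?i + ?r))"
    by (rule NN_Imp_lower)
  have 2: "NN (delta Top - ?p + ?q - ?i)" by (rule NN_Imp_upper)
  have 3: "NN (delta (Pr (Oplus \<phi> \<psi>)) - delta (Imp (Imp (Pr \<phi>) (Pr (Odot \<phi> \<psi>))) (Pr \<psi>)))"
    by (rule NN_fp_Imp[OF fp_Iff_elim(2)[OF fp_derives.P3]])
  show ?thesis using NN_add[OF NN_add[OF 1 2] 3] by (simp add: algebra_simps)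
qed

lemma NN_Pr_good_insert:
  "NN ((\<Sum>\<theta>\<leftarrow>good_insert \<psi> cs. delta (Pr \<theta>)) - delta (Pr \<psi>) - (\<Sum>\<theta>\<leftarrow>cs. delta (Pr \<theta>)))"
proof (induction \<psi> cs rule: good_insert.induct)
  case (1 \<psi>)
  show ?case using NN_zero by (simp del: minus_apply plus_fun_apply zero_fun_apply)
next
  case (2 \<psi> \<phi> cs)
  from NN_add[OF this NN_Pr_plus[of \<phi> \<psi>]] show ?case
    by (simp add: algebra_simps del: minus_apply plus_fun_apply zero_fun_apply)
qed

lemma NN_Pr_good_seq:
  "NN ((\<Sum>\<theta>\<leftarrow>good_seq ps. delta (Pr \<theta>)) - (\<Sum>\<psi>\<leftarrow>ps. delta (Pr \<psi>)))"
proof (induction ps)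
  case Nil
  show ?case using NN_zero by (simp add: good_seq_def del: minus_apply plus_fun_apply zero_fun_apply)
next
  case (Cons \<psi> ps)
  have "good_seq (\<psi> # ps) = good_insert \<psi> (good_seq ps)" by (simp add: good_seq_def)
  then show ?case using NN_add[OF Cons NN_Pr_good_insert[of \<psi> "good_seq ps"]]
    by (simp add: algebra_simps del: minus_apply plus_fun_apply zero_fun_apply)
qed

text \<open>Each of the first \<open>m\<close> entries costs at most one unit; the others have
  probability zero by \<open>N\<close> and \<open>P1\<close>.\<close>

lemma NN_Pr_list_bound:
  assumes "\<And>i. i < length cs \<Longrightarrow> m \<le> i \<Longrightarrow> luk_provable (Neg (cs ! i))"
  shows "NN (unit_form (int m) - (\<Sum>\<theta>\<leftarrow>cs. delta (Pr \<theta>)))"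
  using assms
proof (induction cs arbitrary: m)
  case Nil
  have "NN (unit_form (int m))"
  proof (induction m)
    case (Suc m)
    from NN_add[OF this NN_delta[of Top]] show ?case by (simp only: unit_form_Suc)
  qed (simp add: unit_form_simps NN_zero del: zero_fun_apply)
  then show ?case by (simp only: list.map sum_list_simps diff_0_right)
next
  case (Cons \<theta> cs)
  show ?case
  proof (cases m)
    case 0
    have "NN (delta (Pr (Neg \<theta>)) - delta Top)"
      using Cons.prems[of 0] 0 by (intro NN_fp fp_derives.N) simp
    from NN_add[OF NN_add[OF this NN_Pr_Neg(2)[of \<theta>]] NN_Neg2[of "Pr \<theta>"]]
    have *: "NN (- delta (Pr \<theta>))" by simp
    have "NN (unit_form (int 0) - (\<Sum>\<theta>\<leftarrow>cs. delta (Pr \<theta>)))"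
      using Cons.prems[of "Suc i" for i] 0 by (intro Cons.IH) fastforce
    from NN_add[OF this *] show ?thesis using 0 by (simp add: algebra_simps del: minus_apply plus_fun_apply zero_fun_apply)
  next
    case (Suc n)
    have "NN (unit_form (int n) - (\<Sum>\<theta>\<leftarrow>cs. delta (Pr \<theta>)))"
      using Cons.prems[of "Suc i" for i] Suc by (intro Cons.IH) fastforce
    from NN_add[OF this NN_le_Top[of "Pr \<theta>"]] show ?thesis unfolding Suc unit_form_Suc
      by (simp add: algebra_simps del: minus_apply plus_fun_apply zero_fun_apply)
  qed
qed

text \<open>The bounds chain up. In the cone, \<open>f\<close> is at least \<open>k\<close> minus
  the literals, these are at most the probabilities of the corresponding events, those are at most
  the sum over the good sequence, and that sum is at most \<open>k\<close>.\<close>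

theorem NN_if_valid:
  assumes "finite E" "{v. f v \<noteq> 0} \<subseteq> insert Top (Pr ` E)"
    and valid: "\<And>y. (\<And>p. y p \<in> {0..1}) \<Longrightarrow> ev f (modal_eval y) \<ge> 0"
  shows "NN f"
proof -
  have "{v. f v \<noteq> 0} \<subseteq> insert Top (Atom ` P ` E)" using assms(2) by (auto simp: image_image)
  from literal_form[OF finite_imageI[OF assms(1)] this] obtain ps k where
    ps: "set ps \<subseteq> Atom ` P ` E \<union> (Neg \<circ> Atom) ` P ` E"
    and evf: "\<And>y. ev f (std_eval y) = of_int k - (\<Sum>\<psi>\<leftarrow>ps. std_eval y \<psi>)"
    and NNf: "NN (f - (unit_form k - (\<Sum>\<psi>\<leftarrow>ps. delta \<psi>)))"
    using mv_cone_axioms by blast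
  \<comment> \<open>\<open>P1\<close> turns a negated probability into the probability of a
    negation. The default \<open>Bot\<close> does not occur on \<open>ps\<close>.\<close>
  define lit :: "modal \<Rightarrow> event" where
    "lit = (\<lambda>\<psi>. case \<psi> of Atom p \<Rightarrow> event_of p | Neg (Atom p) \<Rightarrow> Neg (event_of p) | _ \<Rightarrow> Bot)"
  have lit: "(\<forall>y. modal_eval y \<psi> = std_eval y (lit \<psi>)) \<and> NN (delta (Pr (lit \<psi>)) - delta \<psi>)"
    if "\<psi> \<in> set ps" for \<psi>
  proof -
    have "\<psi> \<in> Atom ` P ` E \<union> (Neg \<circ> Atom) ` P ` E" using that ps by blast
    then have "\<exists>\<phi>. \<psi> = Pr \<phi> \<or> \<psi> = Neg (Pr \<phi>)" by (simp add: image_iff) blast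
    then obtain \<phi> where "\<psi> = Pr \<phi> \<or> \<psi> = Neg (Pr \<phi>)" by blast
    then show ?thesis
    proof
      assume "\<psi> = Pr \<phi>"
      then show ?thesis using NN_zero by (simp add: lit_def)
    next
      assume "\<psi> = Neg (Pr \<phi>)"
      then show ?thesis using NN_Pr_Neg(1)[of \<phi>] by (simp add: lit_def modal_eval_def)
    qed
  qed
  have "NN ((\<Sum>\<psi>\<leftarrow>qs. delta (Pr (lit \<psi>))) - (\<Sum>\<psi>\<leftarrow>qs. delta \<psi>))" if "set qs \<subseteq> set ps" for qs
    using that
  proof (induction qs)
    case (Cons q qs)
    then have "NN ((\<Sum>\<psi>\<leftarrow>qs. delta (Pr (lit \<psi>))) - (\<Sum>\<psi>\<leftarrow>qs. delta \<psi>) + (delta (Pr (lit q)) - delta q))"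
      using lit[of q] by (intro NN_add) (auto simp del: minus_apply plus_fun_apply zero_fun_apply)
    then show ?case by (simp add: algebra_simps del: minus_apply plus_fun_apply zero_fun_apply)
  qed (simp add: NN_zero del: minus_apply plus_fun_apply zero_fun_apply)
  from this[OF order_refl]
  have 1: "NN ((\<Sum>\<psi>\<leftarrow>map lit ps. delta (Pr \<psi>)) - (\<Sum>\<psi>\<leftarrow>ps. delta \<psi>))" by (simp add: o_def)
  have sum: "(\<Sum>\<psi>\<leftarrow>map lit ps. std_eval y \<psi>) \<le> of_int k" if "\<And>p. y p \<in> {0..1}" for y
  proof -
    have "(\<Sum>\<psi>\<leftarrow>map lit ps. std_eval y \<psi>) = (\<Sum>\<psi>\<leftarrow>ps. modal_eval y \<psi>)"
      using lit by (auto intro!: arg_cong[of _ _ sum_list] simp: o_def)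
    also have "\<dots> = of_int k - ev f (modal_eval y)" by (simp add: modal_eval_def evf)
    finally show ?thesis using valid[OF that] by simp
  qed
  \<comment> \<open>One assignment suffices to see that \<open>k\<close> is nonnegative, so that it
    can serve as an index.\<close>
  have "0 \<le> (\<Sum>\<psi>\<leftarrow>map lit ps. std_eval (\<lambda>_. 0) \<psi>)"
    using std_eval_bounds[of _ "\<lambda>_. 0"] by (intro sum_list_nonneg) fastforce
  with sum[of "\<lambda>_. 0"] have k: "k \<ge> 0" by simp
  have "NN (unit_form (int (nat k)) - (\<Sum>\<theta>\<leftarrow>good_seq (map lit ps). delta (Pr \<theta>)))"
  proof (rule NN_Pr_list_bound, rule luk_completeness)
    fix i and y :: "nat \<Rightarrow> real" assume i: "i < length (good_seq (map lit ps))" "nat k \<le> i" and y: "\<And>p. y p \<in> {0..1}"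
    have "std_eval y (good_seq (map lit ps) ! i) = clamp01 ((\<Sum>\<psi>\<leftarrow>map lit ps. std_eval y \<psi>) - real i)"
      using i(1) std_eval_bounds[OF y] by (intro eval_good_seq) simp_all
    also have "\<dots> = 0" using sum[of y, OF y] i(2) k by (auto simp: clamp01_def)
    finally show "std_eval y (Neg (good_seq (map lit ps) ! i)) = 1" by simp
  qed
  from NN_add[OF NN_add[OF NN_add[OF NNf this] NN_Pr_good_seq[of "map lit ps"]] 1]
  show ?thesis using k by (simp add: algebra_simps)
qed

end

subsection \<open>A finite system of inequalities for the coherent set\<close>

text \<open>Renaming of the variables of a form along an injection.\<close>

definition push :: "('u \<Rightarrow> 'v) \<Rightarrow> ('u \<Rightarrow> int) \<Rightarrow> 'v \<Rightarrow> int" where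
  "push h a = (\<lambda>v. if v \<in> range h then a (inv_into UNIV h v) else 0)"

lemma sum_fun_apply: "(\<Sum>i\<in>I. f i) x = (\<Sum>i\<in>I. f i x)" for f :: "_ \<Rightarrow> _ \<Rightarrow> _ :: comm_monoid_add"
  by (induction I rule: infinite_finite_induct) auto

lemma push_support: "inj h \<Longrightarrow> {v. push h a v \<noteq> 0} = h ` {u. a u \<noteq> 0}"
  by (auto simp: push_def dest: injD)

lemma push_fin_form [intro]: "inj h \<Longrightarrow> fin_form a \<Longrightarrow> fin_form (push h a)"
  by (simp add: fin_form_def push_support)

lemma ev_push:
  assumes "inj h" shows "ev (push h a) r = ev a (r \<circ> h)"
proof -
  have "ev (push h a) r = (\<Sum>v\<in>h ` {u. a u \<noteq> 0}. of_int (push h a v) * r v)"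
    unfolding ev_def push_support[OF assms] ..
  also have "\<dots> = ev a (r \<circ> h)"
    by (subst sum.reindex) (auto intro: inj_on_subset[OF assms] simp: push_def ev_def assms)
  finally show ?thesis .
qed

lemma fin_form_sum: "finite I \<Longrightarrow> (\<And>i. i \<in> I \<Longrightarrow> fin_form (a i)) \<Longrightarrow> fin_form (\<Sum>i\<in>I. a i)"
  by (induction rule: finite_induct) auto

lemma ev_sum_forms:
  "finite I \<Longrightarrow> (\<And>i. i \<in> I \<Longrightarrow> fin_form (a i)) \<Longrightarrow> ev (\<Sum>i\<in>I. a i) r = (\<Sum>i\<in>I. ev (a i) r)"
  by (induction rule: finite_induct) (auto simp: fin_form_sum)

lemma der_weak: "c \<in> der S \<Longrightarrow> (\<And>c. c \<in> S \<Longrightarrow> \<not> fst c) \<Longrightarrow> \<not> fst c"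
  by (induction rule: der.induct) auto

lemma der_sat:
  assumes "c \<in> der S" "\<And>c. c \<in> S \<Longrightarrow> fin_form (snd c) \<and> sat r c"
  shows "fin_form (snd c) \<and> sat r c"
  using assms(1)
proof (induction rule: der.induct)
  case (add p a q b)
  then show ?case by (auto simp: sat_def simp del: plus_fun_apply split: if_splits)
qed (rule assms(2))

definition truth_point :: "event set \<Rightarrow> (nat \<Rightarrow> real) \<Rightarrow> event \<Rightarrow> real" where
  "truth_point E y = (\<lambda>\<phi>\<in>E. truth_fun \<phi> y)"

definition truth_hull :: "event set \<Rightarrow> (event \<Rightarrow> real) set" where
  "truth_hull E = convex hull (truth_point E ` cube (\<Union>\<phi>\<in>E. atoms \<phi>))"

lemma coherent_set_eq_closure: "coherent_set E = closure (truth_hull E)"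
  by (simp add: coherent_set_def truth_hull_def truth_point_def)

lemma truth_point_in_hull:
  assumes "\<And>p. y p \<in> {0..1}" shows "truth_point E y \<in> truth_hull E"
proof -
  let ?A = "\<Union>\<phi>\<in>E. atoms \<phi>"
  have "restrict y ?A \<in> cube ?A" using assms by (auto simp: cube_def)
  moreover have "truth_point E y = truth_point E (restrict y ?A)"
    unfolding truth_point_def truth_fun_def by (intro restrict_ext mv_eval_cong) auto
  ultimately show ?thesis unfolding truth_hull_def by (auto intro: hull_inc)
qed

text \<open>A point of the hull is a convex combination of points from the cells on which all truth
  functions are affine. The variable \<open>Inr (\<sigma>, \<theta>)\<close> stands for the value of \<open>\<theta>\<close> at the point of
  the cell \<open>\<sigma>\<close>, scaled by its coefficient, which is the value of \<open>Inr (\<sigma>, Top)\<close>. Elimination of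
  these variables leaves finitely many inequalities.\<close>

theorem truth_hull_inequalities:
  assumes "finite E"
  shows "\<exists>H. finite H \<and> (\<forall>f\<in>H. {v. f v \<noteq> 0} \<subseteq> insert Top (Pr ` E)) \<and>
    (\<forall>f\<in>H. \<forall>y. (\<forall>p. y p \<in> {0..1}) \<longrightarrow> ev f (modal_eval y) \<ge> 0) \<and>
    (\<forall>x. x Top = 1 \<longrightarrow> (\<forall>f\<in>H. ev f x \<ge> 0) \<longrightarrow> (\<lambda>\<phi>\<in>E. x (Pr \<phi>)) \<in> truth_hull E)"
proof -
  define W where "W = (\<Union>\<phi>\<in>E. subf \<phi>)"
  have W: "finite W" "E \<subseteq> W" using assms subf_refl by (auto simp: W_def)
  have W_closed: "subf \<theta> \<subseteq> W" if "\<theta> \<in> W" for \<theta>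
    using that subf_trans[of \<theta>] by (fastforce simp: W_def)
  define l :: "modal \<Rightarrow> modal + event set \<times> event" where "l = Inl"
  define h :: "event set \<Rightarrow> event \<Rightarrow> modal + event set \<times> event" where "h = (\<lambda>\<sigma> \<theta>. Inr (\<sigma>, \<theta>))"
  have inj: "inj l" "\<And>\<sigma>. inj (h \<sigma>)" by (auto simp: l_def h_def inj_def)
  \<comment> \<open>Set to zero, \<open>lk m \<theta>\<close> says that the value of
    \<open>m\<close> is the sum over all cells of the scaled values of \<theta>. For
    \<open>Top\<close> it says that the weights add up to the unit. Equations enter \<open>F\<close>
    as a form and its negative.\<close>
  define lk where "lk = (\<lambda>m \<theta>. push l (delta m) - (\<Sum>\<sigma>\<in>Pow W. push (h \<sigma>) (delta \<theta>)))"
  define L where "L = insert (lk Top Top) ((\<lambda>\<phi>. lk (Pr \<phi>) \<phi>) ` E)"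
  define F where "F = (\<Union>\<sigma>\<in>Pow W. push (h \<sigma>) ` insert (delta Top) (tab \<sigma> W)) \<union> L \<union> uminus ` L"
  define S where "S = Pair False ` F"
  let ?X = "l ` insert Top (Pr ` E)" and ?Y = "Inr ` (Pow W \<times> insert Top W)"
  have fW: "finite (Pow W)" using W by simp
  have lk_fin: "fin_form (lk m \<theta>)" for m \<theta>
    unfolding lk_def by (intro fin_form_diff fin_form_sum push_fin_form inj fW fin_form_delta)
  have ev_lk: "ev (lk m \<theta>) r = r (l m) - (\<Sum>\<sigma>\<in>Pow W. r (h \<sigma> \<theta>))" for m \<theta> r
    unfolding lk_def
    by (simp add: ev_sum_forms fin_form_sum push_fin_form inj W(1) ev_push)
  have lk_supp: "{v. lk m \<theta> v \<noteq> 0} \<subseteq> insert (l m) ((\<lambda>\<sigma>. h \<sigma> \<theta>) ` Pow W)" for m \<theta>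
  proof
    fix v assume "v \<in> {v. lk m \<theta> v \<noteq> 0}"
    then have "push l (delta m) v \<noteq> 0 \<or> (\<Sum>\<sigma>\<in>Pow W. push (h \<sigma>) (delta \<theta>)) v \<noteq> 0"
      by (auto simp: lk_def)
    then show "v \<in> insert (l m) ((\<lambda>\<sigma>. h \<sigma> \<theta>) ` Pow W)"
    proof
      assume "push l (delta m) v \<noteq> 0"
      then have "v \<in> {v. push l (delta m) v \<noteq> 0}" by simp
      then show ?thesis unfolding push_support[OF inj(1)] by (auto simp: delta_def split: if_splits)
    next
      assume "(\<Sum>\<sigma>\<in>Pow W. push (h \<sigma>) (delta \<theta>)) v \<noteq> 0"
      then have "(\<Sum>\<sigma>\<in>Pow W. push (h \<sigma>) (delta \<theta>) v) \<noteq> 0" by (simp add: sum_fun_apply)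
      then obtain \<sigma> where "\<sigma> \<in> Pow W" "push (h \<sigma>) (delta \<theta>) v \<noteq> 0" by (meson sum.neutral)
      then have "v \<in> {v. push (h \<sigma>) (delta \<theta>) v \<noteq> 0}" by simp
      with \<open>\<sigma> \<in> Pow W\<close> show ?thesis
        unfolding push_support[OF inj(2)] by (auto simp: delta_def split: if_splits)
    qed
  qed
  have Sfin: "finite S" using assms W(1) by (simp add: S_def F_def L_def)
  have Sff: "fin_form a" if "a \<in> F" for a
    using that lk_fin unfolding F_def L_def by (auto intro!: push_fin_form inj dest: fin_form_tab)
  have Ssupp: "{v. a v \<noteq> 0} \<subseteq> ?X \<union> ?Y" if "a \<in> F" for a
  proof -
    have Y: "{v. push (h \<sigma>) b v \<noteq> 0} \<subseteq> ?Y" if "\<sigma> \<in> Pow W" "b \<in> insert (delta Top) (tab \<sigma> W)" for \<sigma> b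
    proof -
      have "{u. b u \<noteq> 0} \<subseteq> insert Top W"
        using that(2) tab_support[of W b \<sigma>] W_closed by (auto simp: delta_def split: if_splits)
      then show ?thesis using that(1) unfolding push_support[OF inj(2)] by (auto simp: h_def)
    qed
    have 2: "{v. b v \<noteq> 0} \<subseteq> ?X \<union> ?Y" if b: "b \<in> L" for b
    proof -
      obtain m \<theta> where "b = lk m \<theta>" "m \<in> insert Top (Pr ` E)" "\<theta> \<in> insert Top W"
        using b W(2) by (auto simp: L_def)
      then show ?thesis using lk_supp[of m \<theta>] by (auto simp: h_def)
    qed
    from that consider \<sigma> b where "\<sigma> \<in> Pow W" "b \<in> insert (delta Top) (tab \<sigma> W)" "a = push (h \<sigma>) b"
      | "a \<in> L" | b where "b \<in> L" "a = - b" unfolding F_def by blast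
    then show ?thesis
    proof cases
      case 1
      then show ?thesis using Y[of \<sigma> b] by blast
    next
      case 3
      then show ?thesis using 2[of b] by simp
    qed (rule 2)
  qed
  have "\<exists>S'. finite S' \<and> S' \<subseteq> der S \<and> (\<forall>c\<in>S'. {v. snd c v \<noteq> 0} \<subseteq> ?X) \<and>
    (\<forall>r. (\<forall>c\<in>S'. sat r c) \<longrightarrow> (\<exists>r'. (\<forall>v\<in>?X. r' v = r v) \<and> (\<forall>c\<in>S. sat r' c)))"
  proof (rule fourier_motzkin)
    show "{v. snd c v \<noteq> 0} \<subseteq> ?X \<union> ?Y" if "c \<in> S" for c
      using that Ssupp[of "snd c"] by (auto simp: S_def)
  qed (use assms W(1) Sfin in \<open>auto simp: l_def\<close>)
  then obtain S' where S': "finite S'" "S' \<subseteq> der S" "\<forall>c\<in>S'. {v. snd c v \<noteq> 0} \<subseteq> ?X"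
    "\<forall>r. (\<forall>c\<in>S'. sat r c) \<longrightarrow> (\<exists>r'. (\<forall>v\<in>?X. r' v = r v) \<and> (\<forall>c\<in>S. sat r' c))"
    by (elim exE conjE) (rule that)
  have weak: "\<not> fst c" if "c \<in> S'" for c
    using S'(2) that by (intro der_weak[of c S]) (auto simp: S_def)
  define H where "H = (\<lambda>c. snd c \<circ> l) ` S'"
  have push_back: "push l (snd c \<circ> l) = snd c" if "c \<in> S'" for c
    using S'(3) that by (force simp: push_def fun_eq_iff f_inv_into_f)
  have evH: "ev (snd c \<circ> l) (r \<circ> l) = ev (snd c) r" if "c \<in> S'" for c r
    using ev_push[OF inj(1), of "snd c \<circ> l" r] push_back[OF that] by simp
  have "ev f (modal_eval y) \<ge> 0" if f: "f \<in> H" and y: "\<And>p. y p \<in> {0..1}" for f y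
  proof -
    obtain c where c: "c \<in> S'" "f = snd c \<circ> l" using f by (auto simp: H_def)
    let ?\<tau> = "{\<theta>. \<exists>\<phi> \<psi>. \<theta> = Oplus \<phi> \<psi> \<and> std_eval y \<phi> + std_eval y \<psi> \<ge> 1}"
    \<comment> \<open>The cell that contains \<open>y\<close> receives all the weight. Intersecting
      with \<open>W\<close> makes it one of the cells considered, and \<open>tabc\<close> consults a
      branch only at the formula at hand.\<close>
    define \<tau> where "\<tau> = ?\<tau> \<inter> W"
    define r where "r = (\<lambda>v. case v of Inl m \<Rightarrow> modal_eval y m
      | Inr (\<sigma>, \<theta>) \<Rightarrow> if \<sigma> = \<tau> then std_eval y \<theta> else 0)"
    have rl: "r \<circ> l = modal_eval y" and rh: "r \<circ> h \<sigma> = (if \<sigma> = \<tau> then std_eval y else (\<lambda>_. 0))" for \<sigma>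
      by (auto simp: r_def l_def h_def fun_eq_iff)
    have "tabc \<tau> \<theta> = tabc ?\<tau> \<theta>" if "\<theta> \<in> W" for \<theta>
      using that by (cases \<theta>) (auto simp: \<tau>_def)
    then have tab\<tau>: "tab \<tau> W = tab ?\<tau> W" by (auto simp: tab_def)
    have sum\<tau>: "(\<Sum>\<sigma>\<in>Pow W. r (h \<sigma> \<theta>)) = std_eval y \<theta>" for \<theta>
    proof -
      have "(\<Sum>\<sigma>\<in>Pow W. r (h \<sigma> \<theta>)) = (\<Sum>\<sigma>\<in>Pow W. if \<sigma> = \<tau> then std_eval y \<theta> else 0)"
        by (intro sum.cong) (auto simp: r_def h_def)
      also have "\<dots> = std_eval y \<theta>" using fW by (simp add: \<tau>_def)
      finally show ?thesis .
    qed
    have "ev a r \<ge> 0" if "a \<in> F" for a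
    proof -
      have "ev (push (h \<sigma>) b) r \<ge> 0" if "b \<in> insert (delta Top) (tab \<sigma> W)" for \<sigma> b
      proof (cases "\<sigma> = \<tau>")
        case True
        then show ?thesis using that tab_eval[where y = y and a = b and W = W, OF y]
          by (auto simp: ev_push inj rh tab\<tau>)
      next
        case False
        then show ?thesis by (simp add: ev_push inj rh) (simp add: ev_def)
      qed
      moreover have "ev a r = 0" if "a \<in> L" for a
        using that by (auto simp: L_def ev_lk sum\<tau> fun_cong[OF rl, unfolded o_def])
      ultimately show ?thesis using that unfolding F_def by (elim UnE UN_E imageE) auto
    qed
    then have "fin_form (snd d) \<and> sat r d" if "d \<in> S" for d
      using that Sff by (auto simp: S_def sat_def)
    with S'(2) c(1) have "sat r c" using der_sat[of c S r] by blast
    then show ?thesis using evH[OF c(1), of r] weak[OF c(1)] by (simp add: rl c(2) sat_def)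
  qed
  moreover have "(\<lambda>\<phi>\<in>E. x (Pr \<phi>)) \<in> truth_hull E" if x: "x Top = 1" "\<forall>f\<in>H. ev f x \<ge> 0" for x
  proof -
    define r0 :: "modal + event set \<times> event \<Rightarrow> real" where "r0 = (\<lambda>v. case v of Inl m \<Rightarrow> x m | Inr _ \<Rightarrow> 0)"
    have r0l: "r0 \<circ> l = x" by (auto simp: r0_def l_def)
    have "sat r0 c" if "c \<in> S'" for c
    proof -
      have "ev (snd c \<circ> l) x \<ge> 0" using x(2) that by (auto simp: H_def)
      then show ?thesis using evH[OF that, of r0] weak[OF that] by (simp add: sat_def r0l)
    qed
    with S'(4) obtain r where r: "\<forall>v\<in>?X. r v = r0 v" "\<forall>c\<in>S. sat r c" by blast
    have F: "ev a r \<ge> 0" if "a \<in> F" for a using r(2) that by (auto simp: S_def sat_def)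
    define \<mu> where "\<mu> = (\<lambda>\<sigma>. r (h \<sigma> Top))"
    define y where "y = (\<lambda>\<sigma> p. max 0 (min 1 (r (h \<sigma> (Atom p)) / \<mu> \<sigma>)))"
    have link: "r (l m) = (\<Sum>\<sigma>\<in>Pow W. r (h \<sigma> \<theta>))" if "lk m \<theta> \<in> L" for m \<theta>
      using F[of "lk m \<theta>"] F[of "- lk m \<theta>"] that by (auto simp: F_def ev_lk)
    have cell: "\<forall>a\<in>tab \<sigma> W. ev a (r \<circ> h \<sigma>) \<ge> 0" "\<mu> \<sigma> \<ge> 0" if "\<sigma> \<in> Pow W" for \<sigma>
    proof -
      have *: "ev (push (h \<sigma>) a) r \<ge> 0" if "a \<in> insert (delta Top) (tab \<sigma> W)" for a
        using that \<open>\<sigma> \<in> Pow W\<close> by (intro F) (auto simp: F_def)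
      show "\<forall>a\<in>tab \<sigma> W. ev a (r \<circ> h \<sigma>) \<ge> 0" using * by (auto simp: ev_push inj)
      show "\<mu> \<sigma> \<ge> 0" using *[of "delta Top"] by (simp add: ev_push inj \<mu>_def)
    qed
    \<comment> \<open>On a cell of weight zero the quotient in \<open>y\<close> is meaningless, but
      there the scaled values lie between 0 and \<open>\<mu> \<sigma>\<close> and so vanish.\<close>
    have val: "r (h \<sigma> \<phi>) = \<mu> \<sigma> * std_eval (y \<sigma>) \<phi>" if \<sigma>: "\<sigma> \<in> Pow W" and \<phi>: "\<phi> \<in> E" for \<sigma> \<phi>
    proof (cases "\<mu> \<sigma> = 0")
      case True
      then show ?thesis using tab_bounds[OF cell(1)[OF \<sigma>], of \<phi>] W(2) \<phi> by (auto simp: \<mu>_def)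
    next
      case False
      then show ?thesis
        using tab_solution[OF cell(1)[OF \<sigma>], of \<phi>] cell(2)[OF \<sigma>] W_closed W \<phi> by (auto simp: \<mu>_def y_def)
    qed
    have Top: "(\<Sum>\<sigma>\<in>Pow W. \<mu> \<sigma>) = 1"
      using link[of Top Top] r(1) x(1) r0l by (auto simp: L_def \<mu>_def fun_eq_iff)
    have "(\<lambda>\<phi>\<in>E. x (Pr \<phi>)) = (\<Sum>\<sigma>\<in>Pow W. \<mu> \<sigma> *\<^sub>R truth_point E (y \<sigma>))"
    proof
      fix \<phi>
      show "(\<lambda>\<phi>\<in>E. x (Pr \<phi>)) \<phi> = (\<Sum>\<sigma>\<in>Pow W. \<mu> \<sigma> *\<^sub>R truth_point E (y \<sigma>)) \<phi>"
      proof (cases "\<phi> \<in> E")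
        case True
        then have "x (Pr \<phi>) = (\<Sum>\<sigma>\<in>Pow W. r (h \<sigma> \<phi>))"
          using link[of "Pr \<phi>" \<phi>] r(1) r0l by (auto simp: L_def fun_eq_iff)
        also have "\<dots> = (\<Sum>\<sigma>\<in>Pow W. \<mu> \<sigma> * std_eval (y \<sigma>) \<phi>)" using val True by simp
        finally show ?thesis using True
          by (simp add: sum_fun_apply scaleR_fun_def truth_point_def truth_fun_def)
      next
        \<comment> \<open>Outside \<open>E\<close> all truth points are \<open>undefined\<close>,
          and the weights sum to 1.\<close>
        case False
        then show ?thesis
          by (simp add: sum_fun_apply scaleR_fun_def truth_point_def Top flip: sum_distrib_right)
      qed
    qed
    also have "\<dots> \<in> truth_hull E"
    proof (rule convex_sum[OF fW _ Top])
      show "convex (truth_hull E)" by (simp add: truth_hull_def convex_convex_hull)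
      show "truth_point E (y \<sigma>) \<in> truth_hull E" for \<sigma>
        by (rule truth_point_in_hull) (simp add: y_def)
    qed (use cell(2) in simp)
    finally show ?thesis .
  qed
  moreover have "finite H" using S'(1) by (simp add: H_def)
  moreover have "\<forall>f\<in>H. {v. f v \<noteq> 0} \<subseteq> insert Top (Pr ` E)"
    using S'(3) by (force simp: H_def l_def)
  ultimately show ?thesis by blast
qed

subsection \<open>The coherent set is the hull\<close>

definition point_eval :: "(event \<Rightarrow> real) \<Rightarrow> modal \<Rightarrow> real" where
  "point_eval x = std_eval (\<lambda>p. x (event_of p))"

lemma point_eval_simps [simp]: "point_eval x (Pr \<phi>) = x \<phi>" "point_eval x Top = 1"
  by (simp_all add: point_eval_def)

lemma mv_eval_map_fm: "mv_eval A g (map_fm h t) = mv_eval A (g \<circ> h) t"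
  by (induction t) auto

lemma std_eval_bullet: "std_eval x (bullet \<Phi>) = point_eval x \<Phi>"
  by (simp add: bullet_def point_eval_def mv_eval_map_fm o_def)

lemma point_eval_cong: "(\<And>\<phi>. \<phi> \<in> events \<Phi> \<Longrightarrow> x \<phi> = x' \<phi>) \<Longrightarrow> point_eval x \<Phi> = point_eval x' \<Phi>"
  unfolding point_eval_def by (rule mv_eval_cong) (auto simp: events_def)

lemma finite_atoms [simp]: "finite (atoms \<phi>)"
  by (induction \<phi>) auto

lemma finite_events [simp]: "finite (events \<Phi>)"
  by (simp add: events_def)

lemma convex_extensional_halfspaces:
  assumes "\<And>f. f \<in> H \<Longrightarrow> {v. f v \<noteq> 0} \<subseteq> insert Top (Pr ` E)"
  shows "convex {x \<in> extensional E. \<forall>f\<in>H. ev f (point_eval x) \<ge> 0}"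
proof (rule convexI)
  fix x y :: "event \<Rightarrow> real" and u v :: real
  assume xy: "x \<in> {x \<in> extensional E. \<forall>f\<in>H. ev f (point_eval x) \<ge> 0}"
    "y \<in> {x \<in> extensional E. \<forall>f\<in>H. ev f (point_eval x) \<ge> 0}" and uv: "0 \<le> u" "0 \<le> v" "u + v = 1"
  \<comment> \<open>Extensional functions form an affine subspace, not a linear one; weights with
    sum 1 preserve the value \<open>undefined\<close>.\<close>
  have "u * undefined + v * undefined = (undefined :: real)"
    using uv(3) by (metis distrib_right mult_1)
  then have "u *\<^sub>R x + v *\<^sub>R y \<in> extensional E"
    using xy by (auto simp: extensional_def scaleR_fun_def)
  moreover have "ev f (point_eval (u *\<^sub>R x + v *\<^sub>R y)) \<ge> 0" if f: "f \<in> H" for f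
  proof -
    have "ev f (point_eval (u *\<^sub>R x + v *\<^sub>R y)) = ev f (\<lambda>m. u * point_eval x m + v * point_eval y m)"
      using assms[OF f] uv(3) by (intro ev_cong) (auto simp: scaleR_fun_def)
    also have "\<dots> = u * ev f (point_eval x) + v * ev f (point_eval y)"
      by (simp add: ev_def sum.distrib sum_distrib_left algebra_simps)
    finally show ?thesis using xy uv f by simp
  qed
  ultimately show "u *\<^sub>R x + v *\<^sub>R y \<in> {x \<in> extensional E. \<forall>f\<in>H. ev f (point_eval x) \<ge> 0}"
    by blast
qed

lemma continuous_on_point_eval: "continuous_on S (\<lambda>x. point_eval x \<Phi>)"
proof (induction \<Phi>)
  case (Atom p)
  then show ?case
    by (auto simp: point_eval_def intro: continuous_on_subset[OF continuous_on_product_coordinates])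
qed (auto simp: point_eval_def intro!: continuous_intros)

lemma closed_extensional_halfspaces:
  "closed {x \<in> extensional E. \<forall>f\<in>H. ev f (point_eval x) \<ge> (0 :: real)}"
proof -
  have "{x \<in> extensional E. \<forall>f\<in>H. ev f (point_eval x) \<ge> 0} =
      (\<Inter>\<phi>\<in>- E. {x. x \<phi> = undefined}) \<inter> (\<Inter>f\<in>H. {x. 0 \<le> ev f (point_eval x)})"
    by (auto simp: extensional_def)
  moreover have "closed {x :: event \<Rightarrow> real. x \<phi> = undefined}" for \<phi>
    by (intro closed_Collect_eq continuous_on_product_coordinates continuous_on_const)
  moreover have "closed {x. 0 \<le> ev f (point_eval x)}" for f
    unfolding ev_def
    by (intro closed_Collect_le continuous_intros continuous_on_point_eval)
  ultimately show ?thesis by (auto intro!: closed_Int closed_INT)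
qed

lemma point_eval_truth_point:
  assumes "{v. f v \<noteq> 0} \<subseteq> insert Top (Pr ` E)"
  shows "ev f (point_eval (truth_point E y)) = ev f (modal_eval y)"
  using assms by (intro ev_cong) (auto simp: truth_point_def truth_fun_def)

theorem coherent_set_inequalities:
  assumes "finite E"
  shows "\<exists>H. finite H \<and> (\<forall>f\<in>H. {v. f v \<noteq> 0} \<subseteq> insert Top (Pr ` E)) \<and>
    (\<forall>f\<in>H. \<forall>y. (\<forall>p. y p \<in> {0..1}) \<longrightarrow> ev f (modal_eval y) \<ge> 0) \<and>
    truth_hull E = {x \<in> extensional E. \<forall>f\<in>H. ev f (point_eval x) \<ge> 0}"
proof -
  obtain H where H: "finite H" "\<forall>f\<in>H. {v. f v \<noteq> 0} \<subseteq> insert Top (Pr ` E)"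
    "\<forall>f\<in>H. \<forall>y. (\<forall>p. y p \<in> {0..1}) \<longrightarrow> ev f (modal_eval y) \<ge> 0"
    "\<forall>x. x Top = 1 \<longrightarrow> (\<forall>f\<in>H. ev f x \<ge> 0) \<longrightarrow> (\<lambda>\<phi>\<in>E. x (Pr \<phi>)) \<in> truth_hull E"
    using truth_hull_inequalities[OF assms] by (elim exE conjE) (rule that)
  have "truth_hull E = {x \<in> extensional E. \<forall>f\<in>H. ev f (point_eval x) \<ge> 0}" (is "_ = ?P")
  proof
    show "truth_hull E \<subseteq> ?P" unfolding truth_hull_def
    proof (rule hull_minimal)
      show "convex ?P" using H(2) by (intro convex_extensional_halfspaces) blast
      show "truth_point E ` cube (\<Union>\<phi>\<in>E. atoms \<phi>) \<subseteq> ?P"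
      proof clarify
        fix y :: "nat \<Rightarrow> real" assume y: "y \<in> cube (\<Union>\<phi>\<in>E. atoms \<phi>)"
        \<comment> \<open>Outside its variables \<open>y\<close> is \<open>undefined\<close>; the
          validity of the inequalities is stated for assignments that lie in the unit interval
          everywhere.\<close>
        define y' where "y' = (\<lambda>p. if p \<in> (\<Union>\<phi>\<in>E. atoms \<phi>) then y p else 0)"
        have "truth_point E y = truth_point E y'"
          unfolding truth_point_def truth_fun_def
          by (intro restrict_ext mv_eval_cong) (auto simp: y'_def)
        moreover have "y' p \<in> {0..1}" for p using y by (auto simp: y'_def cube_def PiE_iff)
        ultimately show "truth_point E y \<in> extensional E \<and> (\<forall>f\<in>H. ev f (point_eval (truth_point E y)) \<ge> 0)"
          using H(3) point_eval_truth_point[OF bspec[OF H(2)], of _ y'] by (auto simp: truth_point_def)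
      qed
    qed
    show "?P \<subseteq> truth_hull E"
    proof
      fix x assume x: "x \<in> ?P"
      then have "(\<lambda>\<phi>\<in>E. point_eval x (Pr \<phi>)) \<in> truth_hull E"
        by (intro H(4)[rule_format]) auto
      also have "(\<lambda>\<phi>\<in>E. point_eval x (Pr \<phi>)) = x" using x by (auto simp: extensional_restrict)
      finally show "x \<in> truth_hull E" .
    qed
  qed
  with H(1-3) show ?thesis by (intro exI[of _ H] conjI)
qed

text \<open>A set cut out by weak inequalities is closed, so the closure adds no points.\<close>

corollary coherent_set_eq:
  assumes "finite E" shows "coherent_set E = truth_hull E"
proof -
  obtain H where "truth_hull E = {x \<in> extensional E. \<forall>f\<in>H. ev f (point_eval x) \<ge> 0}"
    using coherent_set_inequalities[OF assms] by (elim exE conjE) (rule that)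
  then have "closed (truth_hull E)" by (simp add: closed_extensional_halfspaces)
  then show ?thesis by (simp add: coherent_set_eq_closure)
qed

lemma truth_hull_subset_cube: "truth_hull E \<subseteq> cube E"
proof -
  have "convex (cube E)"
  proof (rule convexI)
    fix x y :: "event \<Rightarrow> real" and u v :: real
    assume xy: "x \<in> cube E" "y \<in> cube E" and uv: "0 \<le> u" "0 \<le> v" "u + v = 1"
    have "u * undefined + v * undefined = (undefined :: real)"
      using uv(3) by (metis distrib_right mult_1)
    moreover have "u * x \<phi> + v * y \<phi> \<in> {0..1}" if "\<phi> \<in> E" for \<phi>
    proof -
      have "x \<phi> \<in> {0..1}" "y \<phi> \<in> {0..1}" using that xy by (auto simp: cube_def PiE_iff)
      then show ?thesis using convexD[of "{0..1::real}" "x \<phi>" "y \<phi>" u v] uv by auto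
    qed
    ultimately show "u *\<^sub>R x + v *\<^sub>R y \<in> cube E"
      using xy by (auto simp: cube_def PiE_iff extensional_def scaleR_fun_def)
  qed
  moreover have "truth_point E y \<in> cube E" if "y \<in> cube (\<Union>\<phi>\<in>E. atoms \<phi>)" for y
  proof -
    have "std_eval y \<phi> \<in> {0..1}" if "\<phi> \<in> E" for \<phi>
      using that \<open>y \<in> _\<close> by (intro std_eval_bounds) (auto simp: cube_def PiE_iff)
    then show ?thesis by (simp add: truth_point_def cube_def truth_fun_def)
  qed
  ultimately show ?thesis unfolding truth_hull_def by (intro hull_minimal) auto
qed

subsection \<open>Completeness and soundness over the coherent set\<close>

text \<open>The countermodel solves one system: \<Psi> below the unit, \<Phi> at the unit, a tableau
  branch for both formulas, and the inequalities of the coherent set. All of these hold in the cone,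
  and a real solution divided by its unit is a point of the hull.\<close>

theorem fp_completeness:
  assumes E: "E = events \<Phi> \<union> events \<Psi>"
    and valid: "\<And>x. x \<in> truth_hull E \<Longrightarrow> point_eval x \<Phi> = 1 \<Longrightarrow> point_eval x \<Psi> = 1"
  shows "{\<Phi>} \<turnstile>\<^sub>F\<^sub>P \<Psi>"
proof (rule ccontr)
  assume "\<not> {\<Phi>} \<turnstile>\<^sub>F\<^sub>P \<Psi>"
  then have "\<not> {\<Theta>. {\<Phi>} \<turnstile>\<^sub>F\<^sub>P \<Theta>} \<turnstile>\<^sub>L \<Psi>" using fp_derives_luk_closed by blast
  then obtain NN where NN: "mv_cone NN"
    "\<And>\<Theta>. {\<Theta>. {\<Phi>} \<turnstile>\<^sub>F\<^sub>P \<Theta>} \<turnstile>\<^sub>L \<Theta> \<Longrightarrow> NN (delta \<Theta> - delta Top)" and \<Psi>: "\<not> NN (delta \<Psi> - delta Top)"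
    by (rule prime_cone) metis
  interpret mv_cone NN by fact
  interpret fp_cone NN "{\<Phi>}"
    by unfold_locales (intro NN(2) luk_derives.premise, simp)
  have fE: "finite E" by (simp add: E)
  obtain H where H: "finite H" "\<forall>f\<in>H. {v. f v \<noteq> 0} \<subseteq> insert Top (Pr ` E)"
    "\<forall>f\<in>H. \<forall>y. (\<forall>p. y p \<in> {0..1}) \<longrightarrow> ev f (modal_eval y) \<ge> 0"
    "truth_hull E = {x \<in> extensional E. \<forall>f\<in>H. ev f (point_eval x) \<ge> 0}"
    using coherent_set_inequalities[OF fE] by (elim exE conjE) (rule that)
  define V where "V = subf \<Phi> \<union> subf \<Psi>"
  let ?T = "tab {\<theta>. NN (delta \<theta> - delta Top)} V"
  have NN_H: "NN f" if "f \<in> H" for f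
    using that H(2,3) by (intro NN_if_valid[OF fE]) auto
  have fin_H: "fin_form f" if "f \<in> H" for f
    using H(2) that fE by (intro fin_form_sub[of "insert Top (Pr ` E)"]) auto
  have "NN (delta \<Phi> - delta Top)" by (intro NN_fp fp_derives.premise) simp
  then have "\<exists>r. \<forall>c\<in>insert (True, delta Top - delta \<Psi>) (Pair False ` (insert (delta \<Phi> - delta Top) (?T \<union> H))). sat r c"
    using \<Psi> NN_le_Top NN_tab NN_H H(1) fin_H
    by (intro cone_satisfiable) (auto simp: V_def intro: fin_form_tab)
  then obtain r where r: "\<forall>a\<in>?T. ev a r \<ge> 0" "r \<Psi> < r Top" "r \<Phi> \<ge> r Top" "\<forall>f\<in>H. ev f r \<ge> 0"
    by (auto simp: sat_def)
  have bounds: "0 \<le> r \<theta>" "r \<theta> \<le> r Top" if "\<theta> \<in> V" for \<theta>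
    using tab_bounds[OF r(1) that] by auto
  have "\<Psi> \<in> V" "\<Phi> \<in> V" by (simp_all add: V_def)
  then have pos: "r Top > 0" and r\<Phi>: "r \<Phi> = r Top" using bounds[of \<Psi>] bounds[of \<Phi>] r(2,3) by auto
  define x where "x = (\<lambda>\<phi>\<in>E. r (Pr \<phi>) / r Top)"
  have "ev f (point_eval x) \<ge> 0" if f: "f \<in> H" for f
  proof -
    have "ev f (point_eval x) = ev f (\<lambda>m. (1 / r Top) * r m)"
    proof (rule ev_cong)
      fix v assume "f v \<noteq> 0"
      then have "v \<in> insert Top (Pr ` E)" using H(2) f by blast
      then show "point_eval x v = (1 / r Top) * r v" using pos by (auto simp: x_def)
    qed
    also have "\<dots> = (1 / r Top) * ev f r" by (rule ev_scale)
    finally show ?thesis using r(4) f pos by simp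
  qed
  then have x: "x \<in> truth_hull E" unfolding H(4) by (simp add: x_def)
  have val: "r \<theta> = r Top * point_eval x \<theta>" if "subf \<theta> \<subseteq> V" "events \<theta> \<subseteq> E" for \<theta>
  proof -
    have "r \<theta> = r Top * std_eval (\<lambda>p. max 0 (min 1 (r (Atom p) / r Top))) \<theta>"
      by (rule tab_solution[OF r(1) pos that(1)])
    also have "std_eval (\<lambda>p. max 0 (min 1 (r (Atom p) / r Top))) \<theta> = point_eval x \<theta>"
      unfolding point_eval_def
    proof (rule mv_eval_cong)
      fix p assume "p \<in> atoms \<theta>"
      then have "Atom p \<in> V" "event_of p \<in> E" using that Atom_subf[of p \<theta>] by (auto simp: events_def)
      moreover have "P (event_of p) = p" by simp
      ultimately show "max 0 (min 1 (r (Atom p) / r Top)) = x (event_of p)"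
        using bounds[of "Atom p"] pos by (simp add: x_def min_def max_def)
    qed
    finally show ?thesis .
  qed
  have "point_eval x \<Phi> = 1" using val[of \<Phi>] r\<Phi> pos by (simp add: V_def E)
  with x have "point_eval x \<Psi> = 1" by (rule valid)
  then show False using val[of \<Psi>] r(2) by (simp add: V_def E)
qed

section \<open>Soundness through states\<close>

lemma std_eval_Imp: "std_eval y (Imp \<phi> \<psi>) = min 1 (1 - std_eval y \<phi> + std_eval y \<psi>)"
  by (simp add: Imp_def)

lemma std_eval_Iff:
  assumes "std_eval y \<phi> = std_eval y \<psi>" shows "std_eval y (Iff \<phi> \<psi>) = 1"
  by (simp add: Iff_def And_def Or_def std_eval_Imp assms)

lemma luk_axiom_sound:
  assumes "luk_axiom \<phi>" "\<And>p. y p \<in> {0..1}" shows "std_eval y \<phi> = 1"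
proof -
  have b: "0 \<le> std_eval y \<theta>" "std_eval y \<theta> \<le> 1" for \<theta>
    using std_eval_bounds[where y = y and \<phi> = \<theta>] assms(2) by auto
  show ?thesis using assms(1)
  proof cases
    case (L1 \<phi> \<psi>)
    then show ?thesis using b[of \<phi>] b[of \<psi>] by (auto simp: std_eval_Imp min_def)
  next
    case (L2 \<phi> \<psi> \<gamma>)
    then show ?thesis using b[of \<phi>] b[of \<psi>] b[of \<gamma>] by (auto simp: std_eval_Imp min_def)
  next
    case (L3 \<phi> \<psi>)
    then show ?thesis using b[of \<phi>] b[of \<psi>] by (auto simp: std_eval_Imp min_def)
  qed (auto simp: std_eval_Imp)
qed

lemma std_eval_mp:
  assumes "std_eval y \<phi> = 1" "std_eval y (Imp \<phi> \<psi>) = 1" "std_eval y \<psi> \<le> 1"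
  shows "std_eval y \<psi> = 1"
  using assms by (auto simp: std_eval_Imp)

lemma luk_sound:
  assumes "luk_provable \<phi>" "\<And>p. y p \<in> {0..1}" shows "std_eval y \<phi> = 1"
  using assms(1)
proof (induction rule: luk_provable.induct)
  case (mp \<phi> \<psi>)
  have "std_eval y \<psi> \<le> 1" using std_eval_bounds[where y = y and \<phi> = \<psi>] assms(2) by auto
  with mp.IH show ?case by (rule std_eval_mp)
qed (use luk_axiom_sound assms(2) in blast)

text \<open>The properties are chosen to be preserved by convex combinations and to validate
  \<open>P1\<close>, \<open>P2\<close>, \<open>P3\<close> and \<open>N\<close>.\<close>

definition state :: "(event \<Rightarrow> real) \<Rightarrow> bool" where
  "state s \<longleftrightarrow> (\<forall>\<phi>. 0 \<le> s \<phi> \<and> s \<phi> \<le> 1) \<and> (\<forall>\<phi>. s (Neg \<phi>) = 1 - s \<phi>) \<and>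
     (\<forall>\<phi> \<psi>. s (Odot \<phi> \<psi>) \<le> s \<phi>) \<and> (\<forall>\<phi> \<psi>. s (Oplus \<phi> \<psi>) + s (Odot \<phi> \<psi>) = s \<phi> + s \<psi>) \<and>
     (\<forall>\<phi>. luk_provable \<phi> \<longrightarrow> s \<phi> = 1)"

lemma fp_sound:
  assumes "\<Gamma> \<turnstile>\<^sub>F\<^sub>P \<Phi>" "state s" "\<And>\<Theta>. \<Theta> \<in> \<Gamma> \<Longrightarrow> point_eval s \<Theta> = 1"
  shows "point_eval s \<Phi> = 1"
proof -
  have s: "0 \<le> s \<phi>" "s \<phi> \<le> 1" "s (Neg \<phi>) = 1 - s \<phi>" "s (Odot \<phi> \<psi>) \<le> s \<phi>"
    "s (Oplus \<phi> \<psi>) + s (Odot \<phi> \<psi>) = s \<phi> + s \<psi>" "luk_provable \<phi> \<Longrightarrow> s \<phi> = 1" for \<phi> \<psi>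
    using assms(2) unfolding state_def by blast+
  have b: "point_eval s \<Theta> \<le> 1" for \<Theta>
    using std_eval_bounds[where y = "\<lambda>p. s (event_of p)" and \<phi> = \<Theta>] s(1,2) by (simp add: point_eval_def)
  note pe = point_eval_def
  show ?thesis using assms(1)
  proof (induction rule: fp_derives.induct)
    case (premise \<Phi>)
    then show ?case by (rule assms(3))
  next
    case (luk \<Phi>)
    then show ?case unfolding pe using s(1,2) by (intro luk_axiom_sound) auto
  next
    case (mp \<Phi> \<Psi>)
    show ?case using mp.IH b[of \<Psi>] unfolding pe by (rule std_eval_mp)
  next
    case (P1 \<phi>)
    then show ?case unfolding pe by (intro std_eval_Iff) (simp add: s(3))
  next
    case (P2 \<phi> \<psi>)
    have "s (Imp \<phi> \<psi>) \<le> 1 - s \<phi> + s \<psi>"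
      using s(5)[of "Neg \<phi>" \<psi>] s(1)[of "Odot (Neg \<phi>) \<psi>"] s(3)[of \<phi>] by (simp add: Imp_def)
    then show ?case using s(2)[of "Imp \<phi> \<psi>"] unfolding pe by (simp add: std_eval_Imp)
  next
    case (P3 \<phi> \<psi>)
    \<comment> \<open>Since \<open>s (Odot \<phi> \<psi>) \<le> s \<phi>\<close>, the inner
      implication is not truncated. Additivity then gives \<open>s (Oplus \<phi> \<psi>)\<close>,
      which is at most 1, as the value of the outer one.\<close>
    show ?case unfolding pe
      using s(4)[of \<phi> \<psi>] s(5)[of \<phi> \<psi>] s(2)[of "Oplus \<phi> \<psi>"]
      by (intro std_eval_Iff) (simp add: std_eval_Imp min_def)
  next
    case (N \<phi>)
    then show ?case by (simp add: s(6))
  qed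
qed

lemma state_truth: "(\<And>p. y p \<in> {0..1}) \<Longrightarrow> state (std_eval y)"
  unfolding state_def
proof (intro conjI allI impI)
  assume y: "\<And>p. y p \<in> {0..1}"
  have b: "0 \<le> std_eval y \<theta>" "std_eval y \<theta> \<le> 1" for \<theta>
    using std_eval_bounds[where y = y and \<phi> = \<theta>] y by auto
  fix \<phi> \<psi>
  show "0 \<le> std_eval y \<phi>" "std_eval y \<phi> \<le> 1" by (rule b)+
  show "std_eval y (Odot \<phi> \<psi>) \<le> std_eval y \<phi>"
    "std_eval y (Oplus \<phi> \<psi>) + std_eval y (Odot \<phi> \<psi>) = std_eval y \<phi> + std_eval y \<psi>"
    using b[of \<phi>] b[of \<psi>] by (auto simp: std_eval_Odot)
  show "luk_provable \<phi> \<Longrightarrow> std_eval y \<phi> = 1" by (rule luk_sound) (use y in auto)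
qed simp

lemma state_convex:
  assumes s: "state s" and t: "state t" and uv: "0 \<le> u" "0 \<le> v" "u + v = 1"
  shows "state (\<lambda>\<phi>. u * s \<phi> + v * t \<phi>)"
proof -
  have u: "u = 1 - v" using uv(3) by simp
  note s' = s[unfolded state_def] and t' = t[unfolded state_def]
  show ?thesis unfolding state_def
  proof (intro conjI allI impI)
    fix \<phi> \<psi>
    show "0 \<le> u * s \<phi> + v * t \<phi>" using s' t' uv by simp
    show "u * s \<phi> + v * t \<phi> \<le> 1" using s' t' uv by (intro convex_bound_le) auto
    have neg: "s (Neg \<phi>) = 1 - s \<phi>" "t (Neg \<phi>) = 1 - t \<phi>" using s' t' by blast+
    show "u * s (Neg \<phi>) + v * t (Neg \<phi>) = 1 - (u * s \<phi> + v * t \<phi>)"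
      unfolding neg by (simp add: u algebra_simps)
    show "u * s (Odot \<phi> \<psi>) + v * t (Odot \<phi> \<psi>) \<le> u * s \<phi> + v * t \<phi>"
      using s' t' uv by (intro add_mono mult_left_mono) auto
    have "s (Oplus \<phi> \<psi>) + s (Odot \<phi> \<psi>) = s \<phi> + s \<psi>" "t (Oplus \<phi> \<psi>) + t (Odot \<phi> \<psi>) = t \<phi> + t \<psi>"
      using s' t' by blast+
    then have "u * (s (Oplus \<phi> \<psi>) + s (Odot \<phi> \<psi>)) + v * (t (Oplus \<phi> \<psi>) + t (Odot \<phi> \<psi>)) =
        u * (s \<phi> + s \<psi>) + v * (t \<phi> + t \<psi>)" by simp
    then show "u * s (Oplus \<phi> \<psi>) + v * t (Oplus \<phi> \<psi>) + (u * s (Odot \<phi> \<psi>) + v * t (Odot \<phi> \<psi>)) =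
        u * s \<phi> + v * t \<phi> + (u * s \<psi> + v * t \<psi>)" by (simp add: algebra_simps)
    show "u * s \<phi> + v * t \<phi> = 1" if "luk_provable \<phi>"
      using that s' t' uv by simp
  qed
qed

text \<open>A derivation of \<Psi> from \<Phi> may pass through probabilities of events outside
  \<open>E\<close>, about which a point of the hull says nothing; a state supplies values for
  them.\<close>

lemma truth_hull_states:
  assumes "x \<in> truth_hull E" obtains s where "state s" "x = restrict s E"
proof -
  let ?K = "{restrict s E |s. state s}"
  have "truth_hull E \<subseteq> ?K" unfolding truth_hull_def
  proof (rule hull_minimal)
    show "truth_point E ` cube (\<Union>\<phi>\<in>E. atoms \<phi>) \<subseteq> ?K"
    proof clarify
      fix y :: "nat \<Rightarrow> real" assume y: "y \<in> cube (\<Union>\<phi>\<in>E. atoms \<phi>)"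
      define y' where "y' = (\<lambda>p. if p \<in> (\<Union>\<phi>\<in>E. atoms \<phi>) then y p else 0)"
      have "truth_point E y = restrict (std_eval y') E"
        unfolding truth_point_def truth_fun_def
        by (intro restrict_ext mv_eval_cong) (auto simp: y'_def)
      moreover have "state (std_eval y')"
        using y by (intro state_truth) (auto simp: y'_def cube_def PiE_iff)
      ultimately show "\<exists>s. truth_point E y = restrict s E \<and> state s" by blast
    qed
    show "convex ?K"
    proof (rule convexI)
      fix x y :: "event \<Rightarrow> real" and u v :: real
      assume "x \<in> ?K" "y \<in> ?K" and uv: "0 \<le> u" "0 \<le> v" "u + v = 1"
      then obtain s t where st: "x = restrict s E" "state s" "y = restrict t E" "state t" by blast
      have "u * undefined + v * undefined = (undefined :: real)"
        using uv(3) by (metis distrib_right mult_1)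
      then have "u *\<^sub>R x + v *\<^sub>R y = restrict (\<lambda>\<phi>. u * s \<phi> + v * t \<phi>) E"
        by (auto simp: st scaleR_fun_def fun_eq_iff)
      then show "u *\<^sub>R x + v *\<^sub>R y \<in> ?K" using state_convex[OF st(2,4) uv] by blast
    qed
  qed
  then show ?thesis using assms that by blast
qed

theorem fp_soundness:
  assumes E: "E = events \<Phi> \<union> events \<Psi>" and "{\<Phi>} \<turnstile>\<^sub>F\<^sub>P \<Psi>" "x \<in> truth_hull E" "point_eval x \<Phi> = 1"
  shows "point_eval x \<Psi> = 1"
proof -
  obtain s where s: "state s" "x = restrict s E" using assms(3) by (rule truth_hull_states)
  have "point_eval x \<Theta> = point_eval s \<Theta>" if "events \<Theta> \<subseteq> E" for \<Theta>
    using that by (intro point_eval_cong) (auto simp: s(2))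
  then show ?thesis using fp_sound[OF assms(2) s(1)] assms(4) by (simp add: E)
qed

subsection \<open>Quotients and isomorphic copies of MV-algebras\<close>

definition mv_congruence :: "'a mv \<Rightarrow> 'a rel \<Rightarrow> bool" where
  "mv_congruence A R \<longleftrightarrow> equiv (mv_carrier A) R \<and>
     (\<forall>x y. (x, y) \<in> R \<longrightarrow> (mv_neg A x, mv_neg A y) \<in> R) \<and>
     (\<forall>x x' y y'. (x, x') \<in> R \<longrightarrow> (y, y') \<in> R \<longrightarrow> (mv_plus A x y, mv_plus A x' y') \<in> R)"

context
  fixes A :: "'a mv" and R :: "'a rel"
  assumes cong: "mv_congruence A R"
begin

lemma quotient_sel:
  "mv_carrier (mv_quotient A R) = mv_carrier A // R"
  "mv_zero (mv_quotient A R) = R `` {mv_zero A}"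
  by (simp_all add: mv_quotient_def)

lemma quotient_neg:
  assumes "x \<in> mv_carrier A"
  shows "mv_neg (mv_quotient A R) (R `` {x}) = R `` {mv_neg A x}"
proof -
  have eq: "equiv (mv_carrier A) R" using cong by (simp add: mv_congruence_def)
  have "R `` {mv_neg A y} = R `` {mv_neg A x}" if "y \<in> R `` {x}" for y
  proof -
    have "(mv_neg A x, mv_neg A y) \<in> R" using that cong by (auto simp: mv_congruence_def)
    then show ?thesis by (rule equiv_class_eq[OF eq, symmetric])
  qed
  moreover have "R `` {x} \<noteq> {}" using equiv_class_self[OF eq assms] by blast
  ultimately have "(\<Union>y\<in>R `` {x}. R `` {mv_neg A y}) = R `` {mv_neg A x}"
    by (intro SUP_eq_const)
  then show ?thesis by (simp add: mv_quotient_def)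
qed

lemma quotient_plus:
  assumes "x \<in> mv_carrier A" "y \<in> mv_carrier A"
  shows "mv_plus (mv_quotient A R) (R `` {x}) (R `` {y}) = R `` {mv_plus A x y}"
proof -
  have eq: "equiv (mv_carrier A) R" using cong by (simp add: mv_congruence_def)
  have "R `` {mv_plus A x' y'} = R `` {mv_plus A x y}" if "x' \<in> R `` {x}" "y' \<in> R `` {y}" for x' y'
  proof -
    have "(mv_plus A x y, mv_plus A x' y') \<in> R" using that cong by (auto simp: mv_congruence_def)
    then show ?thesis by (rule equiv_class_eq[OF eq, symmetric])
  qed
  moreover have "R `` {x} \<noteq> {}" "R `` {y} \<noteq> {}" using equiv_class_self[OF eq] assms by blast+
  ultimately have "(\<Union>x'\<in>R `` {x}. \<Union>y'\<in>R `` {y}. R `` {mv_plus A x' y'}) = R `` {mv_plus A x y}"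
    by (intro SUP_eq_const)
  then show ?thesis by (simp add: mv_quotient_def)
qed

lemma mv_algebra_quotient:
  assumes "mv_algebra A" shows "mv_algebra (mv_quotient A R)"
proof -
  interpret mv_algebra A by fact
  have c: "\<And>x. x \<in> mv_carrier A \<Longrightarrow> R `` {x} \<in> mv_carrier (mv_quotient A R)"
    by (simp add: quotient_sel quotientI)
  have q: thesis if "X \<in> mv_carrier (mv_quotient A R)"
    "\<And>x. x \<in> mv_carrier A \<Longrightarrow> X = R `` {x} \<Longrightarrow> thesis" for X thesis
    using that by (auto simp: quotient_sel elim: quotientE)
  show ?thesis
  proof
    fix X Y assume "X \<in> mv_carrier (mv_quotient A R)" "Y \<in> mv_carrier (mv_quotient A R)"
    then obtain x y where [simp]: "x \<in> mv_carrier A" "X = R `` {x}" "y \<in> mv_carrier A" "Y = R `` {y}"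
      by (metis q)
    show "mv_plus (mv_quotient A R) X Y \<in> mv_carrier (mv_quotient A R)"
      by (simp add: quotient_plus c)
    show "mv_plus (mv_quotient A R) X Y = mv_plus (mv_quotient A R) Y X"
      by (simp add: quotient_plus plus_commute)
    show "mv_plus (mv_quotient A R) (mv_neg (mv_quotient A R) (mv_plus (mv_quotient A R)
          (mv_neg (mv_quotient A R) X) Y)) Y =
        mv_plus (mv_quotient A R) (mv_neg (mv_quotient A R) (mv_plus (mv_quotient A R)
          (mv_neg (mv_quotient A R) Y) X)) X"
      using lukasiewicz[of x y] by (simp add: quotient_plus quotient_neg)
    fix Z assume "Z \<in> mv_carrier (mv_quotient A R)"
    then obtain z where [simp]: "z \<in> mv_carrier A" "Z = R `` {z}" by (metis q)
    show "mv_plus (mv_quotient A R) (mv_plus (mv_quotient A R) X Y) Z =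
        mv_plus (mv_quotient A R) X (mv_plus (mv_quotient A R) Y Z)"
      by (simp add: quotient_plus plus_assoc)
  next
    fix X assume "X \<in> mv_carrier (mv_quotient A R)"
    then obtain x where [simp]: "x \<in> mv_carrier A" "X = R `` {x}" by (metis q)
    show "mv_neg (mv_quotient A R) X \<in> mv_carrier (mv_quotient A R)"
      "mv_plus (mv_quotient A R) X (mv_zero (mv_quotient A R)) = X"
      "mv_neg (mv_quotient A R) (mv_neg (mv_quotient A R) X) = X"
      "mv_plus (mv_quotient A R) X (mv_neg (mv_quotient A R) (mv_zero (mv_quotient A R))) =
        mv_neg (mv_quotient A R) (mv_zero (mv_quotient A R))"
      by (simp_all add: quotient_plus quotient_neg quotient_sel(2) c)
  qed (simp add: quotient_sel(2) c)
qed

end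

lemma mv_algebra_iso:
  assumes "mv_algebra A" "mv_iso A B f" shows "mv_algebra B"
proof -
  interpret mv_algebra A by fact
  have B: "mv_carrier B = f ` mv_carrier A"
    using assms(2) by (simp add: mv_iso_def bij_betw_def)
  have hom: "mv_zero B = f (mv_zero A)" "\<And>x. x \<in> mv_carrier A \<Longrightarrow> mv_neg B (f x) = f (mv_neg A x)"
    "\<And>x y. x \<in> mv_carrier A \<Longrightarrow> y \<in> mv_carrier A \<Longrightarrow> mv_plus B (f x) (f y) = f (mv_plus A x y)"
    using assms(2) by (auto simp: mv_iso_def mv_hom_def)
  show ?thesis
  proof
    show "mv_plus B x y = mv_plus B y x" if "x \<in> mv_carrier B" "y \<in> mv_carrier B" for x y
      using that by (auto simp: B hom plus_commute)
    show "mv_plus B (mv_neg B (mv_plus B (mv_neg B x) y)) y =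
        mv_plus B (mv_neg B (mv_plus B (mv_neg B y) x)) x"
      if "x \<in> mv_carrier B" "y \<in> mv_carrier B" for x y
      using that by (auto simp: B hom lukasiewicz)
  qed (auto simp: B hom plus_assoc)
qed

text \<open>Transport of structure, used to place the coherent algebra inside the element type over
  which entailment quantifies.\<close>

definition mv_copy :: "('a \<Rightarrow> 'b) \<Rightarrow> 'a mv \<Rightarrow> 'b mv" where
  "mv_copy f A = (let g = inv_into (mv_carrier A) f in
     \<lparr>mv_carrier = f ` mv_carrier A, mv_plus = (\<lambda>x y. f (mv_plus A (g x) (g y))),
      mv_neg = (\<lambda>x. f (mv_neg A (g x))), mv_zero = f (mv_zero A)\<rparr>)"

lemma mv_iso_copy:
  assumes "inj_on f (mv_carrier A)" shows "mv_iso A (mv_copy f A) f"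
  using assms by (auto simp: mv_iso_def mv_hom_def mv_copy_def bij_betw_def Let_def)

lemma mv_hom_compose: "mv_hom A B f \<Longrightarrow> mv_hom B C h \<Longrightarrow> mv_hom A C (h \<circ> f)"
  by (simp add: mv_hom_def image_subset_iff)

lemma mv_hom_iso_inverse:
  assumes "mv_algebra A" "mv_iso A B f" "mv_hom A C h"
  shows "mv_hom B C (h \<circ> inv_into (mv_carrier A) f)"
proof -
  interpret mv_algebra A by fact
  have inj: "inj_on f (mv_carrier A)" and B: "mv_carrier B = f ` mv_carrier A"
    using assms(2) by (auto simp: mv_iso_def bij_betw_def)
  have hom: "mv_zero B = f (mv_zero A)" "\<And>x. x \<in> mv_carrier A \<Longrightarrow> mv_neg B (f x) = f (mv_neg A x)"
    "\<And>x y. x \<in> mv_carrier A \<Longrightarrow> y \<in> mv_carrier A \<Longrightarrow> mv_plus B (f x) (f y) = f (mv_plus A x y)"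
    using assms(2) by (auto simp: mv_iso_def mv_hom_def)
  show ?thesis
    using assms(3) inj by (auto simp: mv_hom_def B hom)
qed

subsection \<open>McNaughton functions\<close>

lemma free_mv_sel [simp]:
  "mv_carrier (free_mv I) = mcnaughton I"
  "mv_plus (free_mv I) f g = (\<lambda>x\<in>cube I. min 1 (f x + g x))"
  "mv_neg (free_mv I) f = (\<lambda>x\<in>cube I. 1 - f x)"
  "mv_zero (free_mv I) = (\<lambda>x\<in>cube I. 0)"
  by (simp_all add: free_mv_def)

lemma mcnaughtonI:
  assumes "\<And>x. x \<in> cube I \<Longrightarrow> f x \<in> {0..1}" "continuous_on (cube I) f" "finite L"
    and "\<And>x. x \<in> cube I \<Longrightarrow> \<exists>(b, a)\<in>L. f x = of_int b + (\<Sum>i\<in>I. of_int (a i) * x i)"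
  shows "restrict f (cube I) \<in> mcnaughton I"
proof -
  have "continuous_on (cube I) (restrict f (cube I))"
    using assms(2) by (simp cong: continuous_on_cong)
  moreover have "\<exists>L :: (int \<times> ('a \<Rightarrow> int)) set. finite L \<and> (\<forall>x\<in>cube I. \<exists>(b, a)\<in>L.
      restrict f (cube I) x = of_int b + (\<Sum>i\<in>I. of_int (a i) * x i))"
    using assms(3,4) by (intro exI[of _ L]) simp
  ultimately show ?thesis using assms(1) by (simp add: mcnaughton_def)
qed

lemma mcnaughtonD:
  assumes "f \<in> mcnaughton I"
  shows "x \<in> cube I \<Longrightarrow> 0 \<le> f x" "x \<in> cube I \<Longrightarrow> f x \<le> 1" "restrict f (cube I) = f" "continuous_on (cube I) f"
    "\<exists>L :: (int \<times> ('a \<Rightarrow> int)) set. finite L \<and>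
      (\<forall>x\<in>cube I. \<exists>(b, a)\<in>L. f x = of_int b + (\<Sum>i\<in>I. of_int (a i) * x i))"
  using assms by (auto simp: mcnaughton_def PiE_iff extensional_restrict)

lemma mcnaughton_plus:
  assumes f: "f \<in> mcnaughton I" and g: "g \<in> mcnaughton I"
  shows "mv_plus (free_mv I) f g \<in> mcnaughton I"
proof -
  obtain L :: "(int \<times> ('a \<Rightarrow> int)) set" where L: "finite L"
    "\<And>x. x \<in> cube I \<Longrightarrow> \<exists>(b, a)\<in>L. f x = of_int b + (\<Sum>i\<in>I. of_int (a i) * x i)"
    using mcnaughtonD(5)[OF f] by blast
  obtain M :: "(int \<times> ('a \<Rightarrow> int)) set" where M: "finite M"
    "\<And>x. x \<in> cube I \<Longrightarrow> \<exists>(b, a)\<in>M. g x = of_int b + (\<Sum>i\<in>I. of_int (a i) * x i)"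
    using mcnaughtonD(5)[OF g] by blast
  \<comment> \<open>The pieces of a truncated sum are the sums of pieces and the constant 1.\<close>
  define N where "N = insert (1, \<lambda>_. 0) ((\<lambda>((b, a), (b', a')). (b + b', \<lambda>i. a i + a' i)) ` (L \<times> M))"
  show ?thesis unfolding free_mv_sel
  proof (rule mcnaughtonI)
    show "min 1 (f x + g x) \<in> {0..1}" if "x \<in> cube I" for x
      using mcnaughtonD(1)[OF f that] mcnaughtonD(1)[OF g that] by simp
    show "continuous_on (cube I) (\<lambda>x. min 1 (f x + g x))"
      using mcnaughtonD(4)[OF f] mcnaughtonD(4)[OF g] by (intro continuous_intros)
    show "finite N" using L(1) M(1) by (simp add: N_def)
    show "\<exists>(b, a)\<in>N. min 1 (f x + g x) = of_int b + (\<Sum>i\<in>I. of_int (a i) * x i)" if x: "x \<in> cube I" for x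
    proof (cases "f x + g x \<le> 1")
      case True
      obtain b a where ba: "(b, a) \<in> L" "f x = of_int b + (\<Sum>i\<in>I. of_int (a i) * x i)" using L(2)[OF x] by blast
      obtain b' a' where ba': "(b', a') \<in> M" "g x = of_int b' + (\<Sum>i\<in>I. of_int (a' i) * x i)" using M(2)[OF x] by blast
      have "(b + b', \<lambda>i. a i + a' i) \<in> N" using ba(1) ba'(1) by (force simp: N_def)
      moreover have "min 1 (f x + g x) = of_int (b + b') + (\<Sum>i\<in>I. of_int (a i + a' i) * x i)"
        using True ba(2) ba'(2) by (simp add: algebra_simps sum.distrib)
      ultimately show ?thesis by (intro bexI[of _ "(b + b', \<lambda>i. a i + a' i)"]) simp_all
    next
      case False
      then show ?thesis by (intro bexI[of _ "(1, \<lambda>_. 0)"]) (auto simp: N_def)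
    qed
  qed
qed

lemma mcnaughton_neg:
  assumes f: "f \<in> mcnaughton I" shows "mv_neg (free_mv I) f \<in> mcnaughton I"
proof -
  obtain L :: "(int \<times> ('a \<Rightarrow> int)) set" where L: "finite L"
    "\<And>x. x \<in> cube I \<Longrightarrow> \<exists>(b, a)\<in>L. f x = of_int b + (\<Sum>i\<in>I. of_int (a i) * x i)"
    using mcnaughtonD(5)[OF f] by blast
  show ?thesis unfolding free_mv_sel
  proof (rule mcnaughtonI)
    show "1 - f x \<in> {0..1}" if "x \<in> cube I" for x using mcnaughtonD(1,2)[OF f that] by simp
    show "continuous_on (cube I) (\<lambda>x. 1 - f x)"
      using mcnaughtonD(4)[OF f] by (intro continuous_intros)
    show "finite ((\<lambda>(b, a). (1 - b, \<lambda>i. - a i)) ` L)" using L(1) by simp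
    show "\<exists>(b, a)\<in>(\<lambda>(b, a). (1 - b, \<lambda>i. - a i)) ` L. 1 - f x = of_int b + (\<Sum>i\<in>I. of_int (a i) * x i)"
      if x: "x \<in> cube I" for x
    proof -
      obtain b a where ba: "(b, a) \<in> L" "f x = of_int b + (\<Sum>i\<in>I. of_int (a i) * x i)" using L(2)[OF x] by blast
      have "(1 - b, \<lambda>i. - a i) \<in> (\<lambda>(b, a). (1 - b, \<lambda>i. - a i)) ` L" using ba(1) by force
      moreover have "1 - f x = of_int (1 - b) + (\<Sum>i\<in>I. of_int (- a i) * x i)"
        using ba(2) by (simp add: sum_negf)
      ultimately show ?thesis by (intro bexI[of _ "(1 - b, \<lambda>i. - a i)"]) simp_all
    qed
  qed
qed

lemma mcnaughton_zero: "mv_zero (free_mv I) \<in> mcnaughton I"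
  unfolding free_mv_sel by (rule mcnaughtonI[where L = "{(0, \<lambda>_. 0)}"]) auto

lemma mcnaughton_gen:
  assumes "finite I" "i \<in> I" shows "free_gen I i \<in> mcnaughton I"
  unfolding free_gen_def
proof (rule mcnaughtonI)
  show "x i \<in> {0..1}" if "x \<in> cube I" for x using that assms(2) by (auto simp: cube_def PiE_iff)
  show "continuous_on (cube I) (\<lambda>x. x i)"
    by (rule continuous_on_subset[OF continuous_on_product_coordinates]) simp
  show "\<exists>(b, a)\<in>{(0, delta i)}. x i = of_int b + (\<Sum>j\<in>I. of_int (a j) * x j)" for x :: "'a \<Rightarrow> real"
  proof -
    have "(\<Sum>j\<in>I. of_int (delta i j) * x j) = (\<Sum>j\<in>I. if j = i then x j else 0)"
      by (intro sum.cong) (auto simp: delta_def)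
    then show ?thesis using assms by simp
  qed
qed simp

lemma mv_algebra_free: "mv_algebra (free_mv I)"
proof
  show "mv_plus (free_mv I) f g \<in> mv_carrier (free_mv I)"
    if "f \<in> mv_carrier (free_mv I)" "g \<in> mv_carrier (free_mv I)" for f g :: "('a \<Rightarrow> real) \<Rightarrow> real"
    using that mcnaughton_plus by (simp only: free_mv_sel(1))
  show "mv_neg (free_mv I) f \<in> mv_carrier (free_mv I)"
    if "f \<in> mv_carrier (free_mv I)" for f :: "('a \<Rightarrow> real) \<Rightarrow> real"
    using that mcnaughton_neg by (simp only: free_mv_sel(1))
  show "mv_zero (free_mv I) \<in> mv_carrier (free_mv I)"
    using mcnaughton_zero by (simp only: free_mv_sel(1))
next
  fix f :: "('a \<Rightarrow> real) \<Rightarrow> real" assume "f \<in> mv_carrier (free_mv I)"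
  then have f: "f \<in> mcnaughton I" by simp
  have e: "f x = undefined" if "x \<notin> cube I" for x
    using mcnaughtonD(3)[OF f] that by (metis restrict_apply)
  show "mv_plus (free_mv I) f (mv_zero (free_mv I)) = f"
    "mv_neg (free_mv I) (mv_neg (free_mv I) f) = f"
    "mv_plus (free_mv I) f (mv_neg (free_mv I) (mv_zero (free_mv I))) = mv_neg (free_mv I) (mv_zero (free_mv I))"
    using mcnaughtonD(1,2)[OF f] e by (auto simp: fun_eq_iff min_def intro: antisym)
  fix g :: "('a \<Rightarrow> real) \<Rightarrow> real" assume "g \<in> mv_carrier (free_mv I)"
  then have g: "g \<in> mcnaughton I" by simp
  show "mv_plus (free_mv I) f g = mv_plus (free_mv I) g f"
    "mv_plus (free_mv I) (mv_neg (free_mv I) (mv_plus (free_mv I) (mv_neg (free_mv I) f) g)) g =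
      mv_plus (free_mv I) (mv_neg (free_mv I) (mv_plus (free_mv I) (mv_neg (free_mv I) g) f)) f"
    using mcnaughtonD(1,2)[OF f] mcnaughtonD(1,2)[OF g] by (auto simp: fun_eq_iff min_def)
  fix h :: "('a \<Rightarrow> real) \<Rightarrow> real" assume "h \<in> mv_carrier (free_mv I)"
  then have h: "h \<in> mcnaughton I" by simp
  show "mv_plus (free_mv I) (mv_plus (free_mv I) f g) h = mv_plus (free_mv I) f (mv_plus (free_mv I) g h)"
    using mcnaughtonD(1,2)[OF f] mcnaughtonD(1,2)[OF g] mcnaughtonD(1,2)[OF h]
    by (fastforce simp: fun_eq_iff min_def)
qed

lemma mv_congruence_agree:
  assumes "S \<subseteq> cube I" shows "mv_congruence (free_mv I) (agree_cong I S)"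
proof -
  have "equiv (mcnaughton I) (agree_cong I S)"
    by (intro equivI refl_onI symI transI) (auto simp: agree_cong_def)
  moreover have "(mv_neg (free_mv I) f, mv_neg (free_mv I) g) \<in> agree_cong I S"
    if "(f, g) \<in> agree_cong I S" for f g
    using that assms mcnaughton_neg[of f I] mcnaughton_neg[of g I] by (auto simp: agree_cong_def)
  moreover have "(mv_plus (free_mv I) f g, mv_plus (free_mv I) f' g') \<in> agree_cong I S"
    if "(f, f') \<in> agree_cong I S" "(g, g') \<in> agree_cong I S" for f f' g g'
    using that assms mcnaughton_plus[of f I g] mcnaughton_plus[of f' I g'] by (auto simp: agree_cong_def)
  ultimately show ?thesis by (simp add: mv_congruence_def del: free_mv_sel(2,3))
qed

lemma mv_algebra_free_quot: "S \<subseteq> cube I \<Longrightarrow> mv_algebra (free_quot I S)"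
  unfolding free_quot_def by (intro mv_algebra_quotient mv_congruence_agree mv_algebra_free)

section \<open>Terms as McNaughton functions, and points as homomorphisms\<close>

definition term_fun :: "'i set \<Rightarrow> 'i fm \<Rightarrow> ('i \<Rightarrow> real) \<Rightarrow> real" where
  "term_fun I t = mv_eval (free_mv I) (free_gen I) t"

lemma term_fun_apply: "x \<in> cube I \<Longrightarrow> term_fun I t x = std_eval x t"
  unfolding term_fun_def by (induction t) (auto simp: free_gen_def)

lemma term_fun_mcnaughton:
  assumes "finite I" "atoms t \<subseteq> I" shows "term_fun I t \<in> mcnaughton I"
  using assms(2) unfolding term_fun_def
  by (induction t) (auto intro: mcnaughton_gen assms(1) mcnaughton_neg mcnaughton_plus mcnaughton_zero
      simp del: free_mv_sel)

lemma coh_class_eq: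
  assumes "finite E" "atoms t \<subseteq> E"
  shows "coh_class E t = agree_cong E (coherent_set E) `` {term_fun E t}"
proof -
  have "coherent_set E \<subseteq> cube E" using truth_hull_subset_cube coherent_set_eq[OF assms(1)] by simp
  then have c: "mv_congruence (free_mv E) (agree_cong E (coherent_set E))" by (rule mv_congruence_agree)
  show ?thesis using assms(2)
  proof (induction t)
    case (Neg t)
    then show ?case
      using quotient_neg[OF c] term_fun_mcnaughton[OF assms(1)]
      by (simp add: coh_class_def free_quot_def term_fun_def del: free_mv_sel(2-))
  next
    case (Oplus s t)
    then show ?case
      using quotient_plus[OF c] term_fun_mcnaughton[OF assms(1)]
      by (simp add: coh_class_def free_quot_def term_fun_def del: free_mv_sel(2-))
  qed (simp_all add: coh_class_def free_quot_def term_fun_def quotient_sel[OF c] del: free_mv_sel(2-))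
qed

lemma coh_class_carrier:
  assumes "finite E" "atoms t \<subseteq> E"
  shows "coh_class E t \<in> mv_carrier (free_quot E (coherent_set E))"
  using term_fun_mcnaughton[OF assms]
  by (simp add: coh_class_eq[OF assms] free_quot_def mv_quotient_def quotientI)

text \<open>A homomorphism to the standard algebra is evaluation at the point of its values on the
  generators. If that point violated an inequality of the coherent set, the truncated violation
  would be a term that vanishes on the coherent set but not at the point.\<close>

theorem hom_is_evaluation:
  assumes fE: "finite E" and hom: "mv_hom (free_quot E (coherent_set E)) std_mv h"
  obtains x where "x \<in> truth_hull E" "\<And>t. atoms t \<subseteq> E \<Longrightarrow> h (coh_class E t) = std_eval x t"
proof
  let ?Q = "free_quot E (coherent_set E)" and ?R = "agree_cong E (coherent_set E)"
  define x where "x = (\<lambda>\<phi>\<in>E. h (coh_class E (Atom \<phi>)))"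
  have C: "coherent_set E = truth_hull E" by (rule coherent_set_eq[OF fE])
  have step: "coh_class E Bot = mv_zero ?Q" "coh_class E (Neg t) = mv_neg ?Q (coh_class E t)"
    "coh_class E (Oplus s t) = mv_plus ?Q (coh_class E s) (coh_class E t)" for s t
    by (simp_all add: coh_class_def)
  have h: "h (mv_zero ?Q) = 0" "\<And>a. a \<in> mv_carrier ?Q \<Longrightarrow> h (mv_neg ?Q a) = 1 - h a"
    "\<And>a b. a \<in> mv_carrier ?Q \<Longrightarrow> b \<in> mv_carrier ?Q \<Longrightarrow> h (mv_plus ?Q a b) = min 1 (h a + h b)"
    "\<And>a. a \<in> mv_carrier ?Q \<Longrightarrow> h a \<in> {0..1}"
    using hom by (auto simp: mv_hom_def)
  show val: "h (coh_class E t) = std_eval x t" if "atoms t \<subseteq> E" for t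
    using that by (induction t) (auto simp: x_def step h coh_class_carrier[OF fE])
  have x01: "x \<phi> \<in> {0..1}" if "\<phi> \<in> E" for \<phi>
    using that h(4)[OF coh_class_carrier[OF fE, of "Atom \<phi>"]] by (simp add: x_def)
  obtain H where H: "\<forall>f\<in>H. {v. f v \<noteq> 0} \<subseteq> insert Top (Pr ` E)"
    "truth_hull E = {x \<in> extensional E. \<forall>f\<in>H. ev f (point_eval x) \<ge> 0}"
    using coherent_set_inequalities[OF fE] by (elim exE conjE) (rule that)
  show "x \<in> truth_hull E"
  proof (rule ccontr)
    assume "x \<notin> truth_hull E"
    then obtain f where f: "f \<in> H" "ev f (point_eval x) < 0"
      unfolding H(2) by (auto simp: x_def not_le)
    have "{v. f v \<noteq> 0} \<subseteq> insert Top (Atom ` P ` E)" using H(1) f(1) by (auto simp: image_image)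
    from literal_form[OF finite_imageI[OF fE] this] obtain ps k where
      ps: "set ps \<subseteq> Atom ` P ` E \<union> (Neg \<circ> Atom) ` P ` E"
      and evf: "\<forall>y. ev f (std_eval y) = of_int k - (\<Sum>\<psi>\<leftarrow>ps. std_eval y \<psi>)"
      by (elim exE conjE) (rule that)
    define s where "s = (\<lambda>z. \<Sum>\<psi>\<leftarrow>ps. point_eval z \<psi>)"
    have evz: "ev f (point_eval z) = of_int k - s z" for z
      using evf by (simp add: point_eval_def s_def)
    have bounds: "point_eval z \<psi> \<in> {0..1}" if "\<And>\<phi>. \<phi> \<in> E \<Longrightarrow> z \<phi> \<in> {0..1}" "\<psi> \<in> set ps" for z \<psi>
      unfolding point_eval_def using that ps by (intro std_eval_bounds) auto
    have hull01: "z \<phi> \<in> {0..1}" if "z \<in> truth_hull E" "\<phi> \<in> E" for z \<phi>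
      using that truth_hull_subset_cube[of E] by (auto simp: cube_def PiE_iff)
    have s_hull: "s z \<le> of_int k" if "z \<in> truth_hull E" for z
      using that f(1) evz[of z] unfolding H(2) by auto
    have s_x: "s x > of_int k" using f(2) evz[of x] by simp
    \<comment> \<open>Some point of the hull is at hand, and it shows that \<open>k\<close> is
      nonnegative.\<close>
    have "truth_point E (\<lambda>_. 0) \<in> truth_hull E" by (rule truth_point_in_hull) simp
    then have "0 \<le> s (truth_point E (\<lambda>_. 0))" "s (truth_point E (\<lambda>_. 0)) \<le> of_int k"
      using bounds[OF hull01] s_hull unfolding s_def by (fastforce intro!: sum_list_nonneg)+
    then have k: "k \<ge> 0" by simp
    \<comment> \<open>Each literal is at most 1 while their sum at \<open>x\<close> exceeds
      \<open>k\<close>, so the good sequence has an entry with index \<open>k\<close>.\<close>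
    have "s x \<le> (\<Sum>\<psi>\<leftarrow>ps. 1)" unfolding s_def using bounds[OF x01] by (intro sum_list_mono) auto
    then have len: "nat k < length ps" using s_x k by (simp add: sum_list_triv)
    \<comment> \<open>The entry with index \<open>k\<close> is the amount by which the sum exceeds
      \<open>k\<close>, clamped: this is the truncated violation as a formula.\<close>
    define \<theta> where "\<theta> = good_seq ps ! nat k"
    have \<theta>: "point_eval z \<theta> = clamp01 (s z - of_int k)" if "\<And>\<phi>. \<phi> \<in> E \<Longrightarrow> z \<phi> \<in> {0..1}" for z
      using eval_good_seq[of ps "\<lambda>p. z (event_of p)" "nat k"] bounds[of z, OF that] len k
      by (simp add: point_eval_def s_def \<theta>_def)
    have "atoms \<psi> \<subseteq> P ` E" if "\<psi> \<in> set ps" for \<psi>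
      using subsetD[OF ps that] by auto
    moreover have "\<theta> \<in> set (good_seq ps)" using len by (simp add: \<theta>_def)
    ultimately have "atoms \<theta> \<subseteq> P ` E" using atoms_good_seq[of \<theta> ps] by blast
    then have t: "atoms (bullet \<theta>) \<subseteq> E" by (auto simp: bullet_def fm.set_map)
    have "term_fun E (bullet \<theta>) z = term_fun E Bot z" if z: "z \<in> truth_hull E" for z
    proof -
      have "z \<in> cube E" using z truth_hull_subset_cube by blast
      then show ?thesis using \<theta>[OF hull01[OF z]] s_hull[OF z]
        by (simp add: term_fun_apply std_eval_bullet clamp01_def)
    qed
    then have "(term_fun E (bullet \<theta>), term_fun E Bot) \<in> ?R"
      using term_fun_mcnaughton[OF fE t] term_fun_mcnaughton[OF fE, of Bot] by (simp add: agree_cong_def C)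
    moreover have "equiv (mcnaughton E) ?R"
      using mv_congruence_agree[of "coherent_set E" E] truth_hull_subset_cube by (simp add: mv_congruence_def C)
    ultimately have "coh_class E (bullet \<theta>) = coh_class E Bot"
      using coh_class_eq[OF fE t] coh_class_eq[OF fE, of Bot] equiv_class_eq by fastforce
    then have "std_eval x (bullet \<theta>) = 0" using val[OF t] val[of Bot] by simp
    moreover have "std_eval x (bullet \<theta>) > 0"
      using \<theta>[OF x01] s_x by (simp add: std_eval_bullet clamp01_def)
    ultimately show False by simp
  qed
qed

theorem evaluation_is_hom:
  assumes fE: "finite E" and x: "x \<in> truth_hull E"
  obtains h where "mv_hom (free_quot E (coherent_set E)) std_mv h"
    "\<And>t. atoms t \<subseteq> E \<Longrightarrow> h (coh_class E t) = std_eval x t"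
proof
  let ?R = "agree_cong E (coherent_set E)"
  have C: "coherent_set E = truth_hull E" by (rule coherent_set_eq[OF fE])
  have xc: "x \<in> cube E" using x truth_hull_subset_cube by blast
  have c: "mv_congruence (free_mv E) ?R" using truth_hull_subset_cube C by (intro mv_congruence_agree) simp
  \<comment> \<open>Any representative may be evaluated: members of one class agree on the coherent
    set, and \<open>x\<close> lies in it.\<close>
  define h :: "((event \<Rightarrow> real) \<Rightarrow> real) set \<Rightarrow> real" where "h = (\<lambda>X. (SOME f. f \<in> X) x)"
  have h: "h (?R `` {f}) = f x" if f: "f \<in> mcnaughton E" for f
  proof -
    have "f \<in> ?R `` {f}" using f by (simp add: agree_cong_def)
    then have "(SOME g. g \<in> ?R `` {f}) \<in> ?R `` {f}" by (rule someI[where P = "\<lambda>g. g \<in> ?R `` {f}"])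
    then show ?thesis using x by (simp add: h_def agree_cong_def C)
  qed
  show "mv_hom (free_quot E (coherent_set E)) std_mv h"
    unfolding mv_hom_def free_quot_def quotient_sel[OF c]
  proof (intro conjI ballI)
    show "h ` (mv_carrier (free_mv E) // ?R) \<subseteq> mv_carrier std_mv"
      using mcnaughtonD(1,2) xc by (auto simp: h elim!: quotientE)
    show "h (?R `` {mv_zero (free_mv E)}) = mv_zero std_mv"
      using h[OF mcnaughton_zero] xc by simp
    fix X assume "X \<in> mv_carrier (free_mv E) // ?R"
    then obtain f where f: "X = ?R `` {f}" "f \<in> mcnaughton E" by (auto elim: quotientE)
    show "h (mv_neg (mv_quotient (free_mv E) ?R) X) = mv_neg std_mv (h X)"
      using f quotient_neg[OF c, of f] h[OF mcnaughton_neg[OF f(2)]] h[OF f(2)] xc by simp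
    fix Y assume "Y \<in> mv_carrier (free_mv E) // ?R"
    then obtain g where g: "Y = ?R `` {g}" "g \<in> mcnaughton E" by (auto elim: quotientE)
    show "h (mv_plus (mv_quotient (free_mv E) ?R) X Y) = mv_plus std_mv (h X) (h Y)"
      using f g quotient_plus[OF c, of f g] h[OF mcnaughton_plus[OF f(2) g(2)]] h[OF f(2)] h[OF g(2)] xc by simp
  qed
  show "h (coh_class E t) = std_eval x t" if "atoms t \<subseteq> E" for t
    using that h[OF term_fun_mcnaughton[OF fE that]] xc by (simp add: coh_class_eq fE term_fun_apply)
qed

text \<open>A homomorphism from a copy, composed with the isomorphism, is one from the quotient and
  hence a point. Conversely, a single copy tests all points through their evaluations.\<close>

theorem fp_entails_iff:
  assumes E: "E = events \<Phi> \<union> events \<Psi>"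
  shows "fp_entails TYPE('a elem) E \<Phi> \<Psi> \<longleftrightarrow>
    (\<forall>x\<in>truth_hull E. point_eval x \<Phi> = 1 \<longrightarrow> point_eval x \<Psi> = 1)"
proof
  let ?Q = "free_quot E (coherent_set E)"
  have fE: "finite E" by (simp add: E)
  have at: "atoms (bullet \<Phi>) \<subseteq> E" "atoms (bullet \<Psi>) \<subseteq> E"
    by (auto simp: E bullet_def events_def fm.set_map)
  then have ct: "bullet \<Phi> \<in> mv_carrier (term_alg E)" "bullet \<Psi> \<in> mv_carrier (term_alg E)"
    by (simp_all add: term_alg_def)
  have Q: "mv_algebra ?Q" using truth_hull_subset_cube coherent_set_eq[OF fE] by (intro mv_algebra_free_quot) simp
  {
    assume valid: "\<forall>x\<in>truth_hull E. point_eval x \<Phi> = 1 \<longrightarrow> point_eval x \<Psi> = 1"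
    show "fp_entails TYPE('a elem) E \<Phi> \<Psi>" unfolding fp_entails_def
    proof (intro allI impI)
      fix A :: "'a elem mv" and e h
      assume "coherent_valuation E A e" and h: "mv_hom A std_mv h" and \<Phi>: "h (e (bullet \<Phi>)) = 1"
      then obtain f where f: "mv_iso ?Q A f" "\<forall>t\<in>mv_carrier (term_alg E). e t = f (coh_class E t)"
        by (auto simp: coherent_valuation_def)
      have "mv_hom ?Q std_mv (h \<circ> f)" using f(1) h by (intro mv_hom_compose) (auto simp: mv_iso_def)
      from hom_is_evaluation[OF fE this] obtain x where x: "x \<in> truth_hull E"
        "\<And>t. atoms t \<subseteq> E \<Longrightarrow> (h \<circ> f) (coh_class E t) = std_eval x t" by blast
      have "h (e (bullet \<Phi>)) = point_eval x \<Phi>" "h (e (bullet \<Psi>)) = point_eval x \<Psi>"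
        using x(2)[OF at(1)] x(2)[OF at(2)] f(2) ct by (simp_all add: std_eval_bullet)
      then show "h (e (bullet \<Psi>)) = 1" using valid x(1) \<Phi> by simp
    qed
  next
    assume ent: "fp_entails TYPE('a elem) E \<Phi> \<Psi>"
    show "\<forall>x\<in>truth_hull E. point_eval x \<Phi> = 1 \<longrightarrow> point_eval x \<Psi> = 1"
    proof (intro ballI impI)
      fix x assume x: "x \<in> truth_hull E" and \<Phi>: "point_eval x \<Phi> = 1"
      obtain h where h: "mv_hom ?Q std_mv h" "\<And>t. atoms t \<subseteq> E \<Longrightarrow> h (coh_class E t) = std_eval x t"
        using evaluation_is_hom[OF fE x] by blast
      \<comment> \<open>The second summand of \<open>'a elem\<close> accommodates the copy, whatever
        \<open>'a\<close> is.\<close>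
      define f :: "((event \<Rightarrow> real) \<Rightarrow> real) set \<Rightarrow> 'a elem" where "f = Inr"
      have inj: "inj_on f (mv_carrier ?Q)" by (simp add: f_def)
      let ?A = "mv_copy f ?Q" and ?h = "h \<circ> inv_into (mv_carrier ?Q) f"
      have iso: "mv_iso ?Q ?A f" by (rule mv_iso_copy[OF inj])
      then have A: "mv_algebra ?A \<and> (\<exists>f. mv_iso ?Q ?A f)" using mv_algebra_iso[OF Q] by blast
      have coh: "coherent_valuation E ?A (\<lambda>t. f (coh_class E t))"
        using iso by (auto simp: coherent_valuation_def)
      have hom: "mv_hom ?A std_mv ?h" by (rule mv_hom_iso_inverse[OF Q iso h(1)])
      have val: "?h (f (coh_class E t)) = std_eval x t" if "atoms t \<subseteq> E" for t
        using inv_into_f_f[OF inj coh_class_carrier[OF fE that]] h(2)[OF that] by simp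
      have "?h (f (coh_class E (bullet \<Phi>))) = 1" using \<Phi> val[OF at(1)] by (simp add: std_eval_bullet)
      with ent[unfolded fp_entails_def, rule_format, OF A coh hom]
      have "?h (f (coh_class E (bullet \<Psi>))) = 1" .
      then show "point_eval x \<Psi> = 1" using val[OF at(2)] by (simp add: std_eval_bullet)
    qed
  }
qed

theorem theorem5p12:
  fixes \<Phi> \<Psi> :: modal and E :: "event set"
  assumes "E = events \<Phi> \<union> events \<Psi>"
  shows "{\<Phi>} \<turnstile>\<^sub>F\<^sub>P \<Psi> \<longleftrightarrow> fp_entails TYPE('a elem) E \<Phi> \<Psi>"
  using fp_entails_iff[OF assms] fp_completeness[OF assms] fp_soundness[OF assms] by blast

end
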